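(* Let $(X,g)$ be any compact Hermitian manifold of complex dimension $2$ and $\omega$ its associated real $(1,1)$-form. Then for every $\varphi\in\mathcal{P}_{\omega}$, $$\frac{1}{3}\,\mathcal{I}^{\mathrm{AY}}_{\omega}(\varphi)\le\mathcal{J}^{\mathrm{AY}}_{\omega}(\varphi)\le\frac{2}{3}\,\mathcal{I}^{\mathrm{AY}}_{\omega}(\varphi).$$
   Context: The associated real $(1,1)$-form of $g=(g_{i\overline j})$ is $\omega=\sqrt{-1}\,g_{i\overline{j}}\,dz^{i}\wedge d\overline{z^{j}}$ (not assumed closed). For a real-valued smooth function $\varphi$, $\omega_\varphi:=\omega+\sqrt{-1}\,\partial\overline{\partial}\varphi$, and $\mathcal{P}_{\omega}:=\{\varphi\in C^{\infty}(X)_{\mathbb{R}} : \omega_\varphi>0\}$ (real-valued smooth functions with $\omega_\varphi$ positive definite on $X$). $V_\omega:=\int_X\omega^2$. Set $$\mathcal{A}_{\omega}(\varphi):=\frac{1}{2V_{\omega}}\int_{X}\varphi\cdot(-\sqrt{-1})\,\partial\omega\wedge\overline{\partial}\varphi,\qquad \mathcal{B}_{\omega}(\varphi):=\frac{1}{2V_{\omega}}\int_{X}\varphi\cdot\sqrt{-1}\,\overline{\partial}\omega\wedge\partial\varphi,$$ $$\mathcal{I}^{\mathrm{AY}}_{\omega}(\varphi):=\frac{1}{V_{\omega}}\int_{X}\varphi\,(\omega^{2}-\omega_{\varphi}^{2})+2\mathcal{A}_{\omega}(\varphi)+2\mathcal{B}_{\omega}(\varphi),$$ $$\mathcal{J}^{\mathrm{AY}}_{\omega}(\varphi):=\frac{1}{V_{\omega}}\int_{0}^{1}\int_{X}\varphi\,(\omega^{2}-\omega_{s\cdot\varphi}^{2})\,ds+\mathcal{A}_{\omega}(\varphi)+\mathcal{B}_{\omega}(\varphi).$$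 *)

theory Defs
  imports "HOL-Analysis.Analysis" "HOL-Library.Complex_Order"
begin

section \<open>Smooth and holomorphic maps on open sets\<close>

fun Ck_on :: "nat \<Rightarrow> 'v::real_normed_vector set \<Rightarrow> ('v \<Rightarrow> 'w::real_normed_vector) \<Rightarrow> bool" where
  "Ck_on 0 S f \<longleftrightarrow> continuous_on S f"
| "Ck_on (Suc k) S f \<longleftrightarrow>
     (\<forall>x\<in>S. f differentiable (at x)) \<and> (\<forall>v. Ck_on k S (\<lambda>x. frechet_derivative f (at x) v))"

definition smooth_on :: "'v::real_normed_vector set \<Rightarrow> ('v \<Rightarrow> 'w::real_normed_vector) \<Rightarrow> bool" where
  "smooth_on S f \<longleftrightarrow> open S \<and> (\<forall>k. Ck_on k S f)"

text \<open>The Wirtinger operators: with \<open>z\<^sup>i = x\<^sup>i + \<i> y\<^sup>i\<close>, the coordinate fields of \<open>x\<^sup>i\<close> and \<open>y\<^sup>i\<close> are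
  the constant fields \<^term>\<open>axis i 1\<close> and \<^term>\<open>axis i \<i>\<close>.\<close>

definition pd_z :: "'n::finite \<Rightarrow> (complex^'n \<Rightarrow> complex) \<Rightarrow> complex^'n \<Rightarrow> complex" where
  "pd_z i f z = (frechet_derivative f (at z) (axis i 1) - \<i> * frechet_derivative f (at z) (axis i \<i>)) / 2"

definition pd_zbar :: "'n::finite \<Rightarrow> (complex^'n \<Rightarrow> complex) \<Rightarrow> complex^'n \<Rightarrow> complex" where
  "pd_zbar i f z = (frechet_derivative f (at z) (axis i 1) + \<i> * frechet_derivative f (at z) (axis i \<i>)) / 2"

definition holomorphic_map_on :: "(complex^'n) set \<Rightarrow> (complex^'n \<Rightarrow> complex^'m) \<Rightarrow> bool" where
  "holomorphic_map_on S f \<longleftrightarrow>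
     smooth_on S f \<and> (\<forall>z\<in>S. \<forall>i k. pd_zbar i (\<lambda>w. f w $ k) z = 0)"


section \<open>Complex manifolds\<close>

text \<open>A chart is a coordinate domain together with a coordinate map, whose values outside the
  domain are irrelevant.\<close>

type_synonym ('a, 'n) chart = "'a set \<times> ('a \<Rightarrow> complex^'n)"

definition chart_image :: "('a, 'n::finite) chart \<Rightarrow> (complex^'n) set" where
  "chart_image c = snd c ` fst c"

definition chart_inv :: "('a, 'n::finite) chart \<Rightarrow> complex^'n \<Rightarrow> 'a" where
  "chart_inv c = inv_into (fst c) (snd c)"

definition transition :: "('a, 'n::finite) chart \<Rightarrow> ('a, 'n) chart \<Rightarrow> complex^'n \<Rightarrow> complex^'n" where
  "transition c d = snd d \<circ> chart_inv c"

text \<open>\<open>X\<close> is a complex manifold of dimension \<open>CARD('n)\<close> with holomorphic atlas \<open>A\<close>, which need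
  not be maximal. Connectedness is not required.\<close>

definition complex_manifold :: "'a topology \<Rightarrow> ('a, 'n::finite) chart set \<Rightarrow> bool" where
  "complex_manifold X A \<longleftrightarrow>
     Hausdorff_space X \<and> second_countable X \<and>
     topspace X = (\<Union>c\<in>A. fst c) \<and>
     (\<forall>c\<in>A. openin X (fst c) \<and> open (chart_image c) \<and>
        homeomorphic_map (subtopology X (fst c)) (top_of_set (chart_image c)) (snd c)) \<and>
     (\<forall>c\<in>A. \<forall>d\<in>A. holomorphic_map_on (snd c ` (fst c \<inter> fst d)) (transition c d))"

definition smooth_function :: "('a, 'n::finite) chart set \<Rightarrow> ('a \<Rightarrow> real) \<Rightarrow> bool" where
  "smooth_function A \<phi> \<longleftrightarrow> (\<forall>c\<in>A. smooth_on (chart_image c) (\<phi> \<circ> chart_inv c))"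


section \<open>Hermitian metrics\<close>

definition hermitian_pos_def :: "complex^'n^'n \<Rightarrow> bool" where
  "hermitian_pos_def M \<longleftrightarrow>
     (\<forall>i j. M $ j $ i = cnj (M $ i $ j)) \<and>
     (\<forall>v::complex^'n. v \<noteq> 0 \<longrightarrow> 0 < Re (\<Sum>i\<in>UNIV. \<Sum>j\<in>UNIV. M $ i $ j * v $ i * cnj (v $ j)))"

text \<open>\<open>g c z $ i $ j\<close> is the component of the metric with indices \<open>i\<close> and \<open>j\<close> barred, in the chart
  \<open>c\<close> at the point with coordinates \<open>z\<close>. The last clause is the tensor transformation law.\<close>

definition hermitian_metric ::
  "('a, 'n::finite) chart set \<Rightarrow> (('a, 'n) chart \<Rightarrow> complex^'n \<Rightarrow> complex^'n^'n) \<Rightarrow> bool" where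
  "hermitian_metric A g \<longleftrightarrow>
     (\<forall>c\<in>A. smooth_on (chart_image c) (g c) \<and> (\<forall>z\<in>chart_image c. hermitian_pos_def (g c z))) \<and>
     (\<forall>c\<in>A. \<forall>d\<in>A. \<forall>z\<in>snd c ` (fst c \<inter> fst d). \<forall>i j.
        g c z $ i $ j =
          (\<Sum>k\<in>UNIV. \<Sum>l\<in>UNIV.
             pd_z i (\<lambda>w. transition c d w $ k) z * cnj (pd_z j (\<lambda>w. transition c d w $ l) z) *
             g d (transition c d z) $ k $ l))"

definition compact_hermitian_manifold ::
  "'a topology \<Rightarrow> ('a, 'n::finite) chart set \<Rightarrow> (('a, 'n) chart \<Rightarrow> complex^'n \<Rightarrow> complex^'n^'n) \<Rightarrow> bool" where
  "compact_hermitian_manifold X A g \<longleftrightarrow>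
     compact_space X \<and> complex_manifold X A \<and> hermitian_metric A g"


section \<open>Differential forms\<close>

text \<open>An element of the exterior algebra on the differentials \<open>dz\<^sup>i\<close> and their conjugates is given by
  its coefficients: the entry at \<open>(I, J)\<close> is the coefficient of the product of the \<open>dz\<^sup>i\<close> with
  \<open>i \<in> I\<close>, followed by the product of the conjugate differentials with index in \<open>J\<close>, each product
  taken in increasing order.\<close>

type_synonym 'n ext = "(complex, 'n set \<times> 'n set) vec"

definition shuffle_sign :: "'n::{finite,linorder} set \<Rightarrow> 'n set \<Rightarrow> complex" where
  "shuffle_sign I K = (- 1) ^ card {(i, k). i \<in> I \<and> k \<in> K \<and> k < i}"

text \<open>The factor \<open>(- 1) ^ (card L * card (I - K))\<close> comes from moving the \<open>dz\<close> factors of \<open>b\<close> past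
  the conjugate factors of \<open>a\<close>.\<close>

definition ext_wedge :: "'n::{finite,linorder} ext \<Rightarrow> 'n ext \<Rightarrow> 'n ext" where
  "ext_wedge a b = (\<chi> IJ. case IJ of (I, J) \<Rightarrow>
     \<Sum>K\<in>Pow I. \<Sum>L\<in>Pow J.
       (- 1) ^ (card L * card (I - K)) * shuffle_sign K (I - K) * shuffle_sign L (J - L) *
       a $ (K, L) * b $ (I - K, J - L))"

definition ext_dz :: "'n::finite \<Rightarrow> 'n ext" where
  "ext_dz i = axis ({i}, {}) 1"

definition ext_dzbar :: "'n::finite \<Rightarrow> 'n ext" where
  "ext_dzbar i = axis ({}, {i}) 1"

text \<open>A differential form on the manifold is the family of its local expressions, one in each
  chart, as a function of the coordinates; only the values on the image of the chart matter.\<close>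

type_synonym ('a, 'n) dform = "('a, 'n) chart \<Rightarrow> complex^'n \<Rightarrow> 'n ext"

definition wedge :: "('a, 'n::{finite,linorder}) dform \<Rightarrow> ('a, 'n) dform \<Rightarrow> ('a, 'n) dform"
    (infixr "\<and>\<^sub>f" 75) where
  "\<alpha> \<and>\<^sub>f \<beta> = (\<lambda>c z. ext_wedge (\<alpha> c z) (\<beta> c z))"

definition form_add :: "('a, 'n::finite) dform \<Rightarrow> ('a, 'n) dform \<Rightarrow> ('a, 'n) dform"
    (infixl "+\<^sub>f" 65) where
  "\<alpha> +\<^sub>f \<beta> = (\<lambda>c z. \<alpha> c z + \<beta> c z)"

definition form_diff :: "('a, 'n::finite) dform \<Rightarrow> ('a, 'n) dform \<Rightarrow> ('a, 'n) dform"
    (infixl "-\<^sub>f" 65) where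
  "\<alpha> -\<^sub>f \<beta> = (\<lambda>c z. \<alpha> c z - \<beta> c z)"

definition form_scale :: "complex \<Rightarrow> ('a, 'n::finite) dform \<Rightarrow> ('a, 'n) dform"
    (infixr "*\<^sub>f" 80) where
  "r *\<^sub>f \<alpha> = (\<lambda>c z. r *s \<alpha> c z)"

text \<open>A function as a form of degree zero.\<close>

definition fun_form :: "('a \<Rightarrow> real) \<Rightarrow> ('a, 'n::finite) dform" where
  "fun_form \<phi> = (\<lambda>c z. axis ({}, {}) (of_real (\<phi> (chart_inv c z))))"

definition del :: "('a, 'n::{finite,linorder}) dform \<Rightarrow> ('a, 'n) dform" where
  "del \<alpha> = (\<lambda>c z. \<Sum>i\<in>UNIV. ext_wedge (ext_dz i) (\<chi> IJ. pd_z i (\<lambda>w. \<alpha> c w $ IJ) z))"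

definition delbar :: "('a, 'n::{finite,linorder}) dform \<Rightarrow> ('a, 'n) dform" where
  "delbar \<alpha> = (\<lambda>c z. \<Sum>i\<in>UNIV. ext_wedge (ext_dzbar i) (\<chi> IJ. pd_zbar i (\<lambda>w. \<alpha> c w $ IJ) z))"

definition associated_form ::
  "(('a, 'n::{finite,linorder}) chart \<Rightarrow> (complex, 'n) vec \<Rightarrow> ((complex, 'n) vec, 'n) vec) \<Rightarrow>
   ('a, 'n) dform" where
  "associated_form g =
     (\<lambda>c z. \<i> *s (\<Sum>i\<in>UNIV. \<Sum>j\<in>UNIV. g c z $ i $ j *s ext_wedge (ext_dz i) (ext_dzbar j)))"

text \<open>A form is positive definite if it is of type \<open>(1,1)\<close> and is obtained from Hermitian positive
  definite matrices as in \<^const>\<open>associated_form\<close>.\<close>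

definition positive_form :: "('a, 'n::{finite,linorder}) chart set \<Rightarrow> ('a, 'n) dform \<Rightarrow> bool" where
  "positive_form A \<alpha> \<longleftrightarrow>
     (\<exists>h. \<forall>c\<in>A. \<forall>z\<in>chart_image c.
        hermitian_pos_def (h c z) \<and> \<alpha> c z = associated_form h c z)"


section \<open>Integration of top-degree forms\<close>

definition active_charts ::
  "'a topology \<Rightarrow> ('a, 'n::finite) chart set \<Rightarrow> (('a, 'n) chart \<Rightarrow> 'a \<Rightarrow> real) \<Rightarrow> ('a, 'n) chart set" where
  "active_charts X A \<rho> = {c \<in> A. \<exists>x\<in>topspace X. \<rho> c x \<noteq> 0}"

definition finite_partition_of_unity ::
  "'a topology \<Rightarrow> ('a, 'n::finite) chart set \<Rightarrow> (('a, 'n) chart \<Rightarrow> 'a \<Rightarrow> real) \<Rightarrow> bool" where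
  "finite_partition_of_unity X A \<rho> \<longleftrightarrow>
     finite (active_charts X A \<rho>) \<and>
     (\<forall>c\<in>A. smooth_function A (\<rho> c) \<and> (\<forall>x\<in>topspace X. 0 \<le> \<rho> c x) \<and>
        X closure_of {x \<in> topspace X. \<rho> c x \<noteq> 0} \<subseteq> fst c) \<and>
     (\<forall>x\<in>topspace X. (\<Sum>c\<in>active_charts X A \<rho>. \<rho> c x) = 1)"

text \<open>The density of a top-degree form with respect to Lebesgue measure, for the complex
  orientation. With \<open>n = CARD('n)\<close>, reordering the product of all \<open>dz\<^sup>i\<close> followed by all conjugate
  differentials into the product of the pairs with equal index costs the sign
  \<open>(- 1) ^ (n * (n - 1) div 2)\<close>, and each pair equals \<open>- 2 * \<i>\<close> times \<open>dx\<^sup>i \<and> dy\<^sup>i\<close>.\<close>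

definition top_density :: "'n::finite ext \<Rightarrow> complex" where
  "top_density a =
     (- 1) ^ (CARD('n) * (CARD('n) - 1) div 2) * (- 2 * \<i>) ^ CARD('n) * a $ (UNIV, UNIV)"

text \<open>The integral of a top-degree form over a compact manifold. As usual, the value does not
  depend on the chosen partition of unity when the local expressions of the form are related by
  pullback along the transition maps.\<close>

definition form_integral ::
  "'a topology \<Rightarrow> ('a, 'n::{finite,linorder}) chart set \<Rightarrow> ('a, 'n) dform \<Rightarrow> complex" where
  "form_integral X A \<alpha> =
     (let \<rho> = (SOME \<rho>. finite_partition_of_unity X A \<rho>) in
       \<Sum>c\<in>active_charts X A \<rho>.
         LINT z:chart_image c|lborel. of_real (\<rho> c (chart_inv c z)) * top_density (\<alpha> c z))"


section \<open>Aubin--Yau functionals on complex surfaces\<close>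

definition deformed_form ::
  "('a, 'n::{finite,linorder}) dform \<Rightarrow> ('a \<Rightarrow> real) \<Rightarrow> ('a, 'n) dform" where
  "deformed_form \<omega> \<phi> = \<omega> +\<^sub>f \<i> *\<^sub>f del (delbar (fun_form \<phi>))"

definition potentials ::
  "('a, 'n::{finite,linorder}) chart set \<Rightarrow> ('a, 'n) dform \<Rightarrow> ('a \<Rightarrow> real) set" where
  "potentials A \<omega> = {\<phi>. smooth_function A \<phi> \<and> positive_form A (deformed_form \<omega> \<phi>)}"

definition volume :: "'a topology \<Rightarrow> ('a, 2) chart set \<Rightarrow> ('a, 2) dform \<Rightarrow> complex" where
  "volume X A \<omega> = form_integral X A (\<omega> \<and>\<^sub>f \<omega>)"

definition A_functional ::
  "'a topology \<Rightarrow> ('a, 2) chart set \<Rightarrow> ('a, 2) dform \<Rightarrow> ('a \<Rightarrow> real) \<Rightarrow> complex" where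
  "A_functional X A \<omega> \<phi> =
     1 / (2 * volume X A \<omega>) *
     form_integral X A (fun_form \<phi> \<and>\<^sub>f ((- \<i>) *\<^sub>f (del \<omega> \<and>\<^sub>f delbar (fun_form \<phi>))))"

definition B_functional ::
  "'a topology \<Rightarrow> ('a, 2) chart set \<Rightarrow> ('a, 2) dform \<Rightarrow> ('a \<Rightarrow> real) \<Rightarrow> complex" where
  "B_functional X A \<omega> \<phi> =
     1 / (2 * volume X A \<omega>) *
     form_integral X A (fun_form \<phi> \<and>\<^sub>f (\<i> *\<^sub>f (delbar \<omega> \<and>\<^sub>f del (fun_form \<phi>))))"

definition I_AY ::
  "'a topology \<Rightarrow> ('a, 2) chart set \<Rightarrow> ('a, 2) dform \<Rightarrow> ('a \<Rightarrow> real) \<Rightarrow> complex" where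
  "I_AY X A \<omega> \<phi> =
     1 / volume X A \<omega> *
     form_integral X A
       (fun_form \<phi> \<and>\<^sub>f (\<omega> \<and>\<^sub>f \<omega> -\<^sub>f deformed_form \<omega> \<phi> \<and>\<^sub>f deformed_form \<omega> \<phi>)) +
     2 * A_functional X A \<omega> \<phi> + 2 * B_functional X A \<omega> \<phi>"

definition J_AY ::
  "'a topology \<Rightarrow> ('a, 2) chart set \<Rightarrow> ('a, 2) dform \<Rightarrow> ('a \<Rightarrow> real) \<Rightarrow> complex" where
  "J_AY X A \<omega> \<phi> =
     1 / volume X A \<omega> *
     integral {0..1::real} (\<lambda>s. form_integral X A
       (fun_form \<phi> \<and>\<^sub>f
         (\<omega> \<and>\<^sub>f \<omega> -\<^sub>f
          deformed_form \<omega> (\<lambda>x. s * \<phi> x) \<and>\<^sub>f deformed_form \<omega> (\<lambda>x. s * \<phi> x)))) +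
     A_functional X A \<omega> \<phi> + B_functional X A \<omega> \<phi>"

text \<open>These functionals are defined as complex numbers. In the order of
  \<^theory>\<open>HOL-Library.Complex_Order\<close>, \<open>x \<le> y\<close> means \<open>Re x \<le> Re y\<close> and \<open>Im x = Im y\<close>; in particular
  \<open>r * x \<le> y\<close> and \<open>y \<le> s * x\<close> with real \<open>r \<noteq> s\<close> force \<open>x\<close> and \<open>y\<close> to be real.\<close>

end

theory Submission
  imports Defs
begin

text \<open>
  Write \<open>V\<close> for the volume of \<open>\<omega>\<close>, and for a metric \<open>h\<close> with form \<open>\<omega>\<^sub>h\<close> consider the gradient energy
  \<open>E(h) = \<integral> \<i> \<partial>\<phi> \<and> \<partial>bar \<phi> \<and> \<omega>\<^sub>h\<close>, whose integrand is nonnegative because \<open>h\<close> is positive definite.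
  Both functionals are nonnegative combinations of the energies \<open>E = E(g)\<close> of the given metric and
  \<open>E' = E(h)\<close> of the metric \<open>h\<close> with form \<open>\<omega>\<^sub>\<phi>\<close>:

    \<open>I = (E + E') / V\<close>  and  \<open>J = (2 E + E') / (3 V)\<close>,

  so the two inequalities say \<open>E + E' \<le> 2 E + E' \<le> 2 E + 2 E'\<close>. This is the lemma
  \<open>functionals_as_gradient_energies\<close>.

  The formulas come from integration by parts. Set \<open>P = - \<integral> \<phi> \<omega> \<and> \<i>\<partial>\<partial>bar \<phi>\<close>,
  \<open>Q = - \<integral> \<phi> (\<i>\<partial>\<partial>bar \<phi>)\<^sup>2\<close> and \<open>T = - \<i> \<integral> \<phi> \<partial>\<omega> \<and> \<partial>bar \<phi>\<close>. Expanding the square of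
  \<open>\<omega> + s \<i>\<partial>\<partial>bar \<phi>\<close> shows that the first terms of \<open>V I\<close> and \<open>V J\<close> are \<open>2 P + Q\<close> and \<open>P + Q / 3\<close>. Stokes'
  theorem for \<open>\<phi> \<omega> \<and> \<partial>bar \<phi>\<close> gives \<open>P + T = E\<close> (\<open>surface_integral_mixed_torsion\<close>). The same identity
  for \<open>\<omega>\<^sub>\<phi>\<close> reads \<open>P + Q + T = E'\<close>, because \<open>\<partial>\<omega>\<^sub>\<phi> = \<partial>\<omega>\<close>. In particular \<open>T\<close> is real, as \<open>P\<close> and \<open>E\<close> are, so the two torsion terms,
  which are conjugate to each other, are both equal to \<open>T / (2 V)\<close>, and everything is expressed by \<open>E\<close> and \<open>E'\<close>.

  Stokes' theorem is proved for vector fields of densities, in the form \<open>integral_divergence_zero\<close>.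
  The integral over the surface is a sum over charts weighted by a partition of unity \<open>\<rho>\<close>.
  In a single chart the divergence theorem moves the derivative from the field \<open>W\<close> onto \<open>\<rho>\<^sub>c\<close>. The
  pairing of \<open>\<partial>\<rho>\<^sub>c\<close> with \<open>W\<close> is a density, so its integral may be redistributed over all charts by
  the change of variables formula; there the terms add up to the derivative of \<open>\<Sum>\<^sub>c \<rho>\<^sub>c = 1\<close>, which is
  zero. What this needs is a calculus of \<open>C\<^sup>k\<close> maps, the existence of partitions of unity, and the fact
  that a holomorphic change of coordinates scales Lebesgue measure by \<open>\<bar>det\<bar>\<^sup>2\<close>.
\<close>

section \<open>The calculus of \<open>C\<^sup>k\<close> maps\<close>

text \<open>Membership in \<open>C\<^sup>k\<close> is local: on an open set the derivative of a function at a point of the set depends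
  only on its values there.\<close>

lemma Ck_on_cong:
  assumes "open S" "\<And>x. x \<in> S \<Longrightarrow> f x = g x"
  shows "Ck_on k S f \<longleftrightarrow> Ck_on k S g"
  using assms(2)
proof (induction k arbitrary: f g)
  case 0
  then show ?case by (auto intro: continuous_on_cong)
next
  case (Suc k)
  have imp: "f differentiable (at x) \<Longrightarrow> g differentiable (at x)"
    if "x \<in> S" and "\<And>x. x \<in> S \<Longrightarrow> f x = g x" for x and f g :: "'a \<Rightarrow> 'b"
    unfolding differentiable_def using that assms(1) has_derivative_transform_within_open by blast
  have diff: "f differentiable (at x) \<longleftrightarrow> g differentiable (at x)" if "x \<in> S" for x
    using imp[of x f g] imp[of x g f] that Suc.prems by metis
  have fr: "f differentiable (at x) \<Longrightarrow> frechet_derivative f (at x) = frechet_derivative g (at x)"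
    if "x \<in> S" for x
    using frechet_derivative_transform_within_open[of f x S g] assms(1) that Suc.prems by blast
  show ?case
  proof (cases "\<forall>x\<in>S. f differentiable (at x)")
    case True
    then have "frechet_derivative f (at x) v = frechet_derivative g (at x) v" if "x \<in> S" for x v
      using fr that by simp
    then have "Ck_on k S (\<lambda>x. frechet_derivative f (at x) v) \<longleftrightarrow>
        Ck_on k S (\<lambda>x. frechet_derivative g (at x) v)" for v
      by (rule Suc.IH)
    then show ?thesis using diff by simp
  next
    case False
    then show ?thesis using diff by auto
  qed
qed

lemma Ck_on_Suc_imp: "Ck_on (Suc k) S f \<Longrightarrow> Ck_on k S f"
proof (induction k arbitrary: f)
  case 0
  then show ?case
    by (auto intro!: continuous_at_imp_continuous_on simp: differentiable_imp_continuous_within)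
next
  case (Suc k)
  then show ?case by (metis Ck_on.simps(2))
qed

lemma Ck_on_imp_continuous_on: "Ck_on k S f \<Longrightarrow> continuous_on S f"
  by (induction k) (auto simp del: Ck_on.simps(2) dest: Ck_on_Suc_imp)

lemma Ck_on_Union:
  assumes "\<And>U. U \<in> \<U> \<Longrightarrow> open U" "\<And>U. U \<in> \<U> \<Longrightarrow> Ck_on k U f"
  shows "Ck_on k (\<Union>\<U>) f"
  using assms(2)
proof (induction k arbitrary: f)
  case 0
  then have "continuous_on (\<Union>\<U>) f"
    by (intro continuous_on_open_Union) (use assms(1) in auto)
  then show ?case by simp
next
  case (Suc k)
  have "Ck_on k (\<Union>\<U>) (\<lambda>x. frechet_derivative f (at x) v)" for v
    using Suc.prems by (intro Suc.IH) simp
  then show ?case using Suc.prems by auto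
qed

text \<open>The derivative may be given by any formula valid on the open set. The closure properties below are
  inductions on \<open>k\<close> in which this rule turns the usual differentiation rule into the step.\<close>

lemma Ck_on_SucI:
  assumes "open S" "\<And>x. x \<in> S \<Longrightarrow> (f has_derivative f' x) (at x)"
    and "\<And>v. Ck_on k S (\<lambda>x. f' x v)"
  shows "Ck_on (Suc k) S f"
proof -
  have "frechet_derivative f (at x) = f' x" if "x \<in> S" for x
    using assms(2)[OF that] frechet_derivative_at by metis
  then have "Ck_on k S (\<lambda>x. frechet_derivative f (at x) v)" for v
    using Ck_on_cong[OF assms(1), of "\<lambda>x. frechet_derivative f (at x) v" "\<lambda>x. f' x v"] assms(3)
    by simp
  then show ?thesis using assms(2) by (auto simp: differentiable_def)
qed

lemma Ck_on_SucD:
  assumes "Ck_on (Suc k) S f" "x \<in> S"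
  shows "(f has_derivative frechet_derivative f (at x)) (at x)"
  using assms by (auto simp: frechet_derivative_works[symmetric])

lemma Ck_on_const: "Ck_on k S (\<lambda>x. c)"
  by (induction k arbitrary: c) auto

lemma Ck_on_bounded_linear:
  assumes "bounded_linear h" "open S" "Ck_on k S f"
  shows "Ck_on k S (\<lambda>x. h (f x))"
  using assms(3)
proof (induction k arbitrary: f)
  case 0
  then show ?case
    using bounded_linear.continuous_on[OF assms(1)] by auto
next
  case (Suc k)
  show ?case
  proof (rule Ck_on_SucI[OF assms(2)])
    fix x assume "x \<in> S"
    from Ck_on_SucD[OF Suc.prems this]
    show "((\<lambda>x. h (f x)) has_derivative (\<lambda>v. h (frechet_derivative f (at x) v))) (at x)"
      by (rule bounded_linear.has_derivative[OF assms(1)])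
  qed (use Suc in auto)
qed

lemma Ck_on_ident: "open S \<Longrightarrow> Ck_on k S (\<lambda>x. x)"
proof (cases k)
  case (Suc m)
  assume "open S"
  then show ?thesis unfolding Suc
    by (rule Ck_on_SucI[of _ _ "\<lambda>_ v. v"]) (auto intro: Ck_on_const derivative_eq_intros)
qed auto

lemma Ck_on_add:
  assumes "open S" "Ck_on k S f" "Ck_on k S g"
  shows "Ck_on k S (\<lambda>x. f x + g x)"
  using assms(2,3)
proof (induction k arbitrary: f g)
  case (Suc k)
  show ?case
  proof (rule Ck_on_SucI[OF assms(1)])
    fix x assume "x \<in> S"
    from Ck_on_SucD[OF Suc.prems(1) this] Ck_on_SucD[OF Suc.prems(2) this]
    show "((\<lambda>x. f x + g x) has_derivative
        (\<lambda>v. frechet_derivative f (at x) v + frechet_derivative g (at x) v)) (at x)"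
      by (rule has_derivative_add)
  qed (use Suc in auto)
qed (auto intro: continuous_on_add)

lemma Ck_on_sum:
  assumes "open S" "\<And>i. i \<in> I \<Longrightarrow> Ck_on k S (f i)"
  shows "Ck_on k S (\<lambda>x. \<Sum>i\<in>I. f i x)"
  using assms(2)
  by (induction I rule: infinite_finite_induct) (auto intro: Ck_on_const Ck_on_add assms(1))

lemma Ck_on_bilinear:
  assumes "bounded_bilinear B" "open S" "Ck_on k S f" "Ck_on k S g"
  shows "Ck_on k S (\<lambda>x. B (f x) (g x))"
  using assms(3,4)
proof (induction k arbitrary: f g)
  case 0
  then show ?case using bounded_bilinear.continuous_on[OF assms(1)] by auto
next
  case (Suc k)
  show ?case
  proof (rule Ck_on_SucI[OF assms(2)])
    fix x assume "x \<in> S"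
    from Ck_on_SucD[OF Suc.prems(1) this] Ck_on_SucD[OF Suc.prems(2) this]
    show "((\<lambda>x. B (f x) (g x)) has_derivative
        (\<lambda>v. B (f x) (frechet_derivative g (at x) v) + B (frechet_derivative f (at x) v) (g x))) (at x)"
      by (rule bounded_bilinear.FDERIV[OF assms(1)])
  next
    fix v
    show "Ck_on k S (\<lambda>x. B (f x) (frechet_derivative g (at x) v) + B (frechet_derivative f (at x) v) (g x))"
      using Suc.prems Suc.prems[THEN Ck_on_Suc_imp]
      by (intro Ck_on_add[OF assms(2)] Suc.IH) auto
  qed
qed

lemmas Ck_on_mult = Ck_on_bilinear[OF bounded_bilinear_mult]
lemmas Ck_on_scaleR = Ck_on_bilinear[OF bounded_bilinear_scaleR]

text \<open>The chain rule gives the derivative of the composition only as \<open>f' (g x) (g' x v)\<close>, where the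
  direction \<open>g' x v\<close> varies with \<open>x\<close>. Expanding it in the basis leaves directional derivatives of
  \<open>f\<close> in fixed directions, to which the induction hypothesis applies.\<close>

lemma Ck_on_compose:
  fixes g :: "'u::real_normed_vector \<Rightarrow> 'v::euclidean_space"
  assumes "open S" "open T" "g ` S \<subseteq> T" "Ck_on k S g" "Ck_on k T f"
  shows "Ck_on k S (\<lambda>x. f (g x))"
  using assms(4,5)
proof (induction k arbitrary: f)
  case 0
  then show ?case using assms(3) continuous_on_compose2[of T f S g] by auto
next
  case (Suc k)
  let ?g' = "\<lambda>x. frechet_derivative g (at x)" and ?f' = "\<lambda>x. frechet_derivative f (at x)"
  have IH: "Ck_on k S (\<lambda>x. ?f' (g x) b)" for b
    using Suc.IH[of "\<lambda>y. ?f' y b"] Suc.prems Ck_on_Suc_imp[OF Suc.prems(1)] by auto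
  show ?case
  proof (rule Ck_on_SucI[OF assms(1)])
    fix x assume x: "x \<in> S"
    have f: "(f has_derivative ?f' (g x)) (at (g x))"
      using Ck_on_SucD[OF Suc.prems(2)] x assms(3) by blast
    from diff_chain_at[OF Ck_on_SucD[OF Suc.prems(1) x] f]
    have d: "((\<lambda>x. f (g x)) has_derivative (\<lambda>v. ?f' (g x) (?g' x v))) (at x)"
      by (simp add: o_def)
    have lin: "linear (?f' (g x))"
      using f has_derivative_linear by blast
    have "?f' (g x) w = (\<Sum>b\<in>Basis. (w \<bullet> b) *\<^sub>R ?f' (g x) b)" for w
    proof -
      have "?f' (g x) w = ?f' (g x) (\<Sum>b\<in>Basis. (w \<bullet> b) *\<^sub>R b)"
        by (simp add: euclidean_representation)
      then show ?thesis
        by (simp add: linear_sum[OF lin] linear_cmul[OF lin])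
    qed
    then have "(\<lambda>v. ?f' (g x) (?g' x v)) = (\<lambda>v. \<Sum>b\<in>Basis. (?g' x v \<bullet> b) *\<^sub>R ?f' (g x) b)"
      by blast
    with d show "((\<lambda>x. f (g x)) has_derivative
        (\<lambda>v. \<Sum>b\<in>Basis. (?g' x v \<bullet> b) *\<^sub>R ?f' (g x) b)) (at x)"
      by argo
  next
    fix v
    have "Ck_on k S (\<lambda>x. ?g' x v)" using Suc.prems by simp
    then have "Ck_on k S (\<lambda>x. ?g' x v \<bullet> b)" for b
      by (rule Ck_on_bounded_linear[OF bounded_linear_inner_left assms(1)])
    with IH show "Ck_on k S (\<lambda>x. \<Sum>b\<in>Basis. (?g' x v \<bullet> b) *\<^sub>R ?f' (g x) b)"
      by (intro Ck_on_sum Ck_on_scaleR assms(1))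
  qed
qed

lemma Ck_on_inverse:
  fixes f :: "'v::real_normed_vector \<Rightarrow> 'w::real_normed_field"
  assumes "open S" "\<And>x. x \<in> S \<Longrightarrow> f x \<noteq> 0" "Ck_on k S f"
  shows "Ck_on k S (\<lambda>x. inverse (f x))"
  using assms(3)
proof (induction k)
  case 0
  then show ?case using assms by (auto intro: continuous_on_inverse)
next
  case (Suc k)
  show ?case
  proof (rule Ck_on_SucI[OF assms(1)])
    fix x assume x: "x \<in> S"
    show "((\<lambda>x. inverse (f x)) has_derivative
       (\<lambda>v. (- 1) * (inverse (f x) * frechet_derivative f (at x) v * inverse (f x)))) (at x)"
      using Deriv.has_derivative_inverse[OF assms(2)[OF x] Ck_on_SucD[OF Suc.prems x]] by simp
  next
    fix v
    show "Ck_on k S (\<lambda>x. (- 1) * (inverse (f x) * frechet_derivative f (at x) v * inverse (f x)))"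
      using Suc.IH Ck_on_Suc_imp[OF Suc.prems] Suc.prems
      by (intro Ck_on_mult assms(1) Ck_on_const) auto
  qed
qed

section \<open>Symmetry of second derivatives and the Wirtinger operators\<close>

lemma has_field_derivative_along_line:
  fixes f :: "'v::real_normed_vector \<Rightarrow> real"
  assumes "(f has_derivative f') (at (p + a *\<^sub>R v))"
  shows "((\<lambda>s. f (p + s *\<^sub>R v)) has_field_derivative f' v) (at a)"
proof -
  have "((\<lambda>s. p + s *\<^sub>R v) has_derivative (\<lambda>s. s *\<^sub>R v)) (at a)"
    by (auto intro!: derivative_eq_intros)
  from diff_chain_at[OF this assms]
  have "((\<lambda>s. f (p + s *\<^sub>R v)) has_derivative (\<lambda>s. f' (s *\<^sub>R v))) (at a)"
    by (simp add: o_def)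
  moreover have "(\<lambda>s. f' (s *\<^sub>R v)) = (*) (f' v)"
    using linear_cmul[OF has_derivative_linear[OF assms]] by (simp add: fun_eq_iff)
  ultimately show ?thesis by (simp add: has_field_derivative_def)
qed

text \<open>The second difference of \<open>f\<close> over a small parallelogram is a difference in direction \<open>w\<close> of a difference in
  direction \<open>v\<close>; the mean value theorem is applied once in each direction.\<close>

lemma second_difference_mean_value:
  fixes f :: "'v::real_normed_vector \<Rightarrow> real"
  assumes f: "\<And>x. x \<in> S \<Longrightarrow> (f has_derivative f' x) (at x)"
    and f': "\<And>x. x \<in> S \<Longrightarrow> ((\<lambda>x. f' x v) has_derivative f'' x) (at x)"
    and t: "0 < t" and S: "cball z (t * (norm v + norm w)) \<subseteq> S"
  obtains \<xi> where "\<xi> \<in> cball z (t * (norm v + norm w))"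
    "f (z + t *\<^sub>R v + t *\<^sub>R w) - f (z + t *\<^sub>R v) - f (z + t *\<^sub>R w) + f z = t\<^sup>2 * f'' \<xi> w"
proof -
  have in_cball: "z + a *\<^sub>R v + b *\<^sub>R w \<in> cball z (t * (norm v + norm w))"
    if "0 \<le> a" "a \<le> t" "0 \<le> b" "b \<le> t" for a b
  proof -
    have "norm (a *\<^sub>R v + b *\<^sub>R w) \<le> a * norm v + b * norm w"
      using norm_triangle_ineq[of "a *\<^sub>R v" "b *\<^sub>R w"] that by simp
    also have "\<dots> \<le> t * (norm v + norm w)"
      unfolding distrib_left using that by (intro add_mono mult_right_mono) auto
    finally show ?thesis
      unfolding mem_cball dist_norm by (metis add.assoc add_diff_cancel_left' norm_minus_commute)
  qed
  then have in_S: "z + a *\<^sub>R v + b *\<^sub>R w \<in> S"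
    if "0 \<le> a" "a \<le> t" "0 \<le> b" "b \<le> t" for a b
    using that S by blast
  let ?g = "\<lambda>a. f ((z + t *\<^sub>R w) + a *\<^sub>R v) - f (z + a *\<^sub>R v)"
  let ?g' = "\<lambda>a. f' ((z + t *\<^sub>R w) + a *\<^sub>R v) v - f' (z + a *\<^sub>R v) v"
  have "\<exists>a. 0 < a \<and> a < t \<and> ?g t - ?g 0 = (t - 0) * ?g' a"
  proof (rule MVT2[OF t])
    fix a assume "0 \<le> a" "a \<le> t"
    with in_S[of a t] in_S[of a 0] t show "DERIV ?g a :> ?g' a"
      by (intro DERIV_diff has_field_derivative_along_line f) (auto simp: algebra_simps)
  qed
  then obtain a where a: "0 < a" "a < t" "?g t - ?g 0 = t * ?g' a" by auto
  have "\<exists>b. 0 < b \<and> b < t \<and> f' (z + a *\<^sub>R v + t *\<^sub>R w) v - f' (z + a *\<^sub>R v + 0 *\<^sub>R w) v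
      = (t - 0) * f'' (z + a *\<^sub>R v + b *\<^sub>R w) w"
  proof (rule MVT2[OF t])
    fix b assume "0 \<le> b" "b \<le> t"
    with a t show "((\<lambda>b. f' (z + a *\<^sub>R v + b *\<^sub>R w) v) has_field_derivative
        f'' (z + a *\<^sub>R v + b *\<^sub>R w) w) (at b)"
      by (intro has_field_derivative_along_line f' in_S) auto
  qed
  then obtain b where b: "0 < b" "b < t"
    "f' (z + a *\<^sub>R v + t *\<^sub>R w) v - f' (z + a *\<^sub>R v) v = t * f'' (z + a *\<^sub>R v + b *\<^sub>R w) w"
    by auto
  show thesis
  proof
    show "z + a *\<^sub>R v + b *\<^sub>R w \<in> cball z (t * (norm v + norm w))"
      using a b by (intro in_cball) auto
    show "f (z + t *\<^sub>R v + t *\<^sub>R w) - f (z + t *\<^sub>R v) - f (z + t *\<^sub>R w) + f z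
        = t\<^sup>2 * f'' (z + a *\<^sub>R v + b *\<^sub>R w) w"
      using a(3) b(3) by (simp add: power2_eq_square algebra_simps)
  qed
qed

text \<open>The second difference over a parallelogram is symmetric in \<open>v\<close> and \<open>w\<close>, while its mean value form produces
  the two mixed derivatives at points that tend to \<open>z\<close> with the size of the parallelogram.\<close>

lemma second_derivative_symmetric_real:
  fixes f :: "'v::real_normed_vector \<Rightarrow> real"
  assumes "open S" and C2: "Ck_on 2 S f" and z: "z \<in> S"
  shows "frechet_derivative (\<lambda>x. frechet_derivative f (at x) v) (at z) w =
         frechet_derivative (\<lambda>x. frechet_derivative f (at x) w) (at z) v"
proof -
  let ?D = "\<lambda>v w x. frechet_derivative (\<lambda>x. frechet_derivative f (at x) v) (at x) w"
  have C2': "Ck_on (Suc (Suc 0)) S f" using C2 by (simp add: numeral_2_eq_2)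
  have f: "(f has_derivative frechet_derivative f (at x)) (at x)" if "x \<in> S" for x
    using Ck_on_SucD[OF C2' that] .
  have f': "((\<lambda>x. frechet_derivative f (at x) v) has_derivative
      frechet_derivative (\<lambda>x. frechet_derivative f (at x) v) (at x)) (at x)" if "x \<in> S" for x v
    using C2' that by (intro Ck_on_SucD[of 0 S]) simp_all
  have cont: "isCont (?D v w) z" for v w
  proof -
    have "continuous_on S (?D v w)" using C2' by simp
    then show ?thesis using \<open>open S\<close> z by (simp add: continuous_on_eq_continuous_at)
  qed
  show ?thesis
  proof (rule ccontr)
    assume "?D v w z \<noteq> ?D w v z"
    define e where "e = \<bar>?D v w z - ?D w v z\<bar> / 2"
    have e: "e > 0" using \<open>?D v w z \<noteq> ?D w v z\<close> by (simp add: e_def)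
    obtain d1 where d1: "d1 > 0" "\<And>x. dist x z < d1 \<Longrightarrow> dist (?D v w x) (?D v w z) < e"
      using cont[of v w] e unfolding continuous_at_eps_delta by blast
    obtain d2 where d2: "d2 > 0" "\<And>x. dist x z < d2 \<Longrightarrow> dist (?D w v x) (?D w v z) < e"
      using cont[of w v] e unfolding continuous_at_eps_delta by blast
    obtain d3 where d3: "d3 > 0" "cball z d3 \<subseteq> S"
      using \<open>open S\<close> z open_contains_cball by blast
    define d where "d = min d1 (min d2 d3)"
    \<comment> \<open>the summand 1 only avoids dividing by zero when both directions vanish\<close>
    define n where "n = norm v + norm w + 1"
    define t where "t = d / 2 / n"
    have d: "d > 0" using d1 d2 d3 by (simp add: d_def)
    have n: "n > 0" unfolding n_def by (smt (verit) norm_ge_zero)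
    have t: "t > 0" using d n by (simp add: t_def)
    have "t * (norm v + norm w) \<le> t * n" using t by (simp add: n_def)
    also have "\<dots> = d / 2" using n by (simp add: t_def)
    finally have td: "t * (norm v + norm w) < d" using d by simp
    then have sub: "cball z (t * (norm v + norm w)) \<subseteq> S"
      using d3(2) by (force simp: d_def)
    obtain \<xi> where \<xi>: "\<xi> \<in> cball z (t * (norm v + norm w))"
      "f (z + t *\<^sub>R v + t *\<^sub>R w) - f (z + t *\<^sub>R v) - f (z + t *\<^sub>R w) + f z = t\<^sup>2 * ?D v w \<xi>"
      by (rule second_difference_mean_value[OF f f' t sub])
    have sub': "cball z (t * (norm w + norm v)) \<subseteq> S" using sub by (simp add: add.commute)
    obtain \<eta> where \<eta>: "\<eta> \<in> cball z (t * (norm w + norm v))"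
      "f (z + t *\<^sub>R w + t *\<^sub>R v) - f (z + t *\<^sub>R w) - f (z + t *\<^sub>R v) + f z = t\<^sup>2 * ?D w v \<eta>"
      by (rule second_difference_mean_value[OF f f' t sub'])
    have "t\<^sup>2 * ?D v w \<xi> = t\<^sup>2 * ?D w v \<eta>"
      unfolding \<xi>(2)[symmetric] \<eta>(2)[symmetric] by (simp add: algebra_simps)
    then have eq: "?D v w \<xi> = ?D w v \<eta>" using t by simp
    have "dist \<xi> z < d" "dist \<eta> z < d"
      using \<xi>(1) \<eta>(1) td by (simp_all add: dist_commute add.commute)
    then have "dist (?D v w \<xi>) (?D v w z) < e" "dist (?D w v \<eta>) (?D w v z) < e"
      using d1(2) d2(2) by (simp_all add: d_def)
    then show False using eq by (simp add: e_def dist_real_def abs_if split: if_splits)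
  qed
qed

lemma second_derivative_symmetric:
  fixes f :: "'v::real_normed_vector \<Rightarrow> 'w::euclidean_space"
  assumes S: "open S" and C2: "Ck_on 2 S f" and z: "z \<in> S"
  shows "frechet_derivative (\<lambda>x. frechet_derivative f (at x) v) (at z) w =
         frechet_derivative (\<lambda>x. frechet_derivative f (at x) w) (at z) v"
proof (rule euclidean_eqI)
  fix b :: 'w
  have C2': "Ck_on (Suc (Suc 0)) S f" using C2 by (simp add: numeral_2_eq_2)
  have fr: "frechet_derivative (\<lambda>x. g x \<bullet> b) (at x) u = frechet_derivative g (at x) u \<bullet> b"
    if "g differentiable (at x)" for g :: "'v \<Rightarrow> 'w" and x u
  proof -
    have "((\<lambda>x. g x \<bullet> b) has_derivative (\<lambda>u. frechet_derivative g (at x) u \<bullet> b)) (at x)"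
      using that by (intro has_derivative_inner_left) (simp add: frechet_derivative_works)
    then show ?thesis by (metis frechet_derivative_at)
  qed
  have 1: "frechet_derivative (\<lambda>x. frechet_derivative (\<lambda>x. f x \<bullet> b) (at x) v) (at z) w =
      frechet_derivative (\<lambda>x. frechet_derivative f (at x) v) (at z) w \<bullet> b" for v w
  proof -
    have d: "(\<lambda>x. frechet_derivative f (at x) v) differentiable (at z)"
      using C2' z by simp
    then have d': "(\<lambda>x. frechet_derivative f (at x) v \<bullet> b) differentiable (at z)"
      by (intro differentiable_inner) auto
    have "frechet_derivative (\<lambda>x. frechet_derivative f (at x) v \<bullet> b) (at z)
        = frechet_derivative (\<lambda>x. frechet_derivative (\<lambda>x. f x \<bullet> b) (at x) v) (at z)"
      by (rule frechet_derivative_transform_within_open[OF d' S z]) (use C2' fr in simp)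
    then show ?thesis using fr[OF d] by metis
  qed
  have "Ck_on 2 S (\<lambda>x. f x \<bullet> b)"
    by (rule Ck_on_bounded_linear[OF bounded_linear_inner_left S C2])
  from second_derivative_symmetric_real[OF S this z]
  show "frechet_derivative (\<lambda>x. frechet_derivative f (at x) v) (at z) w \<bullet> b =
      frechet_derivative (\<lambda>x. frechet_derivative f (at x) w) (at z) v \<bullet> b"
    by (simp add: 1)
qed

lemma pd_eqI:
  assumes "(f has_derivative f') (at z)"
  shows "pd_z i f z = (f' (axis i 1) - \<i> * f' (axis i \<i>)) / 2"
    and "pd_zbar i f z = (f' (axis i 1) + \<i> * f' (axis i \<i>)) / 2"
  using frechet_derivative_at[OF assms] by (simp_all add: pd_z_def pd_zbar_def)

text \<open>A real-linear map on complex vectors is the sum of a complex-linear and an antilinear part; the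
  Wirtinger derivatives are their coefficients.\<close>

lemma frechet_derivative_wirtinger:
  fixes f :: "complex^'n \<Rightarrow> complex"
  assumes "f differentiable (at z)"
  shows "frechet_derivative f (at z) v = (\<Sum>k\<in>UNIV. pd_z k f z * v $ k + pd_zbar k f z * cnj (v $ k))"
proof -
  let ?f' = "frechet_derivative f (at z)"
  have lin: "linear ?f'"
    using assms frechet_derivative_works has_derivative_linear by blast
  have "v = (\<Sum>k\<in>UNIV. Re (v $ k) *\<^sub>R axis k 1 + Im (v $ k) *\<^sub>R axis k \<i>)"
    by (simp add: vec_eq_iff axis_def if_distrib sum.delta complex_eq_iff sum.distrib cong: if_cong)
  then have "?f' v = ?f' (\<Sum>k\<in>UNIV. Re (v $ k) *\<^sub>R axis k 1 + Im (v $ k) *\<^sub>R axis k \<i>)"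
    by simp
  also have "\<dots> = (\<Sum>k\<in>UNIV. Re (v $ k) *\<^sub>R ?f' (axis k 1) + Im (v $ k) *\<^sub>R ?f' (axis k \<i>))"
    by (simp add: linear_sum[OF lin] linear_add[OF lin] linear_cmul[OF lin])
  also have "\<dots> = (\<Sum>k\<in>UNIV. pd_z k f z * v $ k + pd_zbar k f z * cnj (v $ k))"
    by (intro sum.cong refl)
      (simp add: pd_z_def pd_zbar_def complex_eq_iff algebra_simps field_simps)
  finally show ?thesis .
qed

lemma pd_cong:
  assumes "open S" "z \<in> S" "\<And>w. w \<in> S \<Longrightarrow> f w = g w" "f differentiable (at z)"
  shows "pd_z i f z = pd_z i g z" "pd_zbar i f z = pd_zbar i g z"
  using frechet_derivative_transform_within_open[OF assms(4,1,2,3)]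
  by (simp_all add: pd_z_def pd_zbar_def)

lemma pd_const: "pd_z i (\<lambda>w. c) z = 0" "pd_zbar i (\<lambda>w. c) z = 0"
  by (simp_all add: pd_z_def pd_zbar_def)

lemma pd_add:
  assumes "f differentiable (at z)" "g differentiable (at z)"
  shows "pd_z i (\<lambda>w. f w + g w) z = pd_z i f z + pd_z i g z"
    "pd_zbar i (\<lambda>w. f w + g w) z = pd_zbar i f z + pd_zbar i g z"
  using pd_eqI[OF has_derivative_add[OF assms[unfolded frechet_derivative_works]]]
  by (simp_all add: pd_z_def pd_zbar_def algebra_simps add_divide_distrib diff_divide_distrib)

lemma pd_mult:
  assumes "f differentiable (at z)" "g differentiable (at z)"
  shows "pd_z i (\<lambda>w. f w * g w) z = pd_z i f z * g z + f z * pd_z i g z"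
    "pd_zbar i (\<lambda>w. f w * g w) z = pd_zbar i f z * g z + f z * pd_zbar i g z"
  using pd_eqI[OF has_derivative_mult[OF assms[unfolded frechet_derivative_works]]]
  by (simp_all add: pd_z_def pd_zbar_def algebra_simps add_divide_distrib diff_divide_distrib)

lemma pd_sum:
  assumes "\<And>j. j \<in> J \<Longrightarrow> f j differentiable (at z)"
  shows "pd_z i (\<lambda>w. \<Sum>j\<in>J. f j w) z = (\<Sum>j\<in>J. pd_z i (f j) z)"
    "pd_zbar i (\<lambda>w. \<Sum>j\<in>J. f j w) z = (\<Sum>j\<in>J. pd_zbar i (f j) z)"
proof -
  have "pd_z i (\<lambda>w. \<Sum>j\<in>J. f j w) z = (\<Sum>j\<in>J. pd_z i (f j) z) \<and>
    pd_zbar i (\<lambda>w. \<Sum>j\<in>J. f j w) z = (\<Sum>j\<in>J. pd_zbar i (f j) z)"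
    using assms
  proof (induction J rule: infinite_finite_induct)
    case (insert j J)
    moreover have "(\<lambda>w. \<Sum>j\<in>J. f j w) differentiable (at z)"
      using insert by (intro differentiable_sum) auto
    ultimately show ?case by (simp add: pd_add)
  qed (simp_all add: pd_const)
  then show "pd_z i (\<lambda>w. \<Sum>j\<in>J. f j w) z = (\<Sum>j\<in>J. pd_z i (f j) z)"
    "pd_zbar i (\<lambda>w. \<Sum>j\<in>J. f j w) z = (\<Sum>j\<in>J. pd_zbar i (f j) z)" by auto
qed

lemma pd_cmult:
  assumes "f differentiable (at z)"
  shows "pd_z i (\<lambda>w. c * f w) z = c * pd_z i f z" "pd_zbar i (\<lambda>w. c * f w) z = c * pd_zbar i f z"
  using assms by (simp_all add: pd_mult pd_const)

lemma pd_cnj: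
  assumes "f differentiable (at z)"
  shows "pd_z i (\<lambda>w. cnj (f w)) z = cnj (pd_zbar i f z)"
    "pd_zbar i (\<lambda>w. cnj (f w)) z = cnj (pd_z i f z)"
  using pd_eqI[OF has_derivative_cnj[OF assms[unfolded frechet_derivative_works]]]
  by (simp_all add: pd_z_def pd_zbar_def)

lemma Ck_on_pd:
  assumes "open S" "Ck_on (Suc k) S f"
  shows "Ck_on k S (pd_z i f)" "Ck_on k S (pd_zbar i f)"
proof -
  let ?d = "\<lambda>v x. frechet_derivative f (at x) v"
  have "Ck_on k S (?d v)" for v using assms(2) by simp
  then have "Ck_on k S (\<lambda>x. (1/2) * (?d (axis i 1) x + (- \<i>) * ?d (axis i \<i>) x))"
    "Ck_on k S (\<lambda>x. (1/2) * (?d (axis i 1) x + \<i> * ?d (axis i \<i>) x))"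
    by (intro Ck_on_mult Ck_on_add Ck_on_const assms(1); simp)+
  then show "Ck_on k S (pd_z i f)" "Ck_on k S (pd_zbar i f)"
    by (simp_all add: pd_z_def[abs_def] pd_zbar_def[abs_def])
qed

text \<open>Both identities are the symmetry of the real second derivative in the coordinate directions.\<close>

lemma pd_commute:
  assumes S: "open S" "z \<in> S" and f: "Ck_on 2 S f"
  shows "pd_z i (pd_z j f) z = pd_z j (pd_z i f) z"
    and "pd_z i (pd_zbar j f) z = pd_zbar j (pd_z i f) z"
proof -
  let ?D = "\<lambda>v w. frechet_derivative (\<lambda>x. frechet_derivative f (at x) v) (at z) w"
  have d: "((\<lambda>x. frechet_derivative f (at x) v) has_derivative ?D v) (at z)" for v
    using f S by (simp add: numeral_2_eq_2 frechet_derivative_works[symmetric])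
  have "((\<lambda>x. (frechet_derivative f (at x) (axis j 1) + c * frechet_derivative f (at x) (axis j \<i>)) / 2)
      has_derivative (\<lambda>w. (?D (axis j 1) w + c * ?D (axis j \<i>) w) / 2)) (at z)" for c :: complex and j
    by (auto intro!: derivative_eq_intros d)
  note * = this[of j "- \<i>"] this[of j "\<i>"] this[of i "- \<i>"]
  have "(pd_z j f has_derivative (\<lambda>w. (?D (axis j 1) w - \<i> * ?D (axis j \<i>) w) / 2)) (at z)"
    "(pd_zbar j f has_derivative (\<lambda>w. (?D (axis j 1) w + \<i> * ?D (axis j \<i>) w) / 2)) (at z)"
    "(pd_z i f has_derivative (\<lambda>w. (?D (axis i 1) w - \<i> * ?D (axis i \<i>) w) / 2)) (at z)"
    using * by (simp_all add: pd_z_def[abs_def] pd_zbar_def[abs_def])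
  note ** = this[THEN pd_eqI(1)] this[THEN pd_eqI(2)]
  have sym: "?D v w = ?D w v" for v w
    by (rule second_derivative_symmetric[OF S(1) f S(2)])
  show "pd_z i (pd_z j f) z = pd_z j (pd_z i f) z"
    unfolding ** using sym[of "axis i 1" "axis j 1"] sym[of "axis i 1" "axis j \<i>"]
      sym[of "axis i \<i>" "axis j 1"] sym[of "axis i \<i>" "axis j \<i>"]
    by (simp add: complex_eq_iff field_simps)
  show "pd_z i (pd_zbar j f) z = pd_zbar j (pd_z i f) z"
    unfolding ** using sym[of "axis i 1" "axis j 1"] sym[of "axis i 1" "axis j \<i>"]
      sym[of "axis i \<i>" "axis j 1"] sym[of "axis i \<i>" "axis j \<i>"]
    by (simp add: complex_eq_iff field_simps)
qed

text \<open>The Cauchy-Riemann equations: the derivative is complex linear.\<close>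

lemma holomorphic_derivative:
  assumes \<tau>: "(\<tau> has_derivative D) (at z)" and hol: "pd_zbar i (\<lambda>w. \<tau> w $ k) z = 0"
  shows "D (axis i \<i>) $ k = \<i> * D (axis i 1) $ k"
    and "pd_z i (\<lambda>w. \<tau> w $ k) z = D (axis i 1) $ k"
proof -
  have "((\<lambda>w. \<tau> w $ k) has_derivative (\<lambda>v. D v $ k)) (at z)"
    by (rule bounded_linear.has_derivative[OF bounded_linear_vec_nth \<tau>])
  note pd = pd_eqI[OF this]
  have "D (axis i 1) $ k + \<i> * D (axis i \<i>) $ k = 0"
    using hol unfolding pd(2) by simp
  then have "\<i> * (D (axis i 1) $ k + \<i> * D (axis i \<i>) $ k) = 0" by simp
  then show 1: "D (axis i \<i>) $ k = \<i> * D (axis i 1) $ k"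
    by (simp add: algebra_simps)
  show "pd_z i (\<lambda>w. \<tau> w $ k) z = D (axis i 1) $ k"
    unfolding pd(1) 1 by (simp add: algebra_simps)
qed

text \<open>For a holomorphic inner function the two Wirtinger operators do not mix in the chain rule, which is why the
  coefficients of forms of a given type transform among themselves.\<close>

lemma pd_chain_holomorphic:
  fixes \<tau> :: "complex^'n \<Rightarrow> complex^'m"
  assumes \<tau>: "\<tau> differentiable (at z)" and hol: "\<And>k. pd_zbar i (\<lambda>w. \<tau> w $ k) z = 0"
    and f: "f differentiable (at (\<tau> z))"
  shows "pd_z i (\<lambda>w. f (\<tau> w)) z = (\<Sum>k\<in>UNIV. pd_z k f (\<tau> z) * pd_z i (\<lambda>w. \<tau> w $ k) z)"
    and "pd_zbar i (\<lambda>w. f (\<tau> w)) z = (\<Sum>k\<in>UNIV. pd_zbar k f (\<tau> z) * cnj (pd_z i (\<lambda>w. \<tau> w $ k) z))"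
proof -
  let ?D = "frechet_derivative \<tau> (at z)"
  have D: "(\<tau> has_derivative ?D) (at z)" using \<tau> by (simp add: frechet_derivative_works)
  note h = holomorphic_derivative[OF D hol]
  from diff_chain_at[OF D f[unfolded frechet_derivative_works]]
  have "((\<lambda>w. f (\<tau> w)) has_derivative (\<lambda>v. frechet_derivative f (at (\<tau> z)) (?D v))) (at z)"
    by (simp add: o_def)
  note pd = pd_eqI[OF this, unfolded frechet_derivative_wirtinger[OF f] h, where i = i]
  show "pd_z i (\<lambda>w. f (\<tau> w)) z = (\<Sum>k\<in>UNIV. pd_z k f (\<tau> z) * pd_z i (\<lambda>w. \<tau> w $ k) z)"
    unfolding pd h sum_distrib_left sum_subtractf[symmetric] sum.distrib[symmetric] sum_divide_distrib
    by (intro sum.cong refl) (simp add: algebra_simps)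
  show "pd_zbar i (\<lambda>w. f (\<tau> w)) z = (\<Sum>k\<in>UNIV. pd_zbar k f (\<tau> z) * cnj (pd_z i (\<lambda>w. \<tau> w $ k) z))"
    unfolding pd h sum_distrib_left sum_subtractf[symmetric] sum.distrib[symmetric] sum_divide_distrib
    by (intro sum.cong refl) (simp add: algebra_simps)
qed

section \<open>Integrals of derivatives and Lebesgue measure\<close>

lemma integrable_continuous_compact_support:
  fixes f :: "'v::euclidean_space \<Rightarrow> 'w::{banach, second_countable_topology}"
  assumes "compact K" "continuous_on K f" "\<And>x. x \<notin> K \<Longrightarrow> f x = 0"
  shows "integrable lborel f"
proof -
  have "(\<lambda>x. indicator K x *\<^sub>R f x) = f"
    using assms(3) by (auto simp: indicator_def)
  then show ?thesis
    using borel_integrable_compact[OF assms(1,2)] by simp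
qed

lemma lborel_integral_translation:
  fixes f :: "'v::euclidean_space \<Rightarrow> 'w::{banach, second_countable_topology}"
  assumes [measurable]: "f \<in> borel_measurable borel"
  shows "(\<integral>x. f (x + a) \<partial>lborel) = (\<integral>x. f x \<partial>lborel)"
proof -
  have "(\<integral>x. f x \<partial>distr lborel borel ((+) a)) = (\<integral>x. f (a + x) \<partial>lborel)"
    by (rule integral_distr) auto
  then show ?thesis
    by (simp add: lborel_distr_plus add.commute)
qed

text \<open>By the fundamental theorem of calculus \<open>F (x + v) - F x\<close> is the average of \<open>F'\<close> over the segment from
  \<open>x\<close> to \<open>x + v\<close>. Its integral over \<open>x\<close> vanishes by translation invariance, and after exchanging the
  integrals each point of the segment contributes the same integral of \<open>F'\<close>.\<close>

lemma integral_directional_derivative_compact_support: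
  fixes F :: "'v::euclidean_space \<Rightarrow> 'w::euclidean_space"
  assumes K: "compact K" "\<And>x. x \<notin> K \<Longrightarrow> F x = 0"
    and F: "\<And>x. (F has_derivative F' x) (at x)"
    and cont: "continuous_on UNIV (\<lambda>x. F' x v)"
  shows "(\<integral>x. F' x v \<partial>lborel) = 0"
proof -
  define D where "D = (\<lambda>x. F' x v)"
  have contF: "continuous_on UNIV F"
    using F has_derivative_continuous continuous_at_imp_continuous_on by blast
  have contD: "continuous_on S D" for S
    using cont continuous_on_subset by (fastforce simp: D_def)
  have D0: "D x = 0" if "x \<notin> K" for x
  proof -
    have "((\<lambda>x. 0) has_derivative F' x) (at x)"
      by (rule has_derivative_transform_within_open[OF F, of "- K"])
        (use that K compact_imp_closed in auto)
    then have "F' x = (\<lambda>_. 0)"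
      using has_derivative_unique[OF has_derivative_const] by metis
    then show ?thesis by (simp add: D_def)
  qed
  have intF: "integrable lborel F" and intD: "integrable lborel D"
    using integrable_continuous_compact_support[OF K(1)] K(2) D0 contD
      continuous_on_subset[OF contF] by blast+
  have FTC: "(\<integral>t. indicator {0..1} t *\<^sub>R D (x + t *\<^sub>R v) \<partial>lborel) = F (x + v) - F x" for x
  proof -
    have d: "((\<lambda>t. F (x + t *\<^sub>R v)) has_vector_derivative D (x + t *\<^sub>R v)) (at t within {0..1})" for t :: real
    proof -
      have "((\<lambda>t. x + t *\<^sub>R v) has_derivative (\<lambda>t. t *\<^sub>R v)) (at t within {0..1})"
        by (auto intro!: derivative_eq_intros)
      from has_derivative_in_compose[OF this has_derivative_at_withinI[OF F]]
      have "((\<lambda>t. F (x + t *\<^sub>R v)) has_derivative (\<lambda>s. F' (x + t *\<^sub>R v) (s *\<^sub>R v))) (at t within {0..1})"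
        by simp
      then show ?thesis
        unfolding has_vector_derivative_def D_def
        using linear_cmul[OF has_derivative_linear[OF F]] by simp
    qed
    have "continuous_on {0..1} (\<lambda>t::real. D (x + t *\<^sub>R v))"
      by (rule continuous_on_compose2[OF contD[of UNIV]]) (auto intro!: continuous_intros)
    from integral_FTC_atLeastAtMost[OF _ d this] show ?thesis by simp
  qed
  let ?g = "\<lambda>(x::'v) (t::real). indicator {0..1} t *\<^sub>R D (x + t *\<^sub>R v)"
  \<comment> \<open>the pairs \<open>(x, t)\<close> with \<open>x + t v \<in> K\<close> form a compact set, which gives integrability on the product\<close>
  let ?K = "(\<lambda>(y, t). (y - t *\<^sub>R v, t)) ` (K \<times> {0..1::real})"
  have "compact ?K"
    by (intro compact_continuous_image compact_Times K(1)) (auto intro!: continuous_intros simp: case_prod_beta)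
  moreover have "continuous_on ?K (\<lambda>(x, t). D (x + t *\<^sub>R v))"
    unfolding case_prod_beta
    by (rule continuous_on_compose2[OF contD[of UNIV]]) (auto intro!: continuous_intros)
  ultimately have "integrable lborel (\<lambda>p. indicator ?K p *\<^sub>R (\<lambda>(x, t). D (x + t *\<^sub>R v)) p)"
    by (rule borel_integrable_compact)
  moreover have "(\<lambda>p. indicator ?K p *\<^sub>R (\<lambda>(x, t). D (x + t *\<^sub>R v)) p) = case_prod ?g"
  proof (rule ext, clarify)
    fix x :: 'v and t :: real
    show "indicator ?K (x, t) *\<^sub>R D (x + t *\<^sub>R v) = ?g x t"
    proof (cases "x + t *\<^sub>R v \<in> K")
      case True
      then have "(x, t) \<in> ?K \<longleftrightarrow> t \<in> {0..1}"
        by (auto simp: image_iff intro!: bexI[of _ "x + t *\<^sub>R v"])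
      then show ?thesis by (simp add: indicator_def)
    qed (simp add: D0)
  qed
  ultimately have "integrable (lborel \<Otimes>\<^sub>M lborel) (case_prod ?g)"
    by (simp add: lborel_prod)
  from lborel_pair.Fubini_integral[OF this]
  have "(\<integral>t. indicator {0..1} t *\<^sub>R (\<integral>x. D (x + t *\<^sub>R v) \<partial>lborel) \<partial>lborel) = (\<integral>x. F (x + v) - F x \<partial>lborel)"
    by (simp add: FTC)
  moreover have "(\<integral>x. D (x + a) \<partial>lborel) = (\<integral>x. D x \<partial>lborel)" for a
    using intD by (intro lborel_integral_translation) auto
  moreover have "integrable lborel (\<lambda>x. F (x + v))"
  proof (rule integrable_continuous_compact_support)
    show "compact ((\<lambda>x. x - v) ` K)"
      by (intro compact_continuous_image K(1) continuous_intros)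
    show "continuous_on ((\<lambda>x. x - v) ` K) (\<lambda>x. F (x + v))"
      by (rule continuous_on_compose2[OF contF]) (auto intro!: continuous_intros)
    show "F (x + v) = 0" if "x \<notin> (\<lambda>x. x - v) ` K" for x
      using that K(2)[of "x + v"] by (metis add_diff_cancel_right' imageI)
  qed
  ultimately show ?thesis
    using intF lborel_integral_translation[of F v] by (simp add: D_def)
qed

text \<open>A linear map permuting the coordinate axes carries boxes to boxes with the same side lengths.\<close>

lemma lborel_distr_basis_bij:
  fixes T :: "'a::euclidean_space \<Rightarrow> 'b::euclidean_space"
  assumes lin: "linear T" and bij: "bij_betw T Basis Basis"
  shows "distr lborel borel T = lborel"
proof (rule lborel_eqI[symmetric])
  have [measurable]: "T \<in> borel \<rightarrow>\<^sub>M borel"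
    using lin linear_continuous_on linear_conv_bounded_linear borel_measurable_continuous_onI by blast
  have Tb: "T b \<in> Basis" if "b \<in> Basis" for b
    using bij that by (auto simp: bij_betw_def)
  have inner: "T x \<bullet> T b = x \<bullet> b" if b: "b \<in> Basis" for x b
  proof -
    have "T x = T (\<Sum>b\<in>Basis. (x \<bullet> b) *\<^sub>R b)" by (simp add: euclidean_representation)
    also have "\<dots> = (\<Sum>b\<in>Basis. (x \<bullet> b) *\<^sub>R T b)"
      by (simp add: linear_sum[OF lin] linear_cmul[OF lin])
    finally have "T x \<bullet> T b = (\<Sum>b'\<in>Basis. (x \<bullet> b') * (T b' \<bullet> T b))"
      by (simp add: inner_sum_left)
    also have "\<dots> = (\<Sum>b'\<in>Basis. (x \<bullet> b') * (if b' = b then 1 else 0))"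
      using bij b Tb by (intro sum.cong refl) (auto simp: inner_Basis bij_betw_def inj_on_def)
    also have "\<dots> = x \<bullet> b" using b by (simp add: if_distrib cong: if_cong)
    finally show ?thesis .
  qed
  fix l u :: 'b
  assume le: "\<And>b. b \<in> Basis \<Longrightarrow> l \<bullet> b \<le> u \<bullet> b"
  define p where "p = (\<lambda>w::'b. \<Sum>b\<in>Basis. (w \<bullet> T b) *\<^sub>R (b::'a))"
  have p: "p w \<bullet> b = w \<bullet> T b" if "b \<in> Basis" for w b
    using that by (simp add: p_def inner_sum_left inner_Basis if_distrib cong: if_cong)
  have "T -` box l u = box (p l) (p u)"
  proof -
    have "x \<in> T -` box l u \<longleftrightarrow> (\<forall>b\<in>T ` Basis. l \<bullet> b < T x \<bullet> b \<and> T x \<bullet> b < u \<bullet> b)" for x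
      using bij by (simp add: mem_box bij_betw_def)
    then show ?thesis by (auto simp: mem_box inner p)
  qed
  then have "emeasure (distr lborel borel T) (box l u) = emeasure lborel (box (p l) (p u))"
    by (simp add: emeasure_distr)
  also have "\<dots> = (\<Prod>b\<in>Basis. (p u - p l) \<bullet> b)"
    using le Tb by (intro emeasure_lborel_box) (simp add: p)
  also have "(\<Prod>b\<in>Basis. (p u - p l) \<bullet> b) = (\<Prod>b\<in>Basis. (u - l) \<bullet> T b)"
    by (intro prod.cong refl) (simp add: p inner_diff_left)
  also have "\<dots> = (\<Prod>b\<in>Basis. (u - l) \<bullet> b)"
    by (rule prod.reindex_bij_betw[OF bij])
  finally show "emeasure (distr lborel borel T) (box l u) = (\<Prod>b\<in>Basis. (u - l) \<bullet> b)" .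
qed simp

text \<open>The sum over permutations is expanded by choosing the images of the indices one at a time.\<close>

lemma det_4:
  "det (A::'a::comm_ring_1^4^4) =
    A$1$1 * A$2$2 * A$3$3 * A$4$4 - A$1$1 * A$2$2 * A$3$4 * A$4$3
  - A$1$1 * A$2$3 * A$3$2 * A$4$4 + A$1$1 * A$2$3 * A$3$4 * A$4$2
  + A$1$1 * A$2$4 * A$3$2 * A$4$3 - A$1$1 * A$2$4 * A$3$3 * A$4$2
  - A$1$2 * A$2$1 * A$3$3 * A$4$4 + A$1$2 * A$2$1 * A$3$4 * A$4$3
  + A$1$2 * A$2$3 * A$3$1 * A$4$4 - A$1$2 * A$2$3 * A$3$4 * A$4$1
  - A$1$2 * A$2$4 * A$3$1 * A$4$3 + A$1$2 * A$2$4 * A$3$3 * A$4$1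
  + A$1$3 * A$2$1 * A$3$2 * A$4$4 - A$1$3 * A$2$1 * A$3$4 * A$4$2
  - A$1$3 * A$2$2 * A$3$1 * A$4$4 + A$1$3 * A$2$2 * A$3$4 * A$4$1
  + A$1$3 * A$2$4 * A$3$1 * A$4$2 - A$1$3 * A$2$4 * A$3$2 * A$4$1
  - A$1$4 * A$2$1 * A$3$2 * A$4$3 + A$1$4 * A$2$1 * A$3$3 * A$4$2
  + A$1$4 * A$2$2 * A$3$1 * A$4$3 - A$1$4 * A$2$2 * A$3$3 * A$4$1
  - A$1$4 * A$2$3 * A$3$1 * A$4$2 + A$1$4 * A$2$3 * A$3$2 * A$4$1"
proof -
  have f1: "finite {2::4, 3, 4}" "1 \<notin> {2::4, 3, 4}" by auto
  have f2: "finite {3::4, 4}" "2 \<notin> {3::4, 4}" by auto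
  have f3: "finite {4::4}" "3 \<notin> {4::4}" by auto
  show ?thesis
    unfolding det_def UNIV_4
    unfolding sum_over_permutations_insert[OF f1]
    unfolding sum_over_permutations_insert[OF f2]
    unfolding sum_over_permutations_insert[OF f3]
    unfolding permutes_sing
    by (simp add: sign_swap_id permutation_swap_id permutation_compose sign_compose sign_id swap_id_eq algebra_simps)
qed

text \<open>The general theorem concerns functions with values in a Euclidean space \<open>real^'n\<close>; a real function is
  treated as one with values in \<open>real^1\<close>.\<close>

lemma integral_change_of_variables_real4:
  fixes f :: "real^4 \<Rightarrow> real" and g :: "real^4 \<Rightarrow> real^4"
  assumes S: "S \<in> sets lebesgue"
    and der_g: "\<And>x. x \<in> S \<Longrightarrow> (g has_derivative g' x) (at x within S)"
    and inj: "inj_on g S"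
    and f: "f absolutely_integrable_on (g ` S)"
  shows "integral S (\<lambda>x. \<bar>det (matrix (g' x))\<bar> * f (g x)) = integral (g ` S) f"
proof -
  have "(\<lambda>x. \<bar>det (matrix (g' x))\<bar> *\<^sub>R vec (f (g x)) :: real^1) absolutely_integrable_on S \<and>
      integral S (\<lambda>x. \<bar>det (matrix (g' x))\<bar> *\<^sub>R vec (f (g x)) :: real^1) = vec (integral (g ` S) f)
    \<longleftrightarrow> (\<lambda>x. vec (f x) :: real^1) absolutely_integrable_on (g ` S) \<and>
      integral (g ` S) (\<lambda>x. vec (f x) :: real^1) = vec (integral (g ` S) f)"
    by (rule has_absolute_integral_change_of_variables[OF S der_g inj])
  with f show ?thesis
    by (simp add: absolutely_integrable_on_1_iff integral_on_1_eq)
qed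

section \<open>Change of variables in \<open>\<complex>\<^sup>2\<close>\<close>

text \<open>The identification of \<open>real^4\<close> with \<open>complex^2\<close> by real and imaginary parts. It transports the change of
  variables formula.\<close>

definition real4_to_complex2 :: "real^4 \<Rightarrow> complex^2" where
  "real4_to_complex2 x = (\<chi> i. if i = 1 then Complex (x $ 1) (x $ 2) else Complex (x $ 3) (x $ 4))"

definition complex2_to_real4 :: "complex^2 \<Rightarrow> real^4" where
  "complex2_to_real4 z = (\<chi> a. if a = 1 then Re (z $ 1) else if a = 2 then Im (z $ 1)
     else if a = 3 then Re (z $ 2) else Im (z $ 2))"

lemma real4_complex2_inverses [simp]:
  "complex2_to_real4 (real4_to_complex2 x) = x" "real4_to_complex2 (complex2_to_real4 z) = z"
  by (simp_all add: vec_eq_iff forall_2 forall_4 real4_to_complex2_def complex2_to_real4_def)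

lemma linear_real4_to_complex2: "linear real4_to_complex2"
  by (rule linearI) (simp_all add: vec_eq_iff forall_2 real4_to_complex2_def complex_eq_iff)

lemma linear_complex2_to_real4: "linear complex2_to_real4"
  by (rule linearI) (simp_all add: vec_eq_iff forall_4 complex2_to_real4_def)

lemma real4_to_complex2_axis:
  "real4_to_complex2 (axis 1 1) = axis 1 1" "real4_to_complex2 (axis 2 1) = axis 1 \<i>"
  "real4_to_complex2 (axis 3 1) = axis 2 1" "real4_to_complex2 (axis 4 1) = axis 2 \<i>"
  by (simp_all add: vec_eq_iff forall_2 real4_to_complex2_def axis_def complex_eq_iff)

lemma lborel_distr_real4_to_complex2: "distr lborel borel real4_to_complex2 = lborel"
proof (rule lborel_distr_basis_bij[OF linear_real4_to_complex2])
  have b4: "(Basis :: (real^4) set) = {axis 1 1, axis 2 1, axis 3 1, axis 4 1}"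
    by (auto simp: Basis_vec_def UNIV_4)
  have b2: "(Basis :: (complex^2) set) = {axis 1 1, axis 1 \<i>, axis 2 1, axis 2 \<i>}"
    by (auto simp: Basis_vec_def UNIV_2 Basis_complex_def)
  have "real4_to_complex2 ` Basis = Basis"
    unfolding b4 b2 image_insert image_empty real4_to_complex2_axis ..
  moreover have "inj real4_to_complex2"
    by (metis injI real4_complex2_inverses(1))
  ultimately show "bij_betw real4_to_complex2 Basis Basis"
    by (metis bij_betw_imageI inj_on_subset subset_UNIV)
qed

text \<open>The identification carries Lebesgue measure to Lebesgue measure, since it permutes the basis vectors.\<close>

lemma set_integral_complex2_real4:
  fixes f :: "complex^2 \<Rightarrow> 'w::{banach, second_countable_topology}"
  assumes "set_integrable lborel V f"
  shows "set_integrable lborel (complex2_to_real4 ` V) (\<lambda>x. f (real4_to_complex2 x))"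
    and "(LINT x:complex2_to_real4 ` V|lborel. f (real4_to_complex2 x)) = (LINT z:V|lborel. f z)"
proof -
  have [measurable]: "real4_to_complex2 \<in> borel \<rightarrow>\<^sub>M borel"
    using linear_real4_to_complex2 linear_continuous_on linear_conv_bounded_linear
      borel_measurable_continuous_onI by blast
  define h where "h = (\<lambda>z. indicator V z *\<^sub>R f z)"
  have h: "integrable lborel h" using assms by (simp add: set_integrable_def h_def)
  then have [measurable]: "h \<in> borel_measurable borel" by auto
  have mem: "x \<in> complex2_to_real4 ` V \<longleftrightarrow> real4_to_complex2 x \<in> V" for x
    by (metis imageE imageI real4_complex2_inverses)
  have eq: "indicator (complex2_to_real4 ` V) x *\<^sub>R f (real4_to_complex2 x) = h (real4_to_complex2 x)" for x
    by (simp add: h_def mem indicator_def)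
  have "integrable (distr lborel borel real4_to_complex2) h"
    using h by (simp add: lborel_distr_real4_to_complex2)
  then show "set_integrable lborel (complex2_to_real4 ` V) (\<lambda>x. f (real4_to_complex2 x))"
    by (simp add: set_integrable_def eq integrable_distr_eq)
  have "(\<integral>z. h z \<partial>distr lborel borel real4_to_complex2) = (\<integral>x. h (real4_to_complex2 x) \<partial>lborel)"
    by (rule integral_distr) auto
  then show "(LINT x:complex2_to_real4 ` V|lborel. f (real4_to_complex2 x)) = (LINT z:V|lborel. f z)"
    by (simp add: set_lebesgue_integral_def eq lborel_distr_real4_to_complex2 h_def)
qed

text \<open>The determinant over the complex numbers of a complex-linear map of \<open>complex^2\<close>.\<close>

definition complex_jacobian :: "(complex^2 \<Rightarrow> complex^2) \<Rightarrow> complex" where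
  "complex_jacobian L = L (axis 1 1) $ 1 * L (axis 2 1) $ 2 - L (axis 1 1) $ 2 * L (axis 2 1) $ 1"

text \<open>The real determinant of a complex-linear map is the squared modulus of its complex determinant.\<close>

lemma det_complex_linear:
  assumes "\<And>i. L (axis i \<i>) = \<i> *s L (axis i 1)"
  shows "det (matrix (complex2_to_real4 \<circ> L \<circ> real4_to_complex2)) = (cmod (complex_jacobian L))\<^sup>2"
  unfolding det_4
  by (simp add: matrix_def real4_to_complex2_axis assms complex2_to_real4_def complex_jacobian_def cmod_power2)
     algebra

lemma integral_change_of_variables_complex2_real:
  fixes f :: "complex^2 \<Rightarrow> real"
  assumes U: "open U" and \<tau>: "\<And>z. z \<in> U \<Longrightarrow> (\<tau> has_derivative D z) (at z)"
    and hol: "\<And>z i. z \<in> U \<Longrightarrow> D z (axis i \<i>) = \<i> *s D z (axis i 1)"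
    and inj: "inj_on \<tau> U"
    and f: "set_integrable lborel (\<tau> ` U) f"
    and f\<tau>: "set_integrable lborel U (\<lambda>z. (cmod (complex_jacobian (D z)))\<^sup>2 * f (\<tau> z))"
  shows "(LINT z:U|lborel. (cmod (complex_jacobian (D z)))\<^sup>2 * f (\<tau> z)) = (LINT z:\<tau> ` U|lborel. f z)"
proof -
  let ?r = complex2_to_real4 and ?c = real4_to_complex2
  let ?S = "?r ` U" and ?g = "?r \<circ> \<tau> \<circ> ?c" and ?g' = "\<lambda>x. ?r \<circ> D (?c x) \<circ> ?c"
  have img: "?g ` ?S = ?r ` \<tau> ` U" by (simp add: image_image o_def)
  have "?S = ?c -` U"
    by (force simp: image_iff intro: real4_complex2_inverses(1)[symmetric])
  then have "open ?S"
    using U linear_continuous_on[of ?c UNIV] linear_real4_to_complex2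
    by (simp add: linear_conv_bounded_linear open_vimage)
  then have S: "?S \<in> sets lebesgue" by simp
  have der: "(?g has_derivative ?g' x) (at x within ?S)" if "x \<in> ?S" for x
  proof -
    have "?c x \<in> U" using that by auto
    have "(?c has_derivative ?c) (at x)" "(?r has_derivative ?r) (at y)" for y
      using linear_real4_to_complex2 linear_complex2_to_real4
      by (simp_all add: linear_imp_has_derivative)
    then have "(?g has_derivative ?g' x) (at x)"
      using \<tau>[OF \<open>?c x \<in> U\<close>] by (metis diff_chain_at)
    then show ?thesis by (rule has_derivative_at_withinI)
  qed
  have inj': "inj_on ?g ?S"
    using inj by (auto simp: inj_on_def) (metis real4_complex2_inverses(2))
  have ai: "h absolutely_integrable_on V" if "set_integrable lborel V h" for h :: "real^4 \<Rightarrow> real" and V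
    using that unfolding set_integrable_def by (simp add: integrable_completion)
  have "(LINT z:\<tau> ` U|lborel. f z) = integral (?g ` ?S) (\<lambda>x. f (?c x))"
    unfolding img set_integral_complex2_real4(2)[OF f, symmetric]
    using set_integral_complex2_real4(1)[OF f] by (rule set_borel_integral_eq_integral(2))
  also have "\<dots> = integral ?S (\<lambda>x. \<bar>det (matrix (?g' x))\<bar> * f (?c (?g x)))"
    by (rule integral_change_of_variables_real4[OF S der inj', symmetric])
       (assumption, unfold img, rule ai, rule set_integral_complex2_real4(1)[OF f])
  also have "\<dots> = integral ?S (\<lambda>x. (cmod (complex_jacobian (D (?c x))))\<^sup>2 * f (\<tau> (?c x)))"
  proof (intro integral_cong)
    fix x assume "x \<in> ?S"
    then have "?c x \<in> U" by auto
    then show "\<bar>det (matrix (?g' x))\<bar> * f (?c (?g x)) =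
        (cmod (complex_jacobian (D (?c x))))\<^sup>2 * f (\<tau> (?c x))"
      by (subst det_complex_linear) (use hol in auto)
  qed
  also have "\<dots> = (LINT x:?S|lborel. (cmod (complex_jacobian (D (?c x))))\<^sup>2 * f (\<tau> (?c x)))"
    using set_integral_complex2_real4(1)[OF f\<tau>]
    by (rule set_borel_integral_eq_integral(2)[symmetric])
  also have "\<dots> = (LINT z:U|lborel. (cmod (complex_jacobian (D z)))\<^sup>2 * f (\<tau> z))"
    by (rule set_integral_complex2_real4(2)[OF f\<tau>])
  finally show ?thesis ..
qed

text \<open>A complex function is treated through its real and imaginary parts; both are bounded linear functionals that
  commute with the real Jacobian factor.\<close>

lemma integral_change_of_variables_complex2:
  fixes f :: "complex^2 \<Rightarrow> complex"
  assumes U: "open U" and \<tau>: "\<And>z. z \<in> U \<Longrightarrow> (\<tau> has_derivative D z) (at z)"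
    and hol: "\<And>z i. z \<in> U \<Longrightarrow> D z (axis i \<i>) = \<i> *s D z (axis i 1)"
    and inj: "inj_on \<tau> U"
    and f: "set_integrable lborel (\<tau> ` U) f"
    and f\<tau>: "set_integrable lborel U (\<lambda>z. of_real ((cmod (complex_jacobian (D z)))\<^sup>2) * f (\<tau> z))"
  shows "(LINT z:U|lborel. of_real ((cmod (complex_jacobian (D z)))\<^sup>2) * f (\<tau> z)) = (LINT z:\<tau> ` U|lborel. f z)"
proof -
  have part: "(LINT z:U|lborel. (cmod (complex_jacobian (D z)))\<^sup>2 * h (f (\<tau> z))) = (LINT z:\<tau> ` U|lborel. h (f z)) \<and>
      h (LINT z:U|lborel. of_real ((cmod (complex_jacobian (D z)))\<^sup>2) * f (\<tau> z)) =
        (LINT z:U|lborel. (cmod (complex_jacobian (D z)))\<^sup>2 * h (f (\<tau> z))) \<and>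
      h (LINT z:\<tau> ` U|lborel. f z) = (LINT z:\<tau> ` U|lborel. h (f z))"
    if h: "bounded_linear h" and hm: "\<And>r w. h (of_real r * w) = r * h w" for h :: "complex \<Rightarrow> real"
  proof (intro conjI integral_change_of_variables_complex2_real[OF U \<tau> hol inj])
    show "set_integrable lborel (\<tau> ` U) (\<lambda>z. h (f z))"
      using integrable_bounded_linear[OF h f[unfolded set_integrable_def]] h
      by (simp add: set_integrable_def bounded_linear.linear linear_cmul)
    show "set_integrable lborel U (\<lambda>z. (cmod (complex_jacobian (D z)))\<^sup>2 * h (f (\<tau> z)))"
      using integrable_bounded_linear[OF h f\<tau>[unfolded set_integrable_def]] h
      by (simp add: set_integrable_def bounded_linear.linear linear_cmul hm flip: of_real_power)
    show "h (LINT z:U|lborel. of_real ((cmod (complex_jacobian (D z)))\<^sup>2) * f (\<tau> z)) =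
        (LINT z:U|lborel. (cmod (complex_jacobian (D z)))\<^sup>2 * h (f (\<tau> z)))"
      using integral_bounded_linear[OF h f\<tau>[unfolded set_integrable_def]] h
      by (simp add: set_lebesgue_integral_def bounded_linear.linear linear_cmul hm flip: of_real_power)
    show "h (LINT z:\<tau> ` U|lborel. f z) = (LINT z:\<tau> ` U|lborel. h (f z))"
      using integral_bounded_linear[OF h f[unfolded set_integrable_def]] h
      by (simp add: set_lebesgue_integral_def bounded_linear.linear linear_cmul)
  qed auto
  show ?thesis
    using part[OF bounded_linear_Re] part[OF bounded_linear_Im] by (simp add: complex_eq_iff)
qed

section \<open>Smooth partitions of unity\<close>

text \<open>The functions \<open>t\<^sup>-\<^sup>n exp (- 1/t)\<close> for \<open>t > 0\<close>, extended by zero. The case \<open>n = 0\<close> is the usual smooth function that is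
  flat at the origin; the whole family is considered because it is closed under differentiation.\<close>

definition flat_exp :: "nat \<Rightarrow> real \<Rightarrow> real" where
  "flat_exp n t = (if t > 0 then inverse t ^ n * exp (- inverse t) else 0)"

text \<open>At the origin the difference quotient from the right is \<open>x\<^sup>n\<^sup>+\<^sup>1 exp (- x)\<close> with \<open>x = 1/h\<close>, and tends to
  zero.\<close>

lemma flat_exp_has_derivative:
  "(flat_exp n has_field_derivative (flat_exp (n + 2) t - real n * flat_exp (n + 1) t)) (at t)"
proof -
  consider "t > 0" | "t < 0" | "t = 0" by linarith
  then show ?thesis
  proof cases
    case 1
    have inv: "(inverse has_field_derivative - (inverse t)\<^sup>2) (at t)"
      using DERIV_inverse[of t] 1 by (simp add: numeral_2_eq_2)
    have "((\<lambda>t. inverse t ^ n) has_field_derivative (- real n * inverse t ^ (n + 1))) (at t)"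
      using DERIV_power[OF inv, of n] by (cases n) (simp_all add: power2_eq_square algebra_simps)
    from DERIV_mult[OF this DERIV_fun_exp[OF DERIV_minus[OF inv]]]
    have "((\<lambda>t. inverse t ^ n * exp (- inverse t)) has_field_derivative
        (flat_exp (n + 2) t - real n * flat_exp (n + 1) t)) (at t)"
      using 1 by (simp add: flat_exp_def power2_eq_square algebra_simps)
    then show ?thesis
      by (rule has_field_derivative_transform_within_open[of _ _ _ "{0<..}"]) (use 1 in \<open>auto simp: flat_exp_def\<close>)
  next
    case 2
    have "((\<lambda>t. 0) has_field_derivative 0) (at t)" by simp
    then have "(flat_exp n has_field_derivative 0) (at t)"
      by (rule has_field_derivative_transform_within_open[of _ _ _ "{..<0}"]) (use 2 in \<open>auto simp: flat_exp_def\<close>)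
    then show ?thesis using 2 by (simp add: flat_exp_def)
  next
    case 3
    have "((\<lambda>h. (inverse h) ^ Suc n / exp (inverse h)) \<longlongrightarrow> (0::real)) (at_right 0)"
      by (rule filterlim_compose[OF tendsto_power_div_exp_0 filterlim_inverse_at_top_right])
    moreover have "eventually (\<lambda>h. (inverse h) ^ Suc n / exp (inverse h) = flat_exp n h / h) (at_right (0::real))"
      by (auto simp: eventually_at_filter flat_exp_def field_simps exp_minus)
    ultimately have "((\<lambda>h. flat_exp n h / h) \<longlongrightarrow> 0) (at_right 0)"
      using tendsto_cong by fast
    moreover have "((\<lambda>h. flat_exp n h / h) \<longlongrightarrow> 0) (at_left 0)"
      by (rule tendsto_eventually) (auto simp: eventually_at_filter flat_exp_def)
    ultimately have "((\<lambda>h. flat_exp n h / h) \<longlongrightarrow> 0) (at 0)"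
      by (simp add: filterlim_split_at_real)
    then show ?thesis using 3 by (simp add: DERIV_def flat_exp_def)
  qed
qed

lemma Ck_on_flat_exp: "Ck_on k UNIV (flat_exp n)"
proof (induction k arbitrary: n)
  case 0
  show ?case
    using flat_exp_has_derivative DERIV_isCont continuous_at_imp_continuous_on by (metis Ck_on.simps(1))
next
  case (Suc k)
  show ?case
  proof (rule Ck_on_SucI)
    show "(flat_exp n has_derivative (\<lambda>v. (flat_exp (n + 2) t + (- real n) * flat_exp (n + 1) t) * v)) (at t)" for t
      using flat_exp_has_derivative[of n t] by (simp add: has_field_derivative_def)
    show "Ck_on k UNIV (\<lambda>t. (flat_exp (n + 2) t + (- real n) * flat_exp (n + 1) t) * v)" for v
      by (intro Ck_on_mult Ck_on_add Ck_on_const Suc.IH open_UNIV)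
  qed simp
qed

definition bump :: "'v::euclidean_space \<Rightarrow> real \<Rightarrow> 'v \<Rightarrow> real" where
  "bump a r x = flat_exp 0 (r\<^sup>2 - (x - a) \<bullet> (x - a))"

lemma bump_nonneg: "0 \<le> bump a r x"
  by (simp add: bump_def flat_exp_def)

lemma bump_pos_iff:
  assumes "r > 0"
  shows "0 < bump a r x \<longleftrightarrow> x \<in> ball a r"
proof -
  have "(x - a) \<bullet> (x - a) < r\<^sup>2 \<longleftrightarrow> norm (x - a) < r"
    using assms unfolding power2_norm_eq_inner[symmetric] by (meson norm_ge_zero power2_less_imp_less power_strict_mono pos2 less_imp_le)
  then show ?thesis by (auto simp: bump_def flat_exp_def dist_norm norm_minus_commute)
qed

lemma Ck_on_bump: "open S \<Longrightarrow> Ck_on k S (bump a r)"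
proof -
  assume S: "open S"
  have d: "Ck_on k S (\<lambda>x. x + (- a))"
    by (intro Ck_on_add Ck_on_ident Ck_on_const S)
  have "Ck_on k S (\<lambda>x. r\<^sup>2 + (- 1) * ((x + (- a)) \<bullet> (x + (- a))))"
    by (rule Ck_on_add[OF S Ck_on_const Ck_on_mult[OF S Ck_on_const
          Ck_on_bilinear[OF bounded_bilinear_inner S d d]]])
  from Ck_on_compose[OF S open_UNIV _ this Ck_on_flat_exp]
  have "Ck_on k S (\<lambda>x. flat_exp 0 (r\<^sup>2 + (- 1) * ((x + (- a)) \<bullet> (x + (- a)))))"
    by simp
  then show ?thesis by (simp add: bump_def[abs_def])
qed

locale compact_complex_manifold =
  fixes X :: "'a topology" and A :: "('a, 'n::finite) chart set"
  assumes compact_X: "compact_space X" and manifold: "complex_manifold X A"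
begin

lemma Hausdorff_X: "Hausdorff_space X"
  using manifold by (simp add: complex_manifold_def)

lemma topspace_eq: "topspace X = (\<Union>c\<in>A. fst c)"
  using manifold by (simp add: complex_manifold_def)

lemma openin_chart: "c \<in> A \<Longrightarrow> openin X (fst c)"
  using manifold by (simp add: complex_manifold_def)

lemma chart_subset: "c \<in> A \<Longrightarrow> fst c \<subseteq> topspace X"
  using openin_chart openin_subset by blast

lemma open_chart_image: "c \<in> A \<Longrightarrow> open (chart_image c)"
  using manifold by (simp add: complex_manifold_def)

lemma homeomorphic_chart:
  "c \<in> A \<Longrightarrow> homeomorphic_map (subtopology X (fst c)) (top_of_set (chart_image c)) (snd c)"
  using manifold by (simp add: complex_manifold_def)

lemma inj_chart: "c \<in> A \<Longrightarrow> inj_on (snd c) (fst c)"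
  using homeomorphic_imp_injective_map[OF homeomorphic_chart] chart_subset
  by (simp add: topspace_subtopology inf.absorb2)

lemma chart_inv_chart [simp]: "c \<in> A \<Longrightarrow> x \<in> fst c \<Longrightarrow> chart_inv c (snd c x) = x"
  by (simp add: chart_inv_def inj_chart)

lemma chart_chart_inv [simp]: "z \<in> chart_image c \<Longrightarrow> snd c (chart_inv c z) = z"
  unfolding chart_inv_def chart_image_def by (rule f_inv_into_f)

lemma chart_inv_in [simp]: "z \<in> chart_image c \<Longrightarrow> chart_inv c z \<in> fst c"
  unfolding chart_inv_def chart_image_def by (rule inv_into_into)

lemma open_image_chart:
  assumes "c \<in> A" "openin X V" "V \<subseteq> fst c"
  shows "open (snd c ` V)"
proof -
  have "openin (subtopology X (fst c)) V"
    using assms by (simp add: openin_open_subtopology openin_chart)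
  moreover have "open_map (subtopology X (fst c)) (top_of_set (chart_image c)) (snd c)"
    using homeomorphic_chart[OF assms(1)] homeomorphic_imp_open_map by blast
  ultimately have "openin (top_of_set (chart_image c)) (snd c ` V)"
    by (simp add: open_map_def)
  then show ?thesis using open_chart_image[OF assms(1)] openin_open_trans by blast
qed

lemma open_overlap: "c \<in> A \<Longrightarrow> d \<in> A \<Longrightarrow> open (snd c ` (fst c \<inter> fst d))"
  by (rule open_image_chart) (auto intro: openin_Int openin_chart)

lemma continuous_map_chart_inv:
  assumes "c \<in> A"
  shows "continuous_map (top_of_set (chart_image c)) X (chart_inv c)"
proof -
  obtain g where g: "homeomorphic_maps (subtopology X (fst c)) (top_of_set (chart_image c)) (snd c) g"
    using homeomorphic_chart[OF assms] homeomorphic_map_maps by blast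
  have "g z = chart_inv c z" if z: "z \<in> chart_image c" for z
  proof -
    have "g (snd c (chart_inv c z)) = chart_inv c z"
      using g chart_inv_in[OF z] chart_subset[OF assms] by (auto simp: homeomorphic_maps_def)
    then show ?thesis using z by simp
  qed
  moreover have "continuous_map (top_of_set (chart_image c)) X g"
    using g by (auto simp: homeomorphic_maps_def continuous_map_in_subtopology)
  ultimately show ?thesis
    by (auto elim: continuous_map_eq)
qed

lemma compact_image_chart:
  assumes "c \<in> A" "compactin X K" "K \<subseteq> fst c"
  shows "compact (snd c ` K)"
proof -
  have "compactin (subtopology X (fst c)) K"
    using assms by (simp add: compactin_subtopology)
  moreover have "continuous_map (subtopology X (fst c)) euclidean (snd c)"
    using homeomorphic_imp_continuous_map[OF homeomorphic_chart[OF assms(1)]]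
    by (simp add: continuous_map_in_subtopology)
  ultimately have "compactin euclidean (snd c ` K)" by (rule image_compactin)
  then show ?thesis by simp
qed

lemma compactin_chart_inv_image:
  assumes "c \<in> A" "compact K" "K \<subseteq> chart_image c"
  shows "compactin X (chart_inv c ` K)"
  by (rule image_compactin[OF _ continuous_map_chart_inv[OF assms(1)]])
    (use assms in \<open>simp add: compactin_subtopology\<close>)

lemma openin_chart_inv_image:
  assumes "c \<in> A" "open V" "V \<subseteq> chart_image c"
  shows "openin X (chart_inv c ` V)"
proof -
  have "chart_inv c ` V = {x \<in> topspace (subtopology X (fst c)). snd c x \<in> V}"
    using assms chart_subset[OF assms(1)] by (auto simp: image_iff subset_iff) (metis chart_inv_chart)
  moreover have "openin (subtopology X (fst c)) {x \<in> topspace (subtopology X (fst c)). snd c x \<in> V}"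
    using homeomorphic_imp_continuous_map[OF homeomorphic_chart[OF assms(1)]] assms(2)
    by (intro openin_continuous_map_preimage[where Y = euclidean])
       (simp_all add: continuous_map_in_subtopology)
  ultimately show ?thesis
    using openin_chart[OF assms(1)] openin_trans_full by metis
qed

lemma smooth_transition:
  "c \<in> A \<Longrightarrow> d \<in> A \<Longrightarrow> Ck_on k (snd c ` (fst c \<inter> fst d)) (transition c d)"
  using manifold by (simp add: complex_manifold_def holomorphic_map_on_def smooth_on_def)

text \<open>A bump in one chart, extended by zero, is smooth in every other chart \<open>d\<close>: the image of \<open>d\<close> is covered by
  two open sets, the overlap of the charts, where the function is a bump composed with a transition map, and the
  complement of the compact support, where it vanishes. Closedness of the support uses the Hausdorff property.\<close>

lemma bump_function_exists:
  assumes x: "x \<in> topspace X"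
  shows "\<exists>c b K N. c \<in> A \<and> smooth_function A b \<and> (\<forall>y. 0 \<le> b y) \<and> compactin X K \<and> K \<subseteq> fst c \<and>
    (\<forall>y\<in>topspace X. b y \<noteq> 0 \<longrightarrow> y \<in> K) \<and> openin X N \<and> x \<in> N \<and> (\<forall>y\<in>N. 0 < b y)"
proof -
  obtain c where c: "c \<in> A" "x \<in> fst c" using x topspace_eq by auto
  let ?z = "snd c x"
  have "?z \<in> chart_image c" using c by (simp add: chart_image_def)
  then obtain r where r: "r > 0" "cball ?z r \<subseteq> chart_image c"
    using open_chart_image[OF c(1)] open_contains_cball by blast
  have ballr: "ball ?z r \<subseteq> chart_image c" using r(2) by auto
  define b where "b = (\<lambda>y. if y \<in> fst c then bump ?z r (snd c y) else 0)"
  define K where "K = chart_inv c ` cball ?z r"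
  have K: "compactin X K" "K \<subseteq> fst c"
    unfolding K_def using compactin_chart_inv_image[OF c(1) _ r(2)] r(2) by auto
  have supp: "y \<in> K" if "b y \<noteq> 0" for y
  proof -
    have "y \<in> fst c" "snd c y \<in> cball ?z r"
      using that bump_nonneg[of ?z r "snd c y"] bump_pos_iff[OF r(1), of ?z "snd c y"]
      by (auto simp: b_def split: if_splits)
    then show ?thesis unfolding K_def using c(1) by (metis chart_inv_chart imageI)
  qed
  have "smooth_on (chart_image d) (b \<circ> chart_inv d)" if d: "d \<in> A" for d
    unfolding smooth_on_def
  proof (intro conjI allI)
    show "open (chart_image d)" by (rule open_chart_image[OF d])
    fix k
    let ?U = "snd d ` (fst d \<inter> fst c)" and ?V = "snd d ` (fst d - K)"
    have oU: "open ?U" by (rule open_overlap[OF d c(1)])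
    have "closedin X K" using K(1) Hausdorff_X compactin_imp_closedin by blast
    then have oV: "open ?V"
      by (intro open_image_chart[OF d] openin_diff openin_chart[OF d]) auto
    have "Ck_on k ?U (\<lambda>z. bump ?z r (transition d c z))"
      by (rule Ck_on_compose[OF oU open_UNIV _ smooth_transition[OF d c(1)] Ck_on_bump]) auto
    moreover have "bump ?z r (transition d c z) = (b \<circ> chart_inv d) z" if "z \<in> ?U" for z
      using that d by (auto simp: b_def transition_def)
    ultimately have 1: "Ck_on k ?U (b \<circ> chart_inv d)"
      using Ck_on_cong[OF oU] by metis
    have "(b \<circ> chart_inv d) z = 0" if "z \<in> ?V" for z
      using that d supp by force
    then have 2: "Ck_on k ?V (b \<circ> chart_inv d)"
      using Ck_on_cong[OF oV, of "b \<circ> chart_inv d" "\<lambda>_. 0"] Ck_on_const by metis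
    have "chart_image d = \<Union>{?U, ?V}"
      using K(2) by (auto simp: chart_image_def)
    then show "Ck_on k (chart_image d) (b \<circ> chart_inv d)"
      using Ck_on_Union[of "{?U, ?V}" k "b \<circ> chart_inv d"] 1 2 oU oV by auto
  qed
  then have "smooth_function A b" by (simp add: smooth_function_def)
  moreover have "openin X (chart_inv c ` ball ?z r)"
    by (rule openin_chart_inv_image[OF c(1) _ ballr]) simp
  moreover have "x \<in> chart_inv c ` ball ?z r"
    using c r(1) by (intro image_eqI[of _ _ ?z]) auto
  moreover have "0 < b y" if "y \<in> chart_inv c ` ball ?z r" for y
    using that ballr bump_pos_iff[OF r(1), of ?z] by (auto simp: b_def subset_iff)
  moreover have "\<forall>y. 0 \<le> b y" by (simp add: b_def bump_nonneg)
  ultimately show ?thesis using c(1) K supp by meson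
qed

text \<open>Finitely many bumps are positive somewhere at each point, by compactness. Grouping them by the chart in which
  they are supported and dividing by their sum gives the partition.\<close>

lemma finite_partition_of_unity_exists: "\<exists>\<rho>. finite_partition_of_unity X A \<rho>"
proof -
  obtain c b K N where cbKN: "\<And>x. x \<in> topspace X \<Longrightarrow> c x \<in> A \<and> smooth_function A (b x) \<and>
      (\<forall>y. 0 \<le> b x y) \<and> compactin X (K x) \<and> K x \<subseteq> fst (c x) \<and>
      (\<forall>y\<in>topspace X. b x y \<noteq> 0 \<longrightarrow> y \<in> K x) \<and> openin X (N x) \<and> x \<in> N x \<and> (\<forall>y\<in>N x. (0::real) < b x y)"
    using bump_function_exists by metis
  have "\<forall>U\<in>N ` topspace X. openin X U" "topspace X \<subseteq> \<Union>(N ` topspace X)"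
    using cbKN by auto
  then obtain \<F> where \<F>: "finite \<F>" "\<F> \<subseteq> N ` topspace X" "topspace X \<subseteq> \<Union>\<F>"
    using compact_X[unfolded compact_space_alt, rule_format, of "N ` topspace X"] by auto
  obtain F where F: "F \<subseteq> topspace X" "finite F" "\<F> = N ` F"
    using finite_subset_image[OF \<F>(1,2)] by metis
  have F: "finite F" "F \<subseteq> topspace X" "topspace X \<subseteq> \<Union>(N ` F)"
    using F \<F>(3) by simp_all
  define s where "s = (\<lambda>y. \<Sum>x\<in>F. b x y)"
  define \<rho> where "\<rho> = (\<lambda>d y. (\<Sum>x\<in>{x\<in>F. c x = d}. b x y) * inverse (s y))"
  have s_pos: "s y > 0" if y: "y \<in> topspace X" for y
  proof -
    obtain x where "x \<in> F" "y \<in> N x" using F y by auto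
    then show ?thesis unfolding s_def using F cbKN by (intro sum_pos2[of F x]) auto
  qed
  have smooth_sum: "Ck_on k (chart_image e) (\<lambda>z. \<Sum>x\<in>G. b x (chart_inv e z))"
    if "e \<in> A" "G \<subseteq> F" for e G k
  proof (rule Ck_on_sum[OF open_chart_image[OF that(1)]])
    fix x assume "x \<in> G"
    then have "smooth_on (chart_image e) (b x \<circ> chart_inv e)"
      using that F cbKN by (auto simp: smooth_function_def)
    then show "Ck_on k (chart_image e) (\<lambda>z. b x (chart_inv e z))"
      by (simp add: smooth_on_def o_def)
  qed
  have smooth: "smooth_function A (\<rho> d)" for d
    unfolding smooth_function_def smooth_on_def
  proof (intro ballI conjI allI)
    fix e k assume e: "e \<in> A"
    show "open (chart_image e)" by (rule open_chart_image[OF e])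
    have "Ck_on k (chart_image e) (\<lambda>z. inverse (s (chart_inv e z)))"
    proof (rule Ck_on_inverse[OF open_chart_image[OF e]])
      show "s (chart_inv e z) \<noteq> 0" if "z \<in> chart_image e" for z
        using s_pos[of "chart_inv e z"] chart_inv_in[OF that] chart_subset[OF e] by force
      show "Ck_on k (chart_image e) (\<lambda>z. s (chart_inv e z))"
        unfolding s_def by (rule smooth_sum[OF e]) auto
    qed
    then have "Ck_on k (chart_image e) (\<lambda>z. (\<Sum>x\<in>{x\<in>F. c x = d}. b x (chart_inv e z)) * inverse (s (chart_inv e z)))"
      by (intro Ck_on_mult[OF open_chart_image[OF e]] smooth_sum[OF e]) auto
    then show "Ck_on k (chart_image e) (\<rho> d \<circ> chart_inv e)"
      by (simp add: \<rho>_def o_def)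
  qed
  have nonneg: "0 \<le> \<rho> d y" if "y \<in> topspace X" for d y
    unfolding \<rho>_def using F cbKN s_pos[OF that] by (intro mult_nonneg_nonneg sum_nonneg) auto
  have active: "\<exists>x\<in>F. c x = d \<and> y \<in> K x" if "y \<in> topspace X" "\<rho> d y \<noteq> 0" for d y
  proof -
    have "(\<Sum>x\<in>{x\<in>F. c x = d}. b x y) \<noteq> 0" using that by (auto simp: \<rho>_def)
    then obtain x where "x \<in> F" "c x = d" "b x y \<noteq> 0" by (auto dest: sum.not_neutral_contains_not_neutral)
    then show ?thesis using F that cbKN by blast
  qed
  have supp: "X closure_of {x \<in> topspace X. \<rho> d x \<noteq> 0} \<subseteq> fst d" for d
  proof -
    let ?L = "\<Union>(K ` {x\<in>F. c x = d})"
    have "closedin X ?L"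
      using F cbKN Hausdorff_X by (intro closedin_Union) (auto intro!: compactin_imp_closedin)
    then have "X closure_of {x \<in> topspace X. \<rho> d x \<noteq> 0} \<subseteq> ?L"
      using active by (intro closure_of_minimal) blast+
    also have "?L \<subseteq> fst d" using F cbKN by fastforce
    finally show ?thesis .
  qed
  have sub: "active_charts X A \<rho> \<subseteq> c ` F"
    unfolding active_charts_def using active by blast
  have "(\<Sum>d\<in>active_charts X A \<rho>. \<rho> d y) = 1" if y: "y \<in> topspace X" for y
  proof -
    have "(\<Sum>d\<in>active_charts X A \<rho>. \<rho> d y) = (\<Sum>d\<in>c ` F. \<rho> d y)"
      using F cbKN y by (intro sum.mono_neutral_left sub) (auto simp: active_charts_def)
    also have "\<dots> = (\<Sum>d\<in>c ` F. \<Sum>x\<in>{x\<in>F. c x = d}. b x y) * inverse (s y)"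
      by (simp add: \<rho>_def sum_distrib_right)
    also have "(\<Sum>d\<in>c ` F. \<Sum>x\<in>{x\<in>F. c x = d}. b x y) = s y"
      unfolding s_def by (rule sum.image_gen[OF F(1), symmetric])
    finally show ?thesis using s_pos[OF y] by simp
  qed
  then have "finite_partition_of_unity X A \<rho>"
    unfolding finite_partition_of_unity_def
    using smooth nonneg supp finite_subset[OF sub] F(1) by auto
  then show ?thesis by blast
qed

end

section \<open>The divergence theorem on a compact complex surface\<close>

lemma frechet_derivative_zero_outside:
  assumes "closed K" "\<And>x. x \<notin> K \<Longrightarrow> F x = 0" "x \<notin> K"
  shows "frechet_derivative F (at x) = (\<lambda>_. 0)"
proof -
  have "((\<lambda>_. 0) has_derivative (\<lambda>_. 0)) (at x)" by simp
  then have "(F has_derivative (\<lambda>_. 0)) (at x)"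
    by (rule has_derivative_transform_within_open[of _ _ _ _ "- K"]) (use assms in auto)
  then show ?thesis using frechet_derivative_at by metis
qed

lemma integral_pd_z_compact_support:
  fixes F :: "complex^'n \<Rightarrow> complex"
  assumes F: "Ck_on 1 UNIV F" and K: "compact K" "\<And>x. x \<notin> K \<Longrightarrow> F x = 0"
  shows "(\<integral>z. pd_z i F z \<partial>lborel) = 0"
proof -
  let ?D = "\<lambda>v x. frechet_derivative F (at x) v"
  have F': "Ck_on (Suc 0) UNIV F" using F by simp
  have cont: "continuous_on UNIV (?D v)" for v using F' by simp
  have int: "integrable lborel (?D v)" for v
    by (rule integrable_continuous_compact_support[OF K(1) continuous_on_subset[OF cont]])
      (simp_all add: frechet_derivative_zero_outside[OF compact_imp_closed[OF K(1)] K(2)])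
  have zero: "(\<integral>z. ?D v z \<partial>lborel) = 0" for v
    by (rule integral_directional_derivative_compact_support[OF K Ck_on_SucD[OF F'] cont]) simp_all
  show ?thesis
    unfolding pd_z_def using int by (simp add: zero)
qed

locale compact_complex_surface = compact_complex_manifold X A
  for X :: "'a topology" and A :: "('a, 2) chart set"
begin

abbreviation overlap :: "('a, 2) chart \<Rightarrow> ('a, 2) chart \<Rightarrow> (complex^2) set" where
  "overlap c d \<equiv> snd c ` (fst c \<inter> fst d)"

text \<open>A real function in local coordinates, with complex values so that the Wirtinger operators apply.\<close>

abbreviation local_fun :: "('a \<Rightarrow> real) \<Rightarrow> ('a, 2) chart \<Rightarrow> complex^2 \<Rightarrow> complex" where
  "local_fun u c \<equiv> \<lambda>z. complex_of_real (u (chart_inv c z))"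

text \<open>The entry at \<open>i\<close> and \<open>k\<close> is the derivative of the \<open>k\<close>-th new coordinate along the \<open>i\<close>-th old one.\<close>

definition jac :: "('a, 2) chart \<Rightarrow> ('a, 2) chart \<Rightarrow> complex^2 \<Rightarrow> 2 \<Rightarrow> 2 \<Rightarrow> complex" where
  "jac c d z i k = pd_z i (\<lambda>w. transition c d w $ k) z"

definition jac_det :: "('a, 2) chart \<Rightarrow> ('a, 2) chart \<Rightarrow> complex^2 \<Rightarrow> complex" where
  "jac_det c d z = jac c d z 1 1 * jac c d z 2 2 - jac c d z 1 2 * jac c d z 2 1"

lemma Ck_on_local_fun:
  assumes "smooth_function A u" "c \<in> A"
  shows "Ck_on k (chart_image c) (local_fun u c)"
  using Ck_on_bounded_linear[OF bounded_linear_of_real open_chart_image[OF assms(2)], of k "u \<circ> chart_inv c"] assms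
  by (simp add: smooth_function_def smooth_on_def o_def)

context
  fixes c d assumes c: "c \<in> A" and d: "d \<in> A"
begin

lemma transition_in: "z \<in> overlap c d \<Longrightarrow> transition c d z \<in> overlap d c"
  using c d by (auto simp: transition_def)

lemma chart_inv_transition: "z \<in> overlap c d \<Longrightarrow> chart_inv d (transition c d z) = chart_inv c z"
  using c d by (auto simp: transition_def)

lemma transition_image: "transition c d ` overlap c d = overlap d c"
proof -
  have "snd d x \<in> transition c d ` overlap c d" if "x \<in> fst c \<inter> fst d" for x
    using that c by (intro image_eqI[of _ _ "snd c x"]) (auto simp: transition_def)
  then show ?thesis using transition_in by blast
qed

lemma inj_on_transition: "inj_on (transition c d) (overlap c d)"
proof (rule inj_onI)
  fix z w assume zw: "z \<in> overlap c d" "w \<in> overlap c d" "transition c d z = transition c d w"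
  then have "chart_inv c z = chart_inv c w" using chart_inv_transition by metis
  then show "z = w" using zw c by auto
qed

lemma transition_differentiable: "z \<in> overlap c d \<Longrightarrow> transition c d differentiable (at z)"
  using smooth_transition[OF c d, of "Suc 0"] by auto

lemma transition_holomorphic: "z \<in> overlap c d \<Longrightarrow> pd_zbar i (\<lambda>w. transition c d w $ k) z = 0"
  using manifold c d unfolding complex_manifold_def holomorphic_map_on_def by blast

lemma transition_derivative:
  assumes "z \<in> overlap c d"
  defines "D \<equiv> frechet_derivative (transition c d) (at z)"
  shows "(transition c d has_derivative D) (at z)" "D (axis i \<i>) = \<i> *s D (axis i 1)"
    "complex_jacobian D = jac_det c d z"
proof -
  show D: "(transition c d has_derivative D) (at z)"
    unfolding D_def using transition_differentiable[OF assms(1)] by (simp add: frechet_derivative_works)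
  note h = holomorphic_derivative[OF D transition_holomorphic[OF assms(1)]]
  show "D (axis i \<i>) = \<i> *s D (axis i 1)"
    by (simp add: vec_eq_iff h(1))
  show "complex_jacobian D = jac_det c d z"
    by (simp add: complex_jacobian_def jac_det_def jac_def h(2))
qed

lemma pd_local_fun_transition:
  assumes u: "smooth_function A u" and z: "z \<in> overlap c d"
  shows "pd_z i (local_fun u c) z = (\<Sum>k\<in>UNIV. pd_z k (local_fun u d) (transition c d z) * jac c d z i k)"
    and "pd_zbar i (local_fun u c) z =
      (\<Sum>k\<in>UNIV. pd_zbar k (local_fun u d) (transition c d z) * cnj (jac c d z i k))"
proof -
  have tz: "transition c d z \<in> chart_image d" and zc: "z \<in> chart_image c"
    using transition_in[OF z] z by (auto simp: chart_image_def)
  have "local_fun u c differentiable (at z)"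
    using Ck_on_local_fun[OF u c, of "Suc 0"] zc by simp
  note cong = pd_cong[OF open_overlap[OF c d] z _ this, of "\<lambda>w. local_fun u d (transition c d w)"]
  have du: "local_fun u d differentiable (at (transition c d z))"
    using Ck_on_local_fun[OF u d, of "Suc 0"] tz by simp
  note chain = pd_chain_holomorphic[OF transition_differentiable[OF z] transition_holomorphic[OF z] du]
  show "pd_z i (local_fun u c) z = (\<Sum>k\<in>UNIV. pd_z k (local_fun u d) (transition c d z) * jac c d z i k)"
    unfolding jac_def chain(1)[symmetric] by (rule cong(1)) (simp add: chart_inv_transition)
  show "pd_zbar i (local_fun u c) z =
      (\<Sum>k\<in>UNIV. pd_zbar k (local_fun u d) (transition c d z) * cnj (jac c d z i k))"
    unfolding jac_def chain(2)[symmetric] by (rule cong(2)) (simp add: chart_inv_transition)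
qed

end

text \<open>Continuous families of local functions with the transformation law of top-degree forms.\<close>

definition scalar_density :: "(('a, 2) chart \<Rightarrow> complex^2 \<Rightarrow> complex) \<Rightarrow> bool" where
  "scalar_density \<theta> \<longleftrightarrow> (\<forall>c\<in>A. continuous_on (chart_image c) (\<theta> c)) \<and>
     (\<forall>c\<in>A. \<forall>d\<in>A. \<forall>z\<in>overlap c d.
        \<theta> c z = of_real ((cmod (jac_det c d z))\<^sup>2) * \<theta> d (transition c d z))"

definition supported_in :: "'a set \<Rightarrow> ('a, 2) chart \<Rightarrow> (complex^2 \<Rightarrow> complex) \<Rightarrow> bool" where
  "supported_in K c f \<longleftrightarrow> (\<forall>z\<in>chart_image c. chart_inv c z \<notin> K \<longrightarrow> f z = 0)"

lemma set_integrable_supported: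
  assumes c: "c \<in> A" and K: "compactin X K" "K \<subseteq> fst c" and f: "continuous_on (chart_image c) f"
    and supp: "supported_in K c f" and S: "snd c ` K \<subseteq> S" "S \<subseteq> chart_image c"
  shows "set_integrable lborel S f"
  unfolding set_integrable_def
proof (rule integrable_continuous_compact_support)
  show "compact (snd c ` K)" by (rule compact_image_chart[OF c K])
  have "continuous_on (snd c ` K) f" using f S continuous_on_subset by blast
  then show "continuous_on (snd c ` K) (\<lambda>x. indicator S x *\<^sub>R f x)"
    by (rule continuous_on_eq) (use S in auto)
  show "indicator S z *\<^sub>R f z = 0" if "z \<notin> snd c ` K" for z
  proof (cases "z \<in> S")
    case True
    then have "z \<in> chart_image c" using S by blast
    moreover from this have "chart_inv c z \<notin> K" using that by (metis chart_chart_inv imageI)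
    ultimately show ?thesis using supp by (simp add: supported_in_def)
  qed simp
qed

lemma set_integral_supported:
  assumes c: "c \<in> A" and K: "K \<subseteq> fst c"
    and supp: "supported_in K c f" and S: "snd c ` K \<subseteq> S" "S \<subseteq> chart_image c"
  shows "(LINT z:chart_image c|lborel. f z) = (LINT z:S|lborel. f z)"
proof -
  have "indicator (chart_image c) z *\<^sub>R f z = indicator S z *\<^sub>R f z" for z
  proof (cases "z \<in> chart_image c \<and> z \<notin> S")
    case True
    then have "chart_inv c z \<notin> K" using S by (metis chart_chart_inv imageI subsetD)
    then show ?thesis using True supp by (simp add: supported_in_def)
  qed (use S in \<open>auto simp: indicator_def\<close>)
  then show ?thesis by (simp only: set_lebesgue_integral_def)
qed

text \<open>Off the support the density vanishes, so both integrals extend over the overlap only, where the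
  transition map is an injective holomorphic change of variables.\<close>

lemma integral_density_change_chart:
  assumes \<theta>: "scalar_density \<theta>" and c: "c \<in> A" and d: "d \<in> A"
    and K: "compactin X K" "K \<subseteq> fst c \<inter> fst d"
    and supp: "supported_in K c (\<theta> c)" "supported_in K d (\<theta> d)"
  shows "(LINT z:chart_image c|lborel. \<theta> c z) = (LINT z:chart_image d|lborel. \<theta> d z)"
proof -
  let ?\<tau> = "transition c d"
  have Kc: "K \<subseteq> fst c" and Kd: "K \<subseteq> fst d" using K by auto
  have cont: "continuous_on (chart_image c) (\<theta> c)" "continuous_on (chart_image d) (\<theta> d)"
    using \<theta> c d by (auto simp: scalar_density_def)
  have Sc: "snd c ` K \<subseteq> overlap c d" "overlap c d \<subseteq> chart_image c"
    and Sd: "snd d ` K \<subseteq> overlap d c" "overlap d c \<subseteq> chart_image d"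
    using K by (auto simp: chart_image_def)
  have law: "\<theta> c z = of_real ((cmod (complex_jacobian (frechet_derivative ?\<tau> (at z))))\<^sup>2) * \<theta> d (?\<tau> z)"
    if "z \<in> overlap c d" for z
    unfolding transition_derivative(3)[OF c d that]
    using \<theta> c d that unfolding scalar_density_def by blast
  have 1: "set_integrable lborel (?\<tau> ` overlap c d) (\<theta> d)"
    unfolding transition_image[OF c d]
    by (rule set_integrable_supported[OF d K(1) Kd cont(2) supp(2) Sd])
  have "set_integrable lborel (overlap c d) (\<theta> c)"
    by (rule set_integrable_supported[OF c K(1) Kc cont(1) supp(1) Sc])
  moreover have "(\<lambda>z. indicator (overlap c d) z *\<^sub>R \<theta> c z) = (\<lambda>z. indicator (overlap c d) z *\<^sub>R
      (of_real ((cmod (complex_jacobian (frechet_derivative ?\<tau> (at z))))\<^sup>2) * \<theta> d (?\<tau> z)))"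
    by (rule ext) (auto simp: law indicator_def)
  ultimately have 2: "set_integrable lborel (overlap c d)
      (\<lambda>z. of_real ((cmod (complex_jacobian (frechet_derivative ?\<tau> (at z))))\<^sup>2) * \<theta> d (?\<tau> z))"
    unfolding set_integrable_def by metis
  have "(LINT z:chart_image c|lborel. \<theta> c z) = (LINT z:overlap c d|lborel. \<theta> c z)"
    by (rule set_integral_supported[OF c Kc supp(1) Sc])
  also have "\<dots> = (LINT z:overlap c d|lborel.
      of_real ((cmod (complex_jacobian (frechet_derivative ?\<tau> (at z))))\<^sup>2) * \<theta> d (?\<tau> z))"
    unfolding set_lebesgue_integral_def
    by (rule Bochner_Integration.integral_cong) (auto simp: law indicator_def)
  also have "\<dots> = (LINT z:?\<tau> ` overlap c d|lborel. \<theta> d z)"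
    by (rule integral_change_of_variables_complex2[OF open_overlap[OF c d]
          transition_derivative(1)[OF c d] transition_derivative(2)[OF c d] inj_on_transition[OF c d] 1 2])
  also have "\<dots> = (LINT z:chart_image d|lborel. \<theta> d z)"
    unfolding transition_image[OF c d]
    by (rule set_integral_supported[OF d Kd supp(2) Sd, symmetric])
  finally show ?thesis .
qed

end

locale surface_with_partition = compact_complex_surface +
  fixes \<rho> :: "('a, 2) chart \<Rightarrow> 'a \<Rightarrow> real"
  assumes partition: "finite_partition_of_unity X A \<rho>"
begin

abbreviation active :: "('a, 2) chart set" where "active \<equiv> active_charts X A \<rho>"

text \<open>The function of \<open>\<rho>\<close> belonging to the chart \<open>d\<close>, in the coordinates of another chart.\<close>

abbreviation weight :: "('a, 2) chart \<Rightarrow> ('a, 2) chart \<Rightarrow> complex^2 \<Rightarrow> complex" where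
  "weight d \<equiv> local_fun (\<rho> d)"

definition weight_support :: "('a, 2) chart \<Rightarrow> 'a set" where
  "weight_support c = X closure_of {x \<in> topspace X. \<rho> c x \<noteq> 0}"

lemma finite_active: "finite active" and active_subset: "active \<subseteq> A"
  using partition by (auto simp: finite_partition_of_unity_def active_charts_def)

lemma smooth_weight: "c \<in> A \<Longrightarrow> smooth_function A (\<rho> c)"
  using partition by (simp add: finite_partition_of_unity_def)

lemma weight_nonneg: "c \<in> A \<Longrightarrow> d \<in> A \<Longrightarrow> z \<in> chart_image d \<Longrightarrow> 0 \<le> \<rho> c (chart_inv d z)"
  using partition chart_inv_in chart_subset unfolding finite_partition_of_unity_def by blast

lemma sum_weight:
  assumes "d \<in> A" "z \<in> chart_image d"
  shows "(\<Sum>c\<in>active. weight c d z) = 1"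
proof -
  have "chart_inv d z \<in> topspace X" using assms chart_inv_in chart_subset by blast
  then have "(\<Sum>c\<in>active. \<rho> c (chart_inv d z)) = 1"
    using partition by (simp add: finite_partition_of_unity_def)
  then show ?thesis by (metis of_real_1 of_real_sum)
qed

lemma weight_support_subset: "c \<in> A \<Longrightarrow> weight_support c \<subseteq> fst c"
  using partition by (simp add: finite_partition_of_unity_def weight_support_def)

lemma compactin_weight_support: "compactin X (weight_support c)"
  unfolding weight_support_def by (intro closedin_compact_space compact_X closedin_closure_of)

lemma weight_zero:
  assumes "d \<in> A" "z \<in> chart_image d" "chart_inv d z \<notin> weight_support c"
  shows "\<rho> c (chart_inv d z) = 0"
proof (rule ccontr)
  assume "\<rho> c (chart_inv d z) \<noteq> 0"
  moreover have "chart_inv d z \<in> topspace X" using assms chart_inv_in chart_subset by blast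
  ultimately have "chart_inv d z \<in> weight_support c"
    unfolding weight_support_def by (intro subsetD[OF closure_of_subset]) auto
  with assms show False by blast
qed

lemma open_off_support:
  assumes "d \<in> A"
  shows "open {z \<in> chart_image d. chart_inv d z \<notin> weight_support c}"
proof -
  have "closedin X (weight_support c)" by (simp add: weight_support_def)
  then have "open (snd d ` (fst d - weight_support c))"
    by (intro open_image_chart[OF assms] openin_diff openin_chart[OF assms]) auto
  moreover have "snd d ` (fst d - weight_support c) = {z \<in> chart_image d. chart_inv d z \<notin> weight_support c}"
    using assms by (auto simp: chart_image_def)
  ultimately show ?thesis by simp
qed

lemma pd_weight_zero:
  assumes d: "d \<in> A" and z: "z \<in> chart_image d" "chart_inv d z \<notin> weight_support c"
  shows "pd_z i (weight c d) z = 0"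
proof -
  have "pd_z i (\<lambda>_. 0) z = pd_z i (weight c d) z"
    by (rule pd_cong[OF open_off_support[OF d, of c]]) (use z d weight_zero in auto)
  then show ?thesis by (simp add: pd_const)
qed

text \<open>Integration by parts in one chart. Since \<open>\<rho>\<^sub>c\<close> has compact support in the domain of \<open>c\<close>, its product with the
  field extends by zero to a \<open>C\<^sup>1\<close> field on the whole space, and no boundary term occurs.\<close>

lemma integral_weighted_divergence:
  assumes c: "c \<in> A" and W: "\<And>i. Ck_on 1 (chart_image c) (W i)"
  shows "(LINT z:chart_image c|lborel. weight c c z * (\<Sum>i\<in>UNIV. pd_z i (W i) z)) =
    - (LINT z:chart_image c|lborel. (\<Sum>i\<in>UNIV. pd_z i (weight c c) z * W i z))"
proof -
  let ?Z = "chart_image c" and ?w = "weight c c" and ?K = "snd c ` weight_support c"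
  have oZ: "open ?Z" by (rule open_chart_image[OF c])
  have K: "compact ?K" and KZ: "?K \<subseteq> ?Z"
    using compact_image_chart[OF c compactin_weight_support weight_support_subset[OF c]]
      weight_support_subset[OF c] by (auto simp: chart_image_def)
  have w: "Ck_on k ?Z ?w" for k by (rule Ck_on_local_fun[OF smooth_weight[OF c] c])
  have w0: "?w z = 0" if "z \<in> ?Z" "z \<notin> ?K" for z
    using weight_zero[OF c that(1), of c] that by (metis chart_chart_inv imageI of_real_0)
  define F where "F = (\<lambda>i z. if z \<in> ?Z then ?w z * W i z else 0)"
  have F0: "F i z = 0" if "z \<notin> ?K" for i z
    using that w0 by (simp add: F_def)
  have prod: "Ck_on 1 ?Z (\<lambda>z. ?w z * W i z)" for i
    by (rule Ck_on_mult[OF oZ w W])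
  have CkF: "Ck_on 1 UNIV (F i)" for i
  proof -
    have "Ck_on 1 ?Z (F i)"
      using prod[of i] Ck_on_cong[OF oZ, of "F i" "\<lambda>z. ?w z * W i z" 1] by (simp add: F_def)
    moreover have "open (- ?K)" using K compact_imp_closed by blast
    moreover from this have "Ck_on 1 (- ?K) (F i)"
      using Ck_on_cong[of "- ?K" "F i" "\<lambda>_. 0" 1] F0 Ck_on_const[of 1 "- ?K" 0] by auto
    ultimately have "Ck_on 1 (\<Union>{?Z, - ?K}) (F i)"
      using oZ by (intro Ck_on_Union) auto
    moreover have "\<Union>{?Z, - ?K} = UNIV" using KZ by auto
    ultimately show ?thesis by simp
  qed
  have dif: "?w differentiable (at z)" "W i differentiable (at z)" "(\<lambda>z. ?w z * W i z) differentiable (at z)"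
    if "z \<in> ?Z" for z i
    using w[of "Suc 0"] W[of i] prod[of i] that by simp_all
  have pdF: "pd_z i (F i) z = indicator ?Z z *\<^sub>R (pd_z i ?w z * W i z + ?w z * pd_z i (W i) z)" for i z
  proof (cases "z \<in> ?Z")
    case True
    have "pd_z i (\<lambda>z. ?w z * W i z) z = pd_z i (F i) z"
      by (rule pd_cong[OF oZ True]) (use dif[OF True] in \<open>auto simp: F_def\<close>)
    then show ?thesis using True dif[OF True] by (simp add: pd_mult)
  next
    case False
    then have "z \<notin> ?K" using KZ by blast
    then have "frechet_derivative (F i) (at z) = (\<lambda>_. 0)"
      using F0 by (intro frechet_derivative_zero_outside[OF compact_imp_closed[OF K]]) auto
    then show ?thesis using False by (simp add: pd_z_def)
  qed
  have int1: "set_integrable lborel ?Z (\<lambda>z. \<Sum>i\<in>UNIV. pd_z i ?w z * W i z)"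
  proof (rule set_integrable_supported[OF c compactin_weight_support weight_support_subset[OF c] _ _ KZ order_refl])
    show "continuous_on ?Z (\<lambda>z. \<Sum>i\<in>UNIV. pd_z i ?w z * W i z)"
      using Ck_on_pd(1)[OF oZ w] Ck_on_imp_continuous_on[OF W]
      by (intro continuous_intros) (auto intro: Ck_on_imp_continuous_on)
    show "supported_in (weight_support c) c (\<lambda>z. \<Sum>i\<in>UNIV. pd_z i ?w z * W i z)"
      using c by (simp add: supported_in_def pd_weight_zero)
  qed
  have int2: "set_integrable lborel ?Z (\<lambda>z. ?w z * (\<Sum>i\<in>UNIV. pd_z i (W i) z))"
  proof (rule set_integrable_supported[OF c compactin_weight_support weight_support_subset[OF c] _ _ KZ order_refl])
    have "Ck_on 0 ?Z (pd_z i (W i))" for i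
      using W[of i] by (intro Ck_on_pd(1)[OF oZ]) simp
    then show "continuous_on ?Z (\<lambda>z. ?w z * (\<Sum>i\<in>UNIV. pd_z i (W i) z))"
      using Ck_on_imp_continuous_on[OF w] by (intro continuous_on_mult continuous_on_sum) auto
    show "supported_in (weight_support c) c (\<lambda>z. ?w z * (\<Sum>i\<in>UNIV. pd_z i (W i) z))"
      using c by (simp add: supported_in_def weight_zero)
  qed
  have intF: "integrable lborel (pd_z i (F i))" for i
  proof (rule integrable_continuous_compact_support[OF K])
    have "Ck_on 0 UNIV (pd_z i (F i))" using CkF[of i] by (intro Ck_on_pd(1)) auto
    then show "continuous_on ?K (pd_z i (F i))" by (auto intro: continuous_on_subset)
    show "pd_z i (F i) z = 0" if "z \<notin> ?K" for z
      using frechet_derivative_zero_outside[OF compact_imp_closed[OF K] F0 that] by (simp add: pd_z_def)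
  qed
  have "0 = (\<Sum>i\<in>UNIV. \<integral>z. pd_z i (F i) z \<partial>lborel)"
    using integral_pd_z_compact_support[OF CkF K F0] by simp
  also have "\<dots> = (\<integral>z. (\<Sum>i\<in>UNIV. pd_z i (F i) z) \<partial>lborel)"
    using intF by simp
  also have "\<dots> = (LINT z:?Z|lborel. (\<Sum>i\<in>UNIV. pd_z i ?w z * W i z) + ?w z * (\<Sum>i\<in>UNIV. pd_z i (W i) z))"
    unfolding set_lebesgue_integral_def pdF
    by (rule Bochner_Integration.integral_cong[OF refl])
      (simp add: sum.distrib sum_distrib_left indicator_def)
  also have "\<dots> = (LINT z:?Z|lborel. (\<Sum>i\<in>UNIV. pd_z i ?w z * W i z)) +
      (LINT z:?Z|lborel. ?w z * (\<Sum>i\<in>UNIV. pd_z i (W i) z))"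
    by (rule set_integral_add(2)[OF int1 int2])
  finally show ?thesis by (simp add: eq_neg_iff_add_eq_0 add.commute)
qed

text \<open>Stokes' theorem. The assumed law is that of a vector field of densities; it makes the pairing with the
  differential of a function a scalar density.\<close>

theorem integral_divergence_zero:
  assumes W: "\<And>c i. c \<in> A \<Longrightarrow> Ck_on 1 (chart_image c) (W c i)"
    and law: "\<And>c d z k. c \<in> A \<Longrightarrow> d \<in> A \<Longrightarrow> z \<in> overlap c d \<Longrightarrow>
      (\<Sum>i\<in>UNIV. jac c d z i k * W c i z) = of_real ((cmod (jac_det c d z))\<^sup>2) * W d k (transition c d z)"
  shows "(\<Sum>c\<in>active. LINT z:chart_image c|lborel. weight c c z * (\<Sum>i\<in>UNIV. pd_z i (W c i) z)) = 0"
proof -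
  \<comment> \<open>the pairing of \<open>\<partial>\<rho>\<^sub>d\<close> with the field, in the chart \<open>c\<close>\<close>
  define \<theta> where "\<theta> = (\<lambda>d c z. \<Sum>i\<in>UNIV. pd_z i (weight d c) z * W c i z)"
  have cont\<theta>: "continuous_on (chart_image c) (\<theta> d c)" if "c \<in> A" "d \<in> A" for c d
    unfolding \<theta>_def
    using Ck_on_pd(1)[OF open_chart_image[OF that(1)] Ck_on_local_fun[OF smooth_weight[OF that(2)] that(1)]]
      Ck_on_imp_continuous_on[OF W[OF that(1)]]
    by (intro continuous_intros) (auto intro: Ck_on_imp_continuous_on)
  have supp\<theta>: "\<theta> d c z = 0" if "c \<in> A" "z \<in> chart_image c" "chart_inv c z \<notin> weight_support d" for c d z
    using that by (simp add: \<theta>_def pd_weight_zero)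
  have law\<theta>: "\<theta> e c z = of_real ((cmod (jac_det c d z))\<^sup>2) * \<theta> e d (transition c d z)"
    if "c \<in> A" "d \<in> A" "e \<in> A" "z \<in> overlap c d" for c d e z
  proof -
    have "\<theta> e c z = (\<Sum>i\<in>UNIV. \<Sum>k\<in>UNIV. pd_z k (weight e d) (transition c d z) * (jac c d z i k * W c i z))"
      unfolding \<theta>_def pd_local_fun_transition(1)[OF that(1,2) smooth_weight[OF that(3)] that(4)]
      by (simp add: sum_distrib_right mult.assoc)
    also have "\<dots> = (\<Sum>k\<in>UNIV. pd_z k (weight e d) (transition c d z) * (\<Sum>i\<in>UNIV. jac c d z i k * W c i z))"
      by (subst sum.swap) (simp add: sum_distrib_left)
    also have "\<dots> = of_real ((cmod (jac_det c d z))\<^sup>2) * \<theta> e d (transition c d z)"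
      unfolding law[OF that(1,2,4)] \<theta>_def by (simp add: sum_distrib_left mult_ac)
    finally show ?thesis .
  qed
  have dens: "scalar_density (\<lambda>c z. weight d c z * \<theta> e c z)" if "d \<in> A" "e \<in> A" for d e
    unfolding scalar_density_def
  proof (intro conjI ballI)
    fix c assume "c \<in> A"
    then show "continuous_on (chart_image c) (\<lambda>z. weight d c z * \<theta> e c z)"
      using that cont\<theta> Ck_on_imp_continuous_on[OF Ck_on_local_fun[OF smooth_weight]]
      by (intro continuous_on_mult) auto
  next
    fix c f z assume "c \<in> A" "f \<in> A" "z \<in> overlap c f"
    then show "weight d c z * \<theta> e c z = of_real ((cmod (jac_det c f z))\<^sup>2) *
        (weight d f (transition c f z) * \<theta> e f (transition c f z))"
      using that by (simp add: chart_inv_transition law\<theta>)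
  qed
  have supp: "supported_in (weight_support d \<inter> weight_support e) c (\<lambda>z. weight d c z * \<theta> e c z)"
    if "c \<in> A" for c d e
    unfolding supported_in_def using supp\<theta>[OF that, of _ e] weight_zero[OF that, of _ d] by auto
  have compact_supp: "compactin X (weight_support d \<inter> weight_support e)" for d e
    unfolding weight_support_def by (intro closedin_compact_space compact_X closedin_Int closedin_closure_of)
  have int: "set_integrable lborel (chart_image c) (\<lambda>z. weight d c z * \<theta> e c z)"
    if "c \<in> A" "d \<in> A" "e \<in> A" "c = d \<or> c = e" for c d e
  proof (rule set_integrable_supported[OF that(1) compact_supp _ _ supp[OF that(1)]])
    show "weight_support d \<inter> weight_support e \<subseteq> fst c" using that weight_support_subset by blast
    then show "snd c ` (weight_support d \<inter> weight_support e) \<subseteq> chart_image c"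
      by (auto simp: chart_image_def)
    show "continuous_on (chart_image c) (\<lambda>z. weight d c z * \<theta> e c z)"
      using dens[OF that(2,3)] that(1) by (simp add: scalar_density_def)
  qed simp
  \<comment> \<open>integrate by parts in \<open>c\<close>, insert \<open>1 = \<Sum>\<^sub>d \<rho>\<^sub>d\<close>, and move the term with \<open>\<rho>\<^sub>d\<close> to the chart \<open>d\<close>\<close>
  have step: "(LINT z:chart_image c|lborel. weight c c z * (\<Sum>i\<in>UNIV. pd_z i (W c i) z)) =
      - (\<Sum>d\<in>active. LINT z:chart_image d|lborel. weight d d z * \<theta> c d z)" if c: "c \<in> active" for c
  proof -
    have cA: "c \<in> A" using c active_subset by auto
    have "(LINT z:chart_image c|lborel. \<theta> c c z) =
        (LINT z:chart_image c|lborel. (\<Sum>d\<in>active. weight d c z * \<theta> c c z))"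
      unfolding set_lebesgue_integral_def
      by (rule Bochner_Integration.integral_cong)
        (auto simp: indicator_def sum_weight[OF cA] simp flip: sum_distrib_right)
    also have "\<dots> = (\<Sum>d\<in>active. LINT z:chart_image c|lborel. weight d c z * \<theta> c c z)"
      using int[OF cA _ cA] active_subset
      unfolding set_lebesgue_integral_def set_integrable_def scaleR_sum_right
      by (intro Bochner_Integration.integral_sum) auto
    also have "\<dots> = (\<Sum>d\<in>active. LINT z:chart_image d|lborel. weight d d z * \<theta> c d z)"
    proof (rule sum.cong[OF refl])
      fix d assume "d \<in> active"
      then have d: "d \<in> A" using active_subset by auto
      show "(LINT z:chart_image c|lborel. weight d c z * \<theta> c c z) = (LINT z:chart_image d|lborel. weight d d z * \<theta> c d z)"
        by (rule integral_density_change_chart[OF dens[OF d cA] cA d compact_supp _ supp[OF cA] supp[OF d]])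
          (use weight_support_subset cA d in blast)
    qed
    finally show ?thesis
      unfolding \<theta>_def using integral_weighted_divergence[OF cA W[OF cA]] by simp
  qed
  have "(\<Sum>c\<in>active. LINT z:chart_image c|lborel. weight c c z * (\<Sum>i\<in>UNIV. pd_z i (W c i) z)) =
      - (\<Sum>c\<in>active. \<Sum>d\<in>active. LINT z:chart_image d|lborel. weight d d z * \<theta> c d z)"
    by (simp add: step sum_negf)
  also have "\<dots> = - (\<Sum>d\<in>active. \<Sum>c\<in>active. LINT z:chart_image d|lborel. weight d d z * \<theta> c d z)"
    by (subst sum.swap) simp
  also have "(\<Sum>d\<in>active. \<Sum>c\<in>active. LINT z:chart_image d|lborel. weight d d z * \<theta> c d z) = 0"
  proof (rule sum.neutral, rule ballI)
    fix d assume "d \<in> active"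
    then have d: "d \<in> A" using active_subset by auto
    \<comment> \<open>the derivative of the constant function \<open>\<Sum>\<^sub>c \<rho>\<^sub>c\<close>\<close>
    have zero: "(\<Sum>c\<in>active. \<theta> c d z) = 0" if z: "z \<in> chart_image d" for z
    proof -
      have dw: "weight c d differentiable (at z)" if "c \<in> active" for c
        using Ck_on_local_fun[OF smooth_weight d, of c "Suc 0"] that z active_subset by auto
      have "pd_z i (\<lambda>w. \<Sum>c\<in>active. weight c d w) z = pd_z i (\<lambda>w. 1) z" for i
        by (rule pd_cong(1)[OF open_chart_image[OF d] z sum_weight[OF d]])
          (use dw finite_active in \<open>auto intro!: differentiable_sum\<close>)
      then have "(\<Sum>c\<in>active. pd_z i (weight c d) z) = 0" for i
        using dw by (simp add: pd_sum pd_const)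
      moreover have "(\<Sum>c\<in>active. \<theta> c d z) = (\<Sum>i\<in>UNIV. (\<Sum>c\<in>active. pd_z i (weight c d) z) * W d i z)"
        unfolding \<theta>_def by (subst sum.swap) (simp add: sum_distrib_right)
      ultimately show ?thesis by simp
    qed
    have "(\<Sum>c\<in>active. LINT z:chart_image d|lborel. weight d d z * \<theta> c d z) =
        (LINT z:chart_image d|lborel. (\<Sum>c\<in>active. weight d d z * \<theta> c d z))"
      using int[OF d d] active_subset
      unfolding set_lebesgue_integral_def set_integrable_def scaleR_sum_right
      by (intro Bochner_Integration.integral_sum[symmetric]) auto
    also have "\<dots> = (LINT z:chart_image d|lborel. 0)"
      unfolding set_lebesgue_integral_def
      by (rule Bochner_Integration.integral_cong)
        (auto simp: indicator_def zero simp flip: sum_distrib_left)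
    finally show "(\<Sum>c\<in>active. LINT z:chart_image d|lborel. weight d d z * \<theta> c d z) = 0"
      by (simp add: set_lebesgue_integral_def)
  qed
  finally show ?thesis by simp
qed

end

section \<open>Exterior algebra in two complex dimensions\<close>

lemma shuffle_sign_empty [simp]: "shuffle_sign {} K = 1" "shuffle_sign I {} = 1"
  by (simp_all add: shuffle_sign_def)

lemma sum_sum_delta:
  assumes "finite S" "finite T"
  shows "(\<Sum>K\<in>S. \<Sum>L\<in>T. (if K = K0 \<and> L = L0 then f K L else 0)) =
    (if K0 \<in> S \<and> L0 \<in> T then f K0 L0 else (0::'a::comm_monoid_add))"
proof -
  have "(\<Sum>L\<in>T. (if K = K0 \<and> L = L0 then f K L else 0)) = (if K = K0 then (if L0 \<in> T then f K0 L0 else 0) else 0)" for K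
    using assms by (cases "K = K0") simp_all
  then show ?thesis using assms by simp
qed

text \<open>A factor with a single coefficient leaves one term in the sum defining the product.\<close>

lemma ext_wedge_axis:
  "ext_wedge (axis (K, L) r) b $ (I, J) =
    (if K \<subseteq> I \<and> L \<subseteq> J then (- 1) ^ (card L * card (I - K)) * shuffle_sign K (I - K) * shuffle_sign L (J - L) *
       r * b $ (I - K, J - L) else 0)"
proof -
  have "ext_wedge (axis (K, L) r) b $ (I, J) = (\<Sum>K'\<in>Pow I. \<Sum>L'\<in>Pow J. (if K' = K \<and> L' = L then
      (- 1) ^ (card L' * card (I - K')) * shuffle_sign K' (I - K') * shuffle_sign L' (J - L') *
       r * b $ (I - K', J - L') else 0))"
    unfolding ext_wedge_def by (auto simp: axis_def intro!: sum.cong)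
  then show ?thesis by (simp only: sum_sum_delta finite_Pow_iff finite Pow_iff)
qed

lemma ext_wedge_scalar: "ext_wedge (axis ({}, {}) r) b = r *s b"
  by (simp add: vec_eq_iff ext_wedge_axis split_paired_All)

lemma ext_wedge_dz:
  "ext_wedge (ext_dz i) b $ (I, J) = (if i \<in> I then shuffle_sign {i} (I - {i}) * b $ (I - {i}, J) else 0)"
  by (simp add: ext_dz_def ext_wedge_axis)

lemma ext_wedge_dzbar:
  "ext_wedge (ext_dzbar j) b $ (I, J) =
    (if j \<in> J then (- 1) ^ card I * shuffle_sign {j} (J - {j}) * b $ (I, J - {j}) else 0)"
  by (simp add: ext_dzbar_def ext_wedge_axis)

text \<open>The form \<open>\<Sum> a\<^sub>i dz\<^sup>i\<close>.\<close>

definition form10 :: "('n::finite \<Rightarrow> complex) \<Rightarrow> 'n ext" where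
  "form10 a = (\<chi> IJ. \<Sum>i\<in>UNIV. if IJ = ({i}, {}) then a i else 0)"

text \<open>The form \<open>\<Sum> a\<^sub>j dzbar\<^sup>j\<close>.\<close>

definition form01 :: "('n::finite \<Rightarrow> complex) \<Rightarrow> 'n ext" where
  "form01 a = (\<chi> IJ. \<Sum>j\<in>UNIV. if IJ = ({}, {j}) then a j else 0)"

text \<open>The form \<open>\<Sum> m\<^sub>i\<^sub>j dz\<^sup>i \<and> dzbar\<^sup>j\<close>.\<close>

definition form11 :: "('n::finite \<Rightarrow> 'n \<Rightarrow> complex) \<Rightarrow> 'n ext" where
  "form11 m = (\<chi> IJ. \<Sum>i\<in>UNIV. \<Sum>j\<in>UNIV. if IJ = ({i}, {j}) then m i j else 0)"

lemma form11_component [simp]: "form11 m $ ({i}, {j}) = m i j"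
proof -
  have "form11 m $ ({i}, {j}) = (\<Sum>i'\<in>UNIV. \<Sum>j'\<in>UNIV. if i' = i \<and> j' = j then m i' j' else 0)"
    unfolding form11_def by (auto intro!: sum.cong)
  then show ?thesis by (simp only: sum_sum_delta finite) simp
qed

lemma form11_zero:
  assumes "card I \<noteq> 1 \<or> card J \<noteq> 1"
  shows "form11 m $ (I, J) = 0"
proof -
  have "(if (I, J) = ({i}, {j}) then m i j else 0) = 0" for i j
    using assms by auto
  then show ?thesis unfolding form11_def by simp
qed

lemma form11_add: "form11 m + r *s form11 n = form11 (\<lambda>i j. m i j + r * n i j)"
  unfolding form11_def vec_eq_iff
  by (auto simp: sum_distrib_left simp flip: sum.distrib intro!: sum.cong)

lemma form01_component [simp]: "form01 a $ ({}, {j}) = a j"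
  by (simp add: form01_def)

lemma form01_zero: "I \<noteq> {} \<or> card J \<noteq> 1 \<Longrightarrow> form01 a $ (I, J) = 0"
  unfolding form01_def by (auto intro!: sum.neutral split: if_splits)

lemma form10_component [simp]: "form10 a $ ({i}, {}) = a i"
  by (simp add: form10_def)

lemma form10_zero: "J \<noteq> {} \<or> card I \<noteq> 1 \<Longrightarrow> form10 a $ (I, J) = 0"
  unfolding form10_def by (auto intro!: sum.neutral split: if_splits)

lemma ext_wedge_dz_dzbar: "ext_wedge (ext_dz i) (ext_dzbar j) = axis ({i}, {j}) 1"
  unfolding vec_eq_iff split_paired_All
  by (auto simp: ext_wedge_dz ext_dzbar_def axis_def)

lemma associated_form_eq: "associated_form g c z = form11 (\<lambda>i j. \<i> * g c z $ i $ j)"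
  unfolding associated_form_def form11_def ext_wedge_dz_dzbar vec_eq_iff
  by (auto simp: axis_def sum_distrib_left if_distrib cong: if_cong intro!: sum.cong)

lemma fun_form_component: "fun_form u c z $ (I, J) = (if I = {} \<and> J = {} then of_real (u (chart_inv c z)) else 0)"
  by (auto simp: fun_form_def axis_def)

lemma delbar_fun_form:
  fixes c :: "('a, 'n::{finite,linorder}) chart"
  shows "delbar (fun_form u) c z = form01 (\<lambda>j. pd_zbar j (\<lambda>w. of_real (u (chart_inv c w))) z)"
  unfolding vec_eq_iff split_paired_All
proof (intro allI)
  fix I J :: "'n set"
  have "delbar (fun_form u) c z $ (I, J) =
      (\<Sum>j\<in>UNIV. if j \<in> J then (- 1) ^ card I * shuffle_sign {j} (J - {j}) *
         pd_zbar j (\<lambda>w. if I = {} \<and> J - {j} = {} then of_real (u (chart_inv c w)) else 0) z else 0)"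
    unfolding delbar_def by (simp add: ext_wedge_dzbar fun_form_component cong: if_cong)
  also have "\<dots> = (\<Sum>j\<in>UNIV. if (I, J) = ({}, {j}) then pd_zbar j (\<lambda>w. of_real (u (chart_inv c w))) z else 0)"
  proof (intro sum.cong refl)
    fix j
    show "(if j \<in> J then (- 1) ^ card I * shuffle_sign {j} (J - {j}) *
         pd_zbar j (\<lambda>w. if I = {} \<and> J - {j} = {} then of_real (u (chart_inv c w)) else 0) z else 0) =
        (if (I, J) = ({}, {j}) then pd_zbar j (\<lambda>w. of_real (u (chart_inv c w))) z else 0)"
    proof (cases "j \<in> J \<and> \<not> (I = {} \<and> J = {j})")
      case True
      then have 1: "(I = {} \<and> J - {j} = {}) = False" and 2: "(I, J) \<noteq> ({}, {j})" by blast+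
      show ?thesis using 2 by (simp only: 1 if_False if_cancel) (simp add: pd_zbar_def)
    next
      case False
      show ?thesis
      proof (cases "j \<in> J")
        case True
        with False have "I = {} \<and> J = {j}" by blast
        then show ?thesis by simp
      next
        case False
        then have "(I, J) \<noteq> ({}, {j})" by blast
        with False show ?thesis by (simp only: if_False)
      qed
    qed
  qed
  finally show "delbar (fun_form u) c z $ (I, J) =
      form01 (\<lambda>j. pd_zbar j (\<lambda>w. of_real (u (chart_inv c w))) z) $ (I, J)"
    by (simp add: form01_def)
qed

lemma del_fun_form:
  fixes c :: "('a, 'n::{finite,linorder}) chart"
  shows "del (fun_form u) c z = form10 (\<lambda>j. pd_z j (\<lambda>w. of_real (u (chart_inv c w))) z)"
  unfolding vec_eq_iff split_paired_All
proof (intro allI)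
  fix I J :: "'n set"
  have "del (fun_form u) c z $ (I, J) =
      (\<Sum>i\<in>UNIV. if i \<in> I then shuffle_sign {i} (I - {i}) *
         pd_z i (\<lambda>w. if I - {i} = {} \<and> J = {} then of_real (u (chart_inv c w)) else 0) z else 0)"
    unfolding del_def by (simp add: ext_wedge_dz fun_form_component cong: if_cong)
  also have "\<dots> = (\<Sum>i\<in>UNIV. if (I, J) = ({i}, {}) then pd_z i (\<lambda>w. of_real (u (chart_inv c w))) z else 0)"
  proof (intro sum.cong refl)
    fix j
    show "(if j \<in> I then shuffle_sign {j} (I - {j}) *
         pd_z j (\<lambda>w. if I - {j} = {} \<and> J = {} then of_real (u (chart_inv c w)) else 0) z else 0) =
        (if (I, J) = ({j}, {}) then pd_z j (\<lambda>w. of_real (u (chart_inv c w))) z else 0)"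
    proof (cases "j \<in> I \<and> \<not> (I = {j} \<and> J = {})")
      case True
      then have 1: "(I - {j} = {} \<and> J = {}) = False" and 2: "(I, J) \<noteq> ({j}, {})" by blast+
      show ?thesis using 2 by (simp only: 1 if_False if_cancel) (simp add: pd_z_def)
    next
      case False
      show ?thesis
      proof (cases "j \<in> I")
        case True
        with False have "I = {j} \<and> J = {}" by blast
        then show ?thesis by simp
      next
        case False
        then have "(I, J) \<noteq> ({j}, {})" by blast
        with False show ?thesis by (simp only: if_False)
      qed
    qed
  qed
  finally show "del (fun_form u) c z $ (I, J) =
      form10 (\<lambda>j. pd_z j (\<lambda>w. of_real (u (chart_inv c w))) z) $ (I, J)"
    by (simp add: form10_def)
qed

lemma del_delbar_fun_form:
  fixes c :: "('a, 'n::{finite,linorder}) chart"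
  shows "del (delbar (fun_form u)) c z =
    form11 (\<lambda>i j. pd_z i (pd_zbar j (\<lambda>w. of_real (u (chart_inv c w)))) z)"
  unfolding vec_eq_iff split_paired_All
proof (intro allI)
  fix I J :: "'n set"
  let ?f = "\<lambda>j. pd_zbar j (\<lambda>w. of_real (u (chart_inv c w)))"
  have "del (delbar (fun_form u)) c z $ (I, J) =
      (\<Sum>i\<in>UNIV. if i \<in> I then shuffle_sign {i} (I - {i}) * pd_z i (\<lambda>w. form01 (\<lambda>j. ?f j w) $ (I - {i}, J)) z else 0)"
    unfolding del_def[of "delbar (fun_form u)"] delbar_fun_form by (simp add: ext_wedge_dz cong: if_cong)
  also have "\<dots> = (\<Sum>i\<in>UNIV. \<Sum>j\<in>UNIV. if (I, J) = ({i}, {j}) then pd_z i (?f j) z else 0)"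
  proof (intro sum.cong refl)
    fix i
    show "(if i \<in> I then shuffle_sign {i} (I - {i}) * pd_z i (\<lambda>w. form01 (\<lambda>j. ?f j w) $ (I - {i}, J)) z else 0) =
        (\<Sum>j\<in>UNIV. if (I, J) = ({i}, {j}) then pd_z i (?f j) z else 0)"
    proof (cases "\<exists>j. I = {i} \<and> J = {j}")
      case True
      then show ?thesis by auto
    next
      case False
      then have "(\<lambda>w. form01 (\<lambda>j. ?f j w) $ (I - {i}, J)) = (\<lambda>_. 0)" if "i \<in> I"
        using that by (intro ext form01_zero) (auto simp: card_1_singleton_iff)
      then have "(if i \<in> I then shuffle_sign {i} (I - {i}) * pd_z i (\<lambda>w. form01 (\<lambda>j. ?f j w) $ (I - {i}, J)) z else 0) = 0"
        by (cases "i \<in> I") (simp_all add: pd_z_def)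
      moreover have "(\<Sum>j\<in>UNIV. if (I, J) = ({i}, {j}) then pd_z i (?f j) z else 0) = 0"
        using False by (intro sum.neutral) auto
      ultimately show ?thesis by simp
    qed
  qed
  finally show "del (delbar (fun_form u)) c z $ (I, J) = form11 (\<lambda>i j. pd_z i (?f j) z) $ (I, J)"
    by (simp add: form11_def)
qed

text \<open>In the index type \<open>2\<close> the numeral \<open>2\<close> is zero, so it precedes \<open>1\<close>; this fixes all signs below.\<close>

lemma less_2: "(2::2) < 1" "\<not> (1::2) < 2"
proof -
  have "(2::2) = 0" by simp
  then show "(2::2) < 1" "\<not> (1::2) < 2"
    by (simp_all only: less_bit0_def bit0.Rep_0 bit0.Rep_1)
qed

lemma shuffle_sign_2: "shuffle_sign {1} {2::2} = - 1" "shuffle_sign {2} {1::2} = 1"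
proof -
  have *: "{(i, k). i \<in> {1} \<and> k \<in> {2::2} \<and> k < i} = {(1, 2)}" "{(i, k). i \<in> {2} \<and> k \<in> {1::2} \<and> k < i} = {}"
    using less_2 by auto
  then show "shuffle_sign {1} {2::2} = - 1" "shuffle_sign {2} {1::2} = 1"
    unfolding shuffle_sign_def * by simp_all
qed

lemma sum_Pow_2: "(\<Sum>K\<in>Pow (UNIV::2 set). f K) = f {} + f {1} + f {2} + f UNIV"
proof -
  have Pow: "Pow (UNIV::2 set) = {{}, {1}, {2}, UNIV}"
    unfolding UNIV_2 by (auto simp: Pow_insert)
  have "{1::2} \<noteq> UNIV" "{2::2} \<noteq> UNIV" "{1::2} \<noteq> {2}" "{} \<noteq> (UNIV::2 set)"
    unfolding UNIV_2 by auto
  then show ?thesis unfolding Pow by (simp add: add.assoc)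
qed

lemma UNIV_2_diff: "UNIV - {1::2} = {2}" "UNIV - {2::2} = {1}"
  unfolding UNIV_2 by auto

text \<open>The polarized determinant of the two coefficient matrices.\<close>

lemma wedge_top_11_11:
  "ext_wedge (form11 m) (form11 n) $ (UNIV, UNIV :: 2 set) =
    - (m 1 1 * n 2 2 + m 2 2 * n 1 1 - m 1 2 * n 2 1 - m 2 1 * n 1 2)"
proof -
  have zero: "form11 m $ ({}, J) = 0" "form11 m $ (I, {}) = 0" "form11 m $ (UNIV, J) = 0" "form11 m $ (I, UNIV) = 0" for I J :: "2 set"
    by (rule form11_zero; simp)+
  show ?thesis
    unfolding ext_wedge_def vec_lambda_beta prod.case sum_Pow_2 zero UNIV_2_diff form11_component shuffle_sign_2
    by simp
qed

lemma wedge_top_01: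
  fixes a :: "2 ext"
  shows "ext_wedge a (form01 b) $ (UNIV, UNIV) = a $ (UNIV, {2}) * b 1 - a $ (UNIV, {1}) * b 2"
proof -
  have zero: "form01 b $ (I, J) = 0" if "I \<noteq> {} \<or> J = {} \<or> J = UNIV" for I J :: "2 set"
    using that by (intro form01_zero) auto
  show ?thesis
    unfolding ext_wedge_def vec_lambda_beta prod.case sum_Pow_2 UNIV_2_diff shuffle_sign_2
    by (simp add: zero)
qed

lemma wedge_top_10:
  fixes a :: "2 ext"
  shows "ext_wedge a (form10 b) $ (UNIV, UNIV) = a $ ({2}, UNIV) * b 1 - a $ ({1}, UNIV) * b 2"
proof -
  have zero: "form10 b $ (I, J) = 0" if "J \<noteq> {} \<or> I = {} \<or> I = UNIV" for I J :: "2 set"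
    using that by (intro form10_zero) auto
  show ?thesis
    unfolding ext_wedge_def vec_lambda_beta prod.case sum_Pow_2 UNIV_2_diff shuffle_sign_2
    by (simp add: zero)
qed

lemma del_form11_top:
  assumes "\<And>w. \<alpha> c w = form11 (m w)"
  shows "del \<alpha> c z $ (UNIV, {l :: 2}) = pd_z 2 (\<lambda>w. m w 1 l) z - pd_z 1 (\<lambda>w. m w 2 l) z"
  unfolding del_def assms sum_2 vector_add_component ext_wedge_dz vec_lambda_beta UNIV_2_diff shuffle_sign_2
  by simp

lemma delbar_form11_top:
  assumes "\<And>w. \<alpha> c w = form11 (m w)"
  shows "delbar \<alpha> c z $ ({k :: 2}, UNIV) = pd_zbar 1 (\<lambda>w. m w k 2) z - pd_zbar 2 (\<lambda>w. m w k 1) z"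
  unfolding delbar_def assms sum_2 vector_add_component ext_wedge_dzbar vec_lambda_beta UNIV_2_diff shuffle_sign_2
  by simp

lemma top_density_2: "top_density (a :: 2 ext) = 4 * a $ (UNIV, UNIV)"
  by (simp add: top_density_def power2_eq_square)

section \<open>Metrics, Hessians and gradient energies\<close>

lemma bounded_linear_axis: "bounded_linear (axis i :: 'w::real_normed_vector \<Rightarrow> 'w^'n)"
proof (rule bounded_linear_intro[of _ 1])
  show "norm (axis i x :: 'w^'n) \<le> norm x * 1" for x :: 'w
    by (simp add: norm_vec_def L2_set_def axis_def if_distrib if_distribR cong: if_cong)
qed (simp_all add: vec_eq_iff axis_def)

lemma Ck_on_vecI:
  fixes f :: "'v::real_normed_vector \<Rightarrow> ('w::real_normed_vector)^'n"
  assumes "open S" "\<And>i. Ck_on k S (\<lambda>x. f x $ i)"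
  shows "Ck_on k S f"
proof -
  have "f x = (\<Sum>i\<in>UNIV. axis i (f x $ i))" for x
    by (simp add: vec_eq_iff axis_def)
  moreover have "Ck_on k S (\<lambda>x. \<Sum>i\<in>UNIV. axis i (f x $ i) :: 'w^'n)"
    by (intro Ck_on_sum Ck_on_bounded_linear[OF bounded_linear_axis] assms)
  ultimately show ?thesis by (metis (no_types, lifting) ext)
qed

lemma Ck_on_component2:
  fixes f :: "'v::real_normed_vector \<Rightarrow> complex^'n^'n"
  assumes "smooth_on S f"
  shows "Ck_on k S (\<lambda>x. f x $ i $ j)"
  using assms by (auto simp: smooth_on_def
      intro!: Ck_on_bounded_linear[OF bounded_linear_vec_nth])

context compact_complex_surface
begin

definition complex_hessian :: "('a \<Rightarrow> real) \<Rightarrow> ('a, 2) chart \<Rightarrow> complex^2 \<Rightarrow> 2 \<Rightarrow> 2 \<Rightarrow> complex" where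
  "complex_hessian u c z i j = pd_z i (pd_zbar j (local_fun u c)) z"

lemma pd_local_fun_cnj:
  assumes "smooth_function A u" "c \<in> A" "z \<in> chart_image c"
  shows "cnj (pd_z i (local_fun u c) z) = pd_zbar i (local_fun u c) z"
    "cnj (pd_zbar i (local_fun u c) z) = pd_z i (local_fun u c) z"
proof -
  have "local_fun u c differentiable (at z)"
    using Ck_on_local_fun[OF assms(1,2), of "Suc 0"] assms(3) by simp
  from pd_cnj[OF this] show "cnj (pd_z i (local_fun u c) z) = pd_zbar i (local_fun u c) z"
    "cnj (pd_zbar i (local_fun u c) z) = pd_z i (local_fun u c) z" by simp_all
qed

text \<open>The coefficients of \<open>\<partial>\<partial>bar u\<close> transform as a tensor: differentiating the transformed antiholomorphic derivatives,
  the derivative of the conjugate Jacobian matrix drops out because the transition map is holomorphic.\<close>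

lemma complex_hessian_transform:
  assumes u: "smooth_function A u" and c: "c \<in> A" and d: "d \<in> A" and z: "z \<in> overlap c d"
  shows "complex_hessian u c z i j = (\<Sum>k\<in>UNIV. \<Sum>l\<in>UNIV.
    jac c d z i k * cnj (jac c d z j l) * complex_hessian u d (transition c d z) k l)"
proof -
  let ?\<tau> = "transition c d" and ?O = "overlap c d"
  have oO: "open ?O" by (rule open_overlap[OF c d])
  have zc: "z \<in> chart_image c" and tz: "?\<tau> z \<in> chart_image d"
    using z transition_in[OF c d z] by (auto simp: chart_image_def)
  have Ck\<tau>: "Ck_on k ?O (\<lambda>w. ?\<tau> w $ l)" for k l
    by (rule Ck_on_bounded_linear[OF bounded_linear_vec_nth oO smooth_transition[OF c d]])
  have jac_diff: "(\<lambda>w. jac c d w j l) differentiable (at z)" for l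
    using Ck_on_pd(1)[OF oO Ck\<tau>, of "Suc 0" j l] z by (auto simp: jac_def)
  have jac_cnj: "(\<lambda>w. cnj (jac c d w j l)) differentiable (at z)" for l
    using has_derivative_cnj[OF jac_diff[unfolded frechet_derivative_works]] by (rule differentiableI)
  \<comment> \<open>commute the derivatives and use the Cauchy-Riemann equations on the whole overlap\<close>
  have jac_hol: "pd_zbar i (\<lambda>w. jac c d w j l) z = 0" for l
  proof -
    have "pd_zbar i (\<lambda>w. jac c d w j l) z = pd_z j (pd_zbar i (\<lambda>w. ?\<tau> w $ l)) z"
      unfolding jac_def using pd_commute(2)[OF oO z Ck\<tau>] by simp
    also have "\<dots> = pd_z j (\<lambda>_. 0) z"
      by (rule pd_cong(1)[OF oO z transition_holomorphic[OF c d]])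
        (use Ck_on_pd(2)[OF oO Ck\<tau>, of "Suc 0" i l] z in auto)
    finally show ?thesis by (simp add: pd_const)
  qed
  have ubar: "pd_zbar l (local_fun u d) differentiable (at (?\<tau> z))" for l
    using Ck_on_pd(2)[OF open_chart_image[OF d] Ck_on_local_fun[OF u d], of "Suc 0" l] tz by auto
  have ubar\<tau>: "(\<lambda>w. pd_zbar l (local_fun u d) (?\<tau> w)) differentiable (at z)" for l
    using differentiable_chain_at[OF transition_differentiable[OF c d z] ubar] by (simp add: o_def)
  have "complex_hessian u c z i j =
      pd_z i (\<lambda>w. \<Sum>l\<in>UNIV. pd_zbar l (local_fun u d) (?\<tau> w) * cnj (jac c d w j l)) z"
    unfolding complex_hessian_def
    by (rule pd_cong(1)[OF oO z pd_local_fun_transition(2)[OF c d u]])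
      (use Ck_on_pd(2)[OF open_chart_image[OF c] Ck_on_local_fun[OF u c], of "Suc 0" j] zc in auto)
  also have "\<dots> = (\<Sum>l\<in>UNIV. pd_z i (\<lambda>w. pd_zbar l (local_fun u d) (?\<tau> w)) z * cnj (jac c d z j l))"
    by (simp add: pd_sum pd_mult pd_cnj ubar\<tau> jac_diff jac_cnj jac_hol)
  also have "\<dots> = (\<Sum>l\<in>UNIV. \<Sum>k\<in>UNIV.
      jac c d z i k * cnj (jac c d z j l) * complex_hessian u d (?\<tau> z) k l)"
    unfolding pd_chain_holomorphic(1)[OF transition_differentiable[OF c d z] transition_holomorphic[OF c d z] ubar]
    unfolding sum_distrib_right
    by (intro sum.cong refl) (simp add: complex_hessian_def jac_def)
  finally show ?thesis by (subst sum.swap)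
qed

lemma complex_hessian_scale:
  assumes u: "smooth_function A u" and c: "c \<in> A" and z: "z \<in> chart_image c"
  shows "complex_hessian (\<lambda>x. s * u x) c z i j = of_real s * complex_hessian u c z i j"
proof -
  have oZ: "open (chart_image c)" by (rule open_chart_image[OF c])
  have d: "local_fun u c differentiable (at w)" "pd_zbar j (local_fun u c) differentiable (at w)"
    if "w \<in> chart_image c" for w
    using Ck_on_local_fun[OF u c, of "Suc 0"] Ck_on_pd(2)[OF oZ Ck_on_local_fun[OF u c], of "Suc 0" j] that
    by simp_all
  have eq: "pd_zbar j (local_fun (\<lambda>x. s * u x) c) w = of_real s * pd_zbar j (local_fun u c) w"
    if "w \<in> chart_image c" for w
    using d(1)[OF that] by (simp add: pd_cmult)
  have "pd_z i (\<lambda>w. of_real s * pd_zbar j (local_fun u c) w) z = complex_hessian (\<lambda>x. s * u x) c z i j"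
    unfolding complex_hessian_def
    by (rule pd_cong(1)[OF oZ z eq[symmetric]]) (use d(2)[OF z] in auto)
  then show ?thesis using d(2)[OF z] by (simp add: pd_cmult complex_hessian_def)
qed

definition deformed_metric ::
  "(('a, 2) chart \<Rightarrow> complex^2 \<Rightarrow> complex^2^2) \<Rightarrow> ('a \<Rightarrow> real) \<Rightarrow> ('a, 2) chart \<Rightarrow> complex^2 \<Rightarrow> complex^2^2" where
  "deformed_metric g u c z = (\<chi> i j. g c z $ i $ j + complex_hessian u c z i j)"

lemma deformed_form_eq:
  "deformed_form (associated_form g) u c z = form11 (\<lambda>i j. \<i> * (g c z $ i $ j + complex_hessian u c z i j))"
  by (simp add: deformed_form_def form_add_def form_scale_def associated_form_eq del_delbar_fun_form
      form11_add complex_hessian_def distrib_left)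

text \<open>The form \<open>\<omega> + \<i>\<partial>\<partial>bar u\<close> of an admissible potential is again the form of a Hermitian metric, so every statement about
  metrics applies to it.\<close>

lemma hermitian_metric_deformed:
  assumes g: "hermitian_metric A g" and u: "u \<in> potentials A (associated_form g)"
  shows "hermitian_metric A (deformed_metric g u)"
  unfolding hermitian_metric_def
proof (intro conjI ballI allI)
  have smooth: "smooth_function A u" and "positive_form A (deformed_form (associated_form g) u)"
    using u by (auto simp: potentials_def)
  then obtain h where h: "\<And>c z. c \<in> A \<Longrightarrow> z \<in> chart_image c \<Longrightarrow> hermitian_pos_def (h c z) \<and>
      deformed_form (associated_form g) u c z = associated_form h c z"
    unfolding positive_form_def by blast
  fix c assume c: "c \<in> A"
  note oZ = open_chart_image[OF c]
  have "Ck_on k (chart_image c) (\<lambda>z. deformed_metric g u c z $ i $ j)" for k i j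
    unfolding deformed_metric_def vec_lambda_beta complex_hessian_def
    using g c by (intro Ck_on_add oZ Ck_on_component2 Ck_on_pd Ck_on_local_fun smooth)
      (auto simp: hermitian_metric_def)
  then show "smooth_on (chart_image c) (deformed_metric g u c)"
    using oZ unfolding smooth_on_def by (blast intro: Ck_on_vecI)
  show "hermitian_pos_def (deformed_metric g u c z)" if z: "z \<in> chart_image c" for z
  proof -
    have "form11 (\<lambda>i j. \<i> * (g c z $ i $ j + complex_hessian u c z i j)) = form11 (\<lambda>i j. \<i> * h c z $ i $ j)"
      using h[OF c z] by (simp add: deformed_form_eq associated_form_eq)
    then have "\<i> * (g c z $ i $ j + complex_hessian u c z i j) = \<i> * h c z $ i $ j" for i j
      by (metis (no_types, lifting) form11_component)
    then have "deformed_metric g u c z = h c z"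
      by (simp add: deformed_metric_def vec_eq_iff)
    then show ?thesis using h[OF c z] by simp
  qed
  fix d z i j assume d: "d \<in> A" and z: "z \<in> overlap c d"
  have "g c z $ i $ j = (\<Sum>k\<in>UNIV. \<Sum>l\<in>UNIV. jac c d z i k * cnj (jac c d z j l) * g d (transition c d z) $ k $ l)"
    using g c d z unfolding hermitian_metric_def jac_def by blast
  then show "deformed_metric g u c z $ i $ j = (\<Sum>k\<in>UNIV. \<Sum>l\<in>UNIV.
      pd_z i (\<lambda>w. transition c d w $ k) z * cnj (pd_z j (\<lambda>w. transition c d w $ l) z) *
      deformed_metric g u d (transition c d z) $ k $ l)"
    using complex_hessian_transform[OF smooth c d z, of i j]
    by (simp add: deformed_metric_def jac_def distrib_left sum.distrib)
qed

text \<open>The density of \<open>- u \<omega>\<^sub>h \<and> \<i>\<partial>\<partial>bar u\<close>.\<close>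

definition mixed_density ::
  "(('a, 2) chart \<Rightarrow> complex^2 \<Rightarrow> complex^2^2) \<Rightarrow> ('a \<Rightarrow> real) \<Rightarrow> ('a, 2) chart \<Rightarrow> complex^2 \<Rightarrow> complex"
  where
  "mixed_density h u c z = - 4 * local_fun u c z *
     (h c z $ 1 $ 1 * complex_hessian u c z 2 2 + h c z $ 2 $ 2 * complex_hessian u c z 1 1
      - h c z $ 1 $ 2 * complex_hessian u c z 2 1 - h c z $ 2 $ 1 * complex_hessian u c z 1 2)"

text \<open>The density of \<open>- \<i> u \<partial>\<omega>\<^sub>h \<and> \<partial>bar u\<close>.\<close>

definition torsion_density ::
  "(('a, 2) chart \<Rightarrow> complex^2 \<Rightarrow> complex^2^2) \<Rightarrow> ('a \<Rightarrow> real) \<Rightarrow> ('a, 2) chart \<Rightarrow> complex^2 \<Rightarrow> complex"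
  where
  "torsion_density h u c z = 4 * local_fun u c z *
     ((pd_z 1 (\<lambda>w. h c w $ 2 $ 1) z - pd_z 2 (\<lambda>w. h c w $ 1 $ 1) z) * pd_zbar 2 (local_fun u c) z
    - (pd_z 1 (\<lambda>w. h c w $ 2 $ 2) z - pd_z 2 (\<lambda>w. h c w $ 1 $ 2) z) * pd_zbar 1 (local_fun u c) z)"

text \<open>The density of \<open>\<i> \<partial>u \<and> \<partial>bar u \<and> \<omega>\<^sub>h\<close>.\<close>

definition gradient_density ::
  "(('a, 2) chart \<Rightarrow> complex^2 \<Rightarrow> complex^2^2) \<Rightarrow> ('a \<Rightarrow> real) \<Rightarrow> ('a, 2) chart \<Rightarrow> complex^2 \<Rightarrow> complex"
  where
  "gradient_density h u c z = 4 *
     (h c z $ 2 $ 2 * pd_z 1 (local_fun u c) z * pd_zbar 1 (local_fun u c) z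
    - h c z $ 2 $ 1 * pd_z 1 (local_fun u c) z * pd_zbar 2 (local_fun u c) z
    - h c z $ 1 $ 2 * pd_z 2 (local_fun u c) z * pd_zbar 1 (local_fun u c) z
    + h c z $ 1 $ 1 * pd_z 2 (local_fun u c) z * pd_zbar 2 (local_fun u c) z)"

text \<open>The form \<open>u \<omega>\<^sub>h \<and> \<partial>bar u\<close>, of type \<open>(1, 2)\<close>, written as a vector field of densities: up to a factor it is \<open>u\<close> times
  the cofactor matrix of \<open>h\<close> applied to the antiholomorphic gradient. Using cofactors avoids the inverse of \<open>h\<close>.\<close>

definition gradient_field ::
  "(('a, 2) chart \<Rightarrow> complex^2 \<Rightarrow> complex^2^2) \<Rightarrow> ('a \<Rightarrow> real) \<Rightarrow> ('a, 2) chart \<Rightarrow> 2 \<Rightarrow> complex^2 \<Rightarrow> complex"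
  where
  "gradient_field h u c i z = (4 * local_fun u c z) *
     (if i = 1 then h c z $ 2 $ 2 * pd_zbar 1 (local_fun u c) z + (- 1) * (h c z $ 2 $ 1 * pd_zbar 2 (local_fun u c) z)
      else h c z $ 1 $ 1 * pd_zbar 2 (local_fun u c) z + (- 1) * (h c z $ 1 $ 2 * pd_zbar 1 (local_fun u c) z))"

lemma metric_Ck: "hermitian_metric A h \<Longrightarrow> c \<in> A \<Longrightarrow> Ck_on k (chart_image c) (\<lambda>z. h c z $ i $ j)"
  by (rule Ck_on_component2) (simp add: hermitian_metric_def)

lemma Ck_on_gradient_field:
  assumes h: "hermitian_metric A h" and u: "smooth_function A u" and c: "c \<in> A"
  shows "Ck_on k (chart_image c) (gradient_field h u c i)"
proof -
  note oZ = open_chart_image[OF c]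
  note * = Ck_on_mult[OF oZ metric_Ck[OF h c] Ck_on_pd(2)[OF oZ Ck_on_local_fun[OF u c]]]
  have "Ck_on k (chart_image c) (\<lambda>z. (4 * local_fun u c z) *
     (h c z $ p $ q * pd_zbar r (local_fun u c) z + (- 1) * (h c z $ p' $ q' * pd_zbar r' (local_fun u c) z)))"
    for p q r p' q' r'
    by (intro Ck_on_mult[OF oZ Ck_on_mult[OF oZ Ck_on_const Ck_on_local_fun[OF u c]]
        Ck_on_add[OF oZ * Ck_on_mult[OF oZ Ck_on_const *]]])
  then show ?thesis by (cases "i = 1") (simp_all add: gradient_field_def[abs_def])
qed

text \<open>Decides the case distinction in \<open>gradient_field\<close> without rewriting the numerals of the index type elsewhere.\<close>

lemma one_neq_2: "((2::2) = 1) = False" "((1::2) = 1) = True"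
  by simp_all

text \<open>If \<open>h = J h' J\<^sup>*\<close>, then the cofactor matrix of \<open>h\<close> absorbs one Jacobian matrix and its conjugate and leaves
  the factor \<open>det J\<close> times its conjugate.\<close>

lemma gradient_field_transform:
  assumes h: "hermitian_metric A h" and u: "smooth_function A u"
    and c: "c \<in> A" and d: "d \<in> A" and z: "z \<in> overlap c d"
  shows "(\<Sum>i\<in>UNIV. jac c d z i k * gradient_field h u c i z) =
    of_real ((cmod (jac_det c d z))\<^sup>2) * gradient_field h u d k (transition c d z)"
proof -
  have hc: "h c z $ i $ j = (\<Sum>k\<in>UNIV. \<Sum>l\<in>UNIV. jac c d z i k * cnj (jac c d z j l) * h d (transition c d z) $ k $ l)" for i j
    using h c d z unfolding hermitian_metric_def jac_def by blast
  have norm: "of_real ((cmod (jac_det c d z))\<^sup>2) = jac_det c d z * cnj (jac_det c d z)"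
    by (rule complex_norm_square)
  note expand = gradient_field_def sum_2 hc pd_local_fun_transition(2)[OF c d u z]
    chart_inv_transition[OF c d z] jac_det_def one_neq_2 if_True if_False complex_cnj_mult complex_cnj_diff
  from exhaust_2[of k] show ?thesis
  proof
    assume "k = 1"
    then show ?thesis unfolding norm by (simp only: expand) (simp add: algebra_simps)
  next
    assume "k = 2"
    then show ?thesis unfolding norm by (simp only: expand) (simp add: algebra_simps)
  qed
qed

text \<open>The product rule, with one term for each factor of \<open>u \<omega>\<^sub>h \<and> \<partial>bar u\<close>.\<close>

lemma divergence_gradient_field:
  assumes h: "hermitian_metric A h" and u: "smooth_function A u"
    and c: "c \<in> A" and z: "z \<in> chart_image c"
  shows "(\<Sum>i\<in>UNIV. pd_z i (gradient_field h u c i) z) =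
    gradient_density h u c z - torsion_density h u c z - mixed_density h u c z"
proof -
  note oZ = open_chart_image[OF c]
  have d: "local_fun u c differentiable (at z)" "pd_zbar j (local_fun u c) differentiable (at z)"
    "(\<lambda>w. h c w $ i $ j) differentiable (at z)" for i j
    using Ck_on_local_fun[OF u c, of "Suc 0"] Ck_on_pd(2)[OF oZ Ck_on_local_fun[OF u c], of "Suc 0" j]
      metric_Ck[OF h c, of "Suc 0" i j] z by simp_all
  show ?thesis
    unfolding sum_2 gradient_field_def gradient_density_def torsion_density_def mixed_density_def complex_hessian_def
    by (simp only: pd_mult pd_add pd_const d differentiable_mult differentiable_add differentiable_const
        if_True if_False refl one_neq_2 simp_thms) algebra
qed

text \<open>The density is the Hermitian form of \<open>h\<close> evaluated at the holomorphic gradient rotated by a quarter turn, which turns the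
  cofactor matrix into \<open>h\<close> itself.\<close>

lemma gradient_density_nonneg:
  assumes h: "hermitian_metric A h" and u: "smooth_function A u"
    and c: "c \<in> A" and z: "z \<in> chart_image c"
  shows "0 \<le> gradient_density h u c z"
proof -
  let ?p = "\<lambda>i. pd_z i (local_fun u c) z" and ?H = "h c z"
  have H: "hermitian_pos_def ?H" using h c z by (simp add: hermitian_metric_def)
  define v :: "complex^2" where "v = (\<chi> i. if i = 1 then ?p 2 else - ?p 1)"
  define Q where "Q = (\<Sum>i\<in>UNIV. \<Sum>j\<in>UNIV. ?H $ i $ j * v $ i * cnj (v $ j))"
  have eq: "gradient_density h u c z = 4 * Q"
    unfolding gradient_density_def Q_def sum_2 v_def
    by (simp add: pd_local_fun_cnj(1)[OF u c z, symmetric] algebra_simps)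
  have sym: "cnj (?H $ i $ j) = ?H $ j $ i" for i j
    using H unfolding hermitian_pos_def_def by metis
  have "cnj Q = Q"
    unfolding Q_def sum_2 by (simp add: sym algebra_simps)
  then have "Im Q = 0" by (simp add: complex_eq_iff)
  moreover have "0 \<le> Re Q"
  proof (cases "v = 0")
    case False
    then have "0 < Re Q" using H unfolding hermitian_pos_def_def Q_def by blast
    then show ?thesis by simp
  qed (simp add: Q_def)
  ultimately show ?thesis unfolding eq by (simp add: less_eq_complex_def)
qed

end

context surface_with_partition
begin

text \<open>The integral over the surface of the top-degree form with the given local densities.\<close>

definition surface_integral :: "(('a, 2) chart \<Rightarrow> complex^2 \<Rightarrow> complex) \<Rightarrow> complex" where
  "surface_integral \<theta> = (\<Sum>c\<in>active. LINT z:chart_image c|lborel. weight c c z * \<theta> c z)"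

lemma surface_integral_cong:
  assumes "\<And>c z. c \<in> A \<Longrightarrow> z \<in> chart_image c \<Longrightarrow> \<theta> c z = \<eta> c z"
  shows "surface_integral \<theta> = surface_integral \<eta>"
  unfolding surface_integral_def set_lebesgue_integral_def
  using active_subset assms
  by (intro sum.cong refl Bochner_Integration.integral_cong) (auto simp: indicator_def)

lemma surface_integral_cmult: "surface_integral (\<lambda>c z. r * \<theta> c z) = r * surface_integral \<theta>"
  unfolding surface_integral_def set_lebesgue_integral_def
  by (simp add: sum_distrib_left mult.left_commute flip: mult_scaleR_right)

lemma weighted_integrable:
  assumes "c \<in> A" "continuous_on (chart_image c) \<theta>"
  shows "set_integrable lborel (chart_image c) (\<lambda>z. weight c c z * \<theta> z)"
proof (rule set_integrable_supported[OF assms(1) compactin_weight_support weight_support_subset[OF assms(1)]])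
  show "continuous_on (chart_image c) (\<lambda>z. weight c c z * \<theta> z)"
    using Ck_on_imp_continuous_on[OF Ck_on_local_fun[OF smooth_weight[OF assms(1)] assms(1)]] assms(2)
    by (intro continuous_on_mult) auto
  show "supported_in (weight_support c) c (\<lambda>z. weight c c z * \<theta> z)"
    using assms(1) by (simp add: supported_in_def weight_zero)
  show "snd c ` weight_support c \<subseteq> chart_image c"
    using weight_support_subset[OF assms(1)] by (auto simp: chart_image_def)
qed simp

lemma surface_integral_add:
  assumes "\<And>c. c \<in> A \<Longrightarrow> continuous_on (chart_image c) (\<theta> c)"
    and "\<And>c. c \<in> A \<Longrightarrow> continuous_on (chart_image c) (\<eta> c)"
  shows "surface_integral (\<lambda>c z. \<theta> c z + \<eta> c z) = surface_integral \<theta> + surface_integral \<eta>"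
proof -
  have "(LINT z:chart_image c|lborel. weight c c z * (\<theta> c z + \<eta> c z)) =
      (LINT z:chart_image c|lborel. weight c c z * \<theta> c z) + (LINT z:chart_image c|lborel. weight c c z * \<eta> c z)"
    if "c \<in> active" for c
    using set_integral_add(2)[OF weighted_integrable weighted_integrable, of c "\<theta> c" "\<eta> c"]
      that active_subset assms by (auto simp: distrib_left)
  then show ?thesis unfolding surface_integral_def by (simp add: sum.distrib)
qed

lemma surface_integral_cnj: "surface_integral (\<lambda>c z. cnj (\<theta> c z)) = cnj (surface_integral \<theta>)"
  unfolding surface_integral_def set_lebesgue_integral_def cnj_sum
proof (rule sum.cong[OF refl])
  fix c
  show "(\<integral>z. indicator (chart_image c) z *\<^sub>R (weight c c z * cnj (\<theta> c z)) \<partial>lborel) =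
      cnj (\<integral>z. indicator (chart_image c) z *\<^sub>R (weight c c z * \<theta> c z) \<partial>lborel)"
    using Bochner_Integration.integral_cnj[of lborel "\<lambda>z. indicator (chart_image c) z *\<^sub>R (weight c c z * \<theta> c z)"]
    by simp
qed

lemma surface_integral_nonneg:
  assumes "\<And>c z. c \<in> A \<Longrightarrow> z \<in> chart_image c \<Longrightarrow> 0 \<le> \<theta> c z"
  shows "0 \<le> surface_integral \<theta>"
proof -
  have "0 \<le> (LINT z:chart_image c|lborel. weight c c z * \<theta> c z)" if "c \<in> active" for c
  proof -
    have c: "c \<in> A" using that active_subset by auto
    let ?f = "\<lambda>z. indicator (chart_image c) z * (\<rho> c (chart_inv c z) * Re (\<theta> c z))"
    have "(LINT z:chart_image c|lborel. weight c c z * \<theta> c z) = (\<integral>z. complex_of_real (?f z) \<partial>lborel)"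
      unfolding set_lebesgue_integral_def
      using assms[OF c] by (intro Bochner_Integration.integral_cong refl)
        (auto simp: indicator_def less_eq_complex_def complex_eq_iff)
    also have "\<dots> = of_real (\<integral>z. ?f z \<partial>lborel)" by (rule integral_complex_of_real)
    also have "0 \<le> \<dots>"
    proof -
      have "0 \<le> (\<integral>z. ?f z \<partial>lborel)"
        using assms[OF c] weight_nonneg[OF c c]
        by (intro integral_nonneg_AE AE_I2) (auto simp: indicator_def less_eq_complex_def)
      then show ?thesis by (simp add: less_eq_complex_def)
    qed
    finally show ?thesis .
  qed
  then show ?thesis unfolding surface_integral_def by (intro sum_nonneg)
qed

lemma continuous_densities:
  assumes h: "hermitian_metric A h" and u: "smooth_function A u" and c: "c \<in> A"
  shows "continuous_on (chart_image c) (mixed_density h u c)"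
    "continuous_on (chart_image c) (torsion_density h u c)"
    "continuous_on (chart_image c) (gradient_density h u c)"
proof -
  note oZ = open_chart_image[OF c] and C = Ck_on_imp_continuous_on
  have 1: "continuous_on (chart_image c) (local_fun u c)"
    "continuous_on (chart_image c) (pd_z i (local_fun u c))"
    "continuous_on (chart_image c) (pd_zbar i (local_fun u c))"
    "continuous_on (chart_image c) (\<lambda>z. complex_hessian u c z i j)"
    "continuous_on (chart_image c) (\<lambda>z. h c z $ i $ j)"
    "continuous_on (chart_image c) (pd_z k (\<lambda>w. h c w $ i $ j))" for i j k
    unfolding complex_hessian_def
    by (rule C[of 0] Ck_on_pd[OF oZ] Ck_on_local_fun[OF u c] metric_Ck[OF h c])+
  show "continuous_on (chart_image c) (mixed_density h u c)"
    "continuous_on (chart_image c) (torsion_density h u c)"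
    "continuous_on (chart_image c) (gradient_density h u c)"
    unfolding mixed_density_def[abs_def] torsion_density_def[abs_def] gradient_density_def[abs_def]
    by (intro continuous_on_mult continuous_on_add continuous_on_diff continuous_on_const 1)+
qed

text \<open>Stokes' theorem for \<open>u \<omega>\<^sub>h \<and> \<partial>bar u\<close>.\<close>

lemma surface_integral_mixed_torsion:
  assumes h: "hermitian_metric A h" and u: "smooth_function A u"
  shows "surface_integral (mixed_density h u) + surface_integral (torsion_density h u) = surface_integral (gradient_density h u)"
proof -
  note cont = continuous_densities[OF h u]
  have "surface_integral (\<lambda>c z. \<Sum>i\<in>UNIV. pd_z i (gradient_field h u c i) z) = 0"
    unfolding surface_integral_def
    by (rule integral_divergence_zero[OF Ck_on_gradient_field[OF h u] gradient_field_transform[OF h u]])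
  moreover have "surface_integral (\<lambda>c z. \<Sum>i\<in>UNIV. pd_z i (gradient_field h u c i) z) =
      surface_integral (\<lambda>c z. gradient_density h u c z + (- 1) * (torsion_density h u c z + mixed_density h u c z))"
    by (rule surface_integral_cong) (simp add: divergence_gradient_field[OF h u])
  moreover have "\<dots> = surface_integral (gradient_density h u) + (- 1) * (surface_integral (torsion_density h u) + surface_integral (mixed_density h u))"
    by (simp only: surface_integral_cmult surface_integral_add cont continuous_on_add continuous_on_mult continuous_on_const)
  ultimately show ?thesis by (simp add: algebra_simps)
qed

end

section \<open>The functionals as combinations of gradient energies\<close>

text \<open>Evaluated at the vector \<open>(M\<^sub>2\<^sub>2, - M\<^sub>1\<^sub>2)\<close> the Hermitian form of \<open>M\<close> is the product of \<open>M\<^sub>2\<^sub>2 > 0\<close> with the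
  determinant.\<close>

lemma hermitian_pos_def_det_nonneg:
  fixes M :: "complex^2^2"
  assumes "hermitian_pos_def M"
  shows "0 \<le> M $ 1 $ 1 * M $ 2 $ 2 - M $ 1 $ 2 * M $ 2 $ 1"
proof -
  have sym: "cnj (M $ i $ j) = M $ j $ i" for i j
    using assms unfolding hermitian_pos_def_def by metis
  have pos: "0 < Re (\<Sum>i\<in>UNIV. \<Sum>j\<in>UNIV. M $ i $ j * v $ i * cnj (v $ j))" if "v \<noteq> 0" for v
    using assms that unfolding hermitian_pos_def_def by blast
  have real: "M $ i $ i = of_real (Re (M $ i $ i))" for i
    using sym[of i i] by (simp add: complex_eq_iff)
  define a where "a = Re (M $ 2 $ 2)"
  have M22: "M $ 2 $ 2 = of_real a" using real[of 2] by (simp add: a_def)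
  have "axis 2 1 \<noteq> (0 :: complex^2)" by (simp add: axis_eq_0_iff)
  from pos[OF this] have a: "0 < a"
    by (simp add: sum_2 axis_def a_def)
  define v :: "complex^2" where "v = (\<chi> i. if i = 1 then M $ 2 $ 2 else - M $ 1 $ 2)"
  have "v \<noteq> 0" using a M22 by (auto simp: v_def vec_eq_iff intro!: exI[of _ 1])
  define d where "d = M $ 1 $ 1 * M $ 2 $ 2 - M $ 1 $ 2 * M $ 2 $ 1"
  have "(\<Sum>i\<in>UNIV. \<Sum>j\<in>UNIV. M $ i $ j * v $ i * cnj (v $ j)) = of_real a * d"
    unfolding sum_2 v_def d_def by (simp add: sym M22 algebra_simps)
  with pos[OF \<open>v \<noteq> 0\<close>] a have "0 < Re d"
    by (simp add: zero_less_mult_iff)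
  moreover have "cnj d = d"
    unfolding d_def by (simp add: sym)
  ultimately show ?thesis
    unfolding d_def[symmetric] by (simp add: less_eq_complex_def complex_eq_iff)
qed

context compact_complex_surface
begin

text \<open>The density of \<open>- u (\<i>\<partial>\<partial>bar u)\<^sup>2\<close>.\<close>

definition hessian_density :: "('a \<Rightarrow> real) \<Rightarrow> ('a, 2) chart \<Rightarrow> complex^2 \<Rightarrow> complex" where
  "hessian_density u c z = - 8 * local_fun u c z *
     (complex_hessian u c z 1 1 * complex_hessian u c z 2 2 - complex_hessian u c z 1 2 * complex_hessian u c z 2 1)"

lemma volume_density:
  fixes g :: "('a, 2) chart \<Rightarrow> complex^2 \<Rightarrow> complex^2^2"
  shows "top_density ((associated_form g \<and>\<^sub>f associated_form g) c z) =
    8 * (g c z $ 1 $ 1 * g c z $ 2 $ 2 - g c z $ 1 $ 2 * g c z $ 2 $ 1)"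
  unfolding top_density_2 wedge_def associated_form_eq wedge_top_11_11 by (simp add: algebra_simps)

lemma pd_metric_component_differentiable:
  assumes "hermitian_metric A g" "c \<in> A" "z \<in> chart_image c"
  shows "(\<lambda>w. g c w $ i $ j) differentiable (at z)"
  using metric_Ck[OF assms(1,2), of "Suc 0" i j] assms(3) by simp

lemma torsion_density_eq:
  assumes g: "hermitian_metric A g" and c: "c \<in> A" and z: "z \<in> chart_image c"
  shows "top_density ((fun_form u \<and>\<^sub>f ((- \<i>) *\<^sub>f (del (associated_form g) \<and>\<^sub>f delbar (fun_form u)))) c z) =
    torsion_density g u c z"
proof -
  note d = pd_metric_component_differentiable[OF g c z]
  note top = del_form11_top[of "associated_form g" c "\<lambda>w i j. \<i> * g c w $ i $ j", OF associated_form_eq]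
  show ?thesis
    unfolding top_density_2 wedge_def form_scale_def fun_form_def[of u] ext_wedge_scalar delbar_fun_form[unfolded fun_form_def]
      vector_smult_component wedge_top_01 top pd_cmult[OF d] torsion_density_def
    by (simp add: algebra_simps)
qed

text \<open>The integrands of the two torsion functionals are conjugate, since \<open>\<omega>\<close> and \<open>u\<close> are real.\<close>

lemma cnj_torsion_density_eq:
  assumes g: "hermitian_metric A g" and u: "smooth_function A u" and c: "c \<in> A" and z: "z \<in> chart_image c"
  shows "top_density ((fun_form u \<and>\<^sub>f (\<i> *\<^sub>f (delbar (associated_form g) \<and>\<^sub>f del (fun_form u)))) c z) =
    cnj (torsion_density g u c z)"
proof -
  note d = pd_metric_component_differentiable[OF g c z]
  note top = delbar_form11_top[of "associated_form g" c "\<lambda>w i j. \<i> * g c w $ i $ j", OF associated_form_eq]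
  have sym: "cnj (pd_z k (\<lambda>w. g c w $ i $ j) z) = pd_zbar k (\<lambda>w. g c w $ j $ i) z" for i j k
  proof -
    have "pd_zbar k (\<lambda>w. cnj (g c w $ i $ j)) z = pd_zbar k (\<lambda>w. g c w $ j $ i) z"
    proof (rule pd_cong(2)[OF open_chart_image[OF c] z, symmetric, OF _ d])
      fix w assume "w \<in> chart_image c"
      then show "g c w $ j $ i = cnj (g c w $ i $ j)"
        using g c unfolding hermitian_metric_def hermitian_pos_def_def by blast
    qed
    then show ?thesis by (simp add: pd_cnj d)
  qed
  show ?thesis
    unfolding top_density_2 wedge_def form_scale_def fun_form_def[of u] ext_wedge_scalar del_fun_form[unfolded fun_form_def]
      vector_smult_component wedge_top_10 top pd_cmult[OF d] torsion_density_def
    by (simp add: sym pd_local_fun_cnj[OF u c z] algebra_simps)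
qed

text \<open>The expansion of \<open>\<omega>\<^sup>2 - (\<omega> + s \<i>\<partial>\<partial>bar u)\<^sup>2\<close> in powers of \<open>s\<close>.\<close>

lemma energy_density_eq:
  fixes g :: "('a, 2) chart \<Rightarrow> complex^2 \<Rightarrow> complex^2^2"
    and s :: real
  assumes u: "smooth_function A u" and c: "c \<in> A" and z: "z \<in> chart_image c"
  defines "\<omega> \<equiv> associated_form g" and "\<omega>' \<equiv> deformed_form (associated_form g) (\<lambda>x. s * u x)"
  shows "top_density ((fun_form u \<and>\<^sub>f (\<omega> \<and>\<^sub>f \<omega> -\<^sub>f \<omega>' \<and>\<^sub>f \<omega>')) c z) =
    of_real (2 * s) * mixed_density g u c z + of_real (s\<^sup>2) * hessian_density u c z"
  unfolding top_density_2 wedge_def form_diff_def fun_form_def[of u] ext_wedge_scalar \<omega>_def \<omega>'_def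
    deformed_form_eq associated_form_eq[of g] vector_smult_component vector_minus_component wedge_top_11_11
    complex_hessian_scale[OF u c z] mixed_density_def hessian_density_def
  by (simp add: power2_eq_square algebra_simps)

lemma mixed_density_deformed:
  "mixed_density (deformed_metric g u) u c z = mixed_density g u c z + hessian_density u c z"
  unfolding mixed_density_def hessian_density_def deformed_metric_def by (simp add: algebra_simps)

text \<open>The form \<open>\<partial>\<omega>\<close> does not change when \<open>\<i>\<partial>\<partial>bar u\<close> is added to \<open>\<omega>\<close>: the operator \<open>\<partial>\<close> annihilates \<open>\<partial>\<partial>bar u\<close>, as holomorphic derivatives
  commute.\<close>

lemma torsion_density_deformed:
  assumes g: "hermitian_metric A g" and u: "smooth_function A u" and c: "c \<in> A" and z: "z \<in> chart_image c"
  shows "torsion_density (deformed_metric g u) u c z = torsion_density g u c z"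
proof -
  note oZ = open_chart_image[OF c] and d = pd_metric_component_differentiable[OF g c z]
  have ubar: "Ck_on k (chart_image c) (pd_zbar l (local_fun u c))" for k l
    by (rule Ck_on_pd(2)[OF oZ Ck_on_local_fun[OF u c]])
  have hd: "(\<lambda>w. complex_hessian u c w i j) differentiable (at z)" for i j
    using Ck_on_pd(1)[OF oZ ubar, of "Suc 0" i j] z by (simp add: complex_hessian_def)
  have "pd_z 1 (\<lambda>w. complex_hessian u c w 2 l) z = pd_z 2 (\<lambda>w. complex_hessian u c w 1 l) z" for l
    unfolding complex_hessian_def using pd_commute(1)[OF oZ z ubar] by simp
  then show ?thesis
    unfolding torsion_density_def deformed_metric_def
    by (simp add: pd_add d hd)
qed

lemma cnj_complex_hessian:
  assumes u: "smooth_function A u" and c: "c \<in> A" and z: "z \<in> chart_image c"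
  shows "cnj (complex_hessian u c z i j) = complex_hessian u c z j i"
proof -
  note oZ = open_chart_image[OF c]
  have d: "pd_zbar j (local_fun u c) differentiable (at z)" "pd_z j (local_fun u c) differentiable (at z)"
    using Ck_on_pd[OF oZ Ck_on_local_fun[OF u c], of "Suc 0" j] z by simp_all
  have "cnj (complex_hessian u c z i j) = pd_zbar i (\<lambda>w. cnj (pd_zbar j (local_fun u c) w)) z"
    unfolding complex_hessian_def using d by (simp add: pd_cnj)
  also have "\<dots> = pd_zbar i (pd_z j (local_fun u c)) z"
    by (rule pd_cong(2)[OF oZ z _ d(2), symmetric]) (simp add: pd_local_fun_cnj[OF u c])
  also have "\<dots> = complex_hessian u c z j i"
    unfolding complex_hessian_def using pd_commute(2)[OF oZ z Ck_on_local_fun[OF u c]] by simp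
  finally show ?thesis .
qed

lemma cnj_mixed_density:
  assumes g: "hermitian_metric A g" and u: "smooth_function A u" and c: "c \<in> A" and z: "z \<in> chart_image c"
  shows "cnj (mixed_density g u c z) = mixed_density g u c z"
proof -
  have "cnj (g c z $ i $ j) = g c z $ j $ i" for i j
    using g c z unfolding hermitian_metric_def hermitian_pos_def_def by metis
  then show ?thesis
    unfolding mixed_density_def by (simp add: cnj_complex_hessian[OF u c z] algebra_simps)
qed

end

context surface_with_partition
begin

lemma form_integral_eq_surface_integral:
  assumes "\<rho> = (SOME \<rho>. finite_partition_of_unity X A \<rho>)"
  shows "form_integral X A \<alpha> = surface_integral (\<lambda>c z. top_density (\<alpha> c z))"
  unfolding form_integral_def surface_integral_def assms[symmetric] by (simp add: Let_def)

lemma continuous_hessian_density: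
  assumes u: "smooth_function A u" and c: "c \<in> A"
  shows "continuous_on (chart_image c) (hessian_density u c)"
proof -
  note oZ = open_chart_image[OF c] and C = Ck_on_imp_continuous_on
  have 1: "continuous_on (chart_image c) (local_fun u c)"
    "continuous_on (chart_image c) (\<lambda>z. complex_hessian u c z i j)" for i j
    unfolding complex_hessian_def
    by (rule C[of 0] Ck_on_pd[OF oZ] Ck_on_local_fun[OF u c])+
  show ?thesis unfolding hessian_density_def[abs_def]
    by (intro continuous_on_mult continuous_on_diff continuous_on_const 1)
qed

lemma form_integral_energy:
  fixes g :: "('a, 2) chart \<Rightarrow> complex^2 \<Rightarrow> complex^2^2"
  assumes \<rho>: "\<rho> = (SOME \<rho>. finite_partition_of_unity X A \<rho>)"
    and g: "hermitian_metric A g" and u: "smooth_function A u"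
  defines "\<omega> \<equiv> associated_form g"
  shows "form_integral X A (fun_form u \<and>\<^sub>f (\<omega> \<and>\<^sub>f \<omega> -\<^sub>f
      deformed_form \<omega> (\<lambda>x. s * u x) \<and>\<^sub>f deformed_form \<omega> (\<lambda>x. s * u x))) =
    of_real (2 * s) * surface_integral (mixed_density g u) + of_real (s\<^sup>2) * surface_integral (hessian_density u)"
proof -
  have "form_integral X A (fun_form u \<and>\<^sub>f (\<omega> \<and>\<^sub>f \<omega> -\<^sub>f
      deformed_form \<omega> (\<lambda>x. s * u x) \<and>\<^sub>f deformed_form \<omega> (\<lambda>x. s * u x))) =
    surface_integral (\<lambda>c z. of_real (2 * s) * mixed_density g u c z + of_real (s\<^sup>2) * hessian_density u c z)"
    unfolding form_integral_eq_surface_integral[OF \<rho>] \<omega>_def by (rule surface_integral_cong) (rule energy_density_eq[OF u])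
  also have "\<dots> = of_real (2 * s) * surface_integral (mixed_density g u) + of_real (s\<^sup>2) * surface_integral (hessian_density u)"
    using continuous_densities(1)[OF g u] continuous_hessian_density[OF u]
    by (simp only: surface_integral_add surface_integral_cmult continuous_on_mult continuous_on_const)
  finally show ?thesis .
qed

text \<open>The integrals \<open>P\<close>, \<open>Q\<close> and \<open>T\<close> are eliminated with the two identities \<open>P + T = E\<close> and \<open>P + Q + T = E'\<close>. Dividing
  by \<open>V = 0\<close> gives zero on both sides of the formulas.\<close>

lemma functionals_as_gradient_energies:
  assumes \<rho>: "\<rho> = (SOME \<rho>. finite_partition_of_unity X A \<rho>)"
    and g: "hermitian_metric A g" and u: "u \<in> potentials A (associated_form g)"
  obtains V E E' where "0 \<le> V" "0 \<le> E" "0 \<le> E'"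
    "I_AY X A (associated_form g) u = (E + E') / V"
    "J_AY X A (associated_form g) u = (2 * E + E') / (3 * V)"
proof -
  let ?\<omega> = "associated_form g" and ?h = "deformed_metric g u"
  have smooth: "smooth_function A u" using u by (simp add: potentials_def)
  have h: "hermitian_metric A ?h" by (rule hermitian_metric_deformed[OF g u])
  define V where "V = volume X A ?\<omega>"
  define P where "P = surface_integral (mixed_density g u)"
  define Q where "Q = surface_integral (hessian_density u)"
  define T where "T = surface_integral (torsion_density g u)"
  define E where "E = surface_integral (gradient_density g u)"
  define E' where "E' = surface_integral (gradient_density ?h u)"
  have V: "0 \<le> V"
    unfolding V_def volume_def form_integral_eq_surface_integral[OF \<rho>] volume_density
  proof (rule surface_integral_nonneg)
    fix c z assume "c \<in> A" "z \<in> chart_image c"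
    then have "hermitian_pos_def (g c z)" using g by (simp add: hermitian_metric_def)
    then show "0 \<le> 8 * (g c z $ 1 $ 1 * g c z $ 2 $ 2 - g c z $ 1 $ 2 * g c z $ 2 $ 1)"
      using hermitian_pos_def_det_nonneg[of "g c z"] by (simp add: less_eq_complex_def)
  qed
  have E: "0 \<le> E" "0 \<le> E'"
    unfolding E_def E'_def using gradient_density_nonneg[OF _ smooth] g h by (auto intro!: surface_integral_nonneg)
  have PT: "P + T = E"
    unfolding P_def T_def E_def by (rule surface_integral_mixed_torsion[OF g smooth])
  have "surface_integral (mixed_density ?h u) = surface_integral (\<lambda>c z. mixed_density g u c z + hessian_density u c z)"
    by (rule surface_integral_cong) (rule mixed_density_deformed)
  also have "\<dots> = P + Q"
    unfolding P_def Q_def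
    by (intro surface_integral_add continuous_densities(1)[OF g smooth] continuous_hessian_density[OF smooth])
  finally have "surface_integral (mixed_density ?h u) = P + Q" .
  moreover have "surface_integral (torsion_density ?h u) = T"
    unfolding T_def by (rule surface_integral_cong) (rule torsion_density_deformed[OF g smooth])
  ultimately have PQT: "P + Q + T = E'"
    using surface_integral_mixed_torsion[OF h smooth] by (simp add: E'_def)
  have "cnj P = P"
    unfolding P_def surface_integral_cnj[symmetric] by (rule surface_integral_cong) (rule cnj_mixed_density[OF g smooth])
  moreover have "cnj E = E" using E by (simp add: less_eq_complex_def complex_eq_iff)
  ultimately have T_real: "cnj T = T" using PT by (metis add_diff_cancel_left' complex_cnj_diff)
  have A: "A_functional X A ?\<omega> u = T / (2 * V)"
  proof -
    have "form_integral X A (fun_form u \<and>\<^sub>f ((- \<i>) *\<^sub>f (del ?\<omega> \<and>\<^sub>f delbar (fun_form u)))) = T"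
      unfolding T_def form_integral_eq_surface_integral[OF \<rho>] by (rule surface_integral_cong) (rule torsion_density_eq[OF g])
    then show ?thesis by (simp add: A_functional_def V_def)
  qed
  have B: "B_functional X A ?\<omega> u = T / (2 * V)"
  proof -
    have "form_integral X A (fun_form u \<and>\<^sub>f (\<i> *\<^sub>f (delbar ?\<omega> \<and>\<^sub>f del (fun_form u)))) =
        surface_integral (\<lambda>c z. cnj (torsion_density g u c z))"
      unfolding form_integral_eq_surface_integral[OF \<rho>] by (rule surface_integral_cong) (rule cnj_torsion_density_eq[OF g smooth])
    also have "\<dots> = T" using T_real by (simp add: surface_integral_cnj T_def)
    finally show ?thesis by (simp add: B_functional_def V_def)
  qed
  note energy = form_integral_energy[OF \<rho> g smooth, folded P_def Q_def]
  have I: "I_AY X A ?\<omega> u = (E + E') / V"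
  proof -
    have "I_AY X A ?\<omega> u = (2 * P + Q) / V + 2 * (T / (2 * V)) + 2 * (T / (2 * V))"
      unfolding I_AY_def A B V_def[symmetric] using energy[of 1] by simp
    also have "\<dots> = (2 * P + Q + 2 * T) / V" by (cases "V = 0") (simp_all add: field_simps)
    finally show ?thesis unfolding PT[symmetric] PQT[symmetric] by (simp add: algebra_simps)
  qed
  have "((\<lambda>s. of_real (2 * s) * P + of_real (s\<^sup>2) * Q) has_integral
      ((of_real (1\<^sup>2) * P + of_real (1 ^ 3 / 3) * Q) - (of_real (0\<^sup>2) * P + of_real (0 ^ 3 / 3) * Q))) {0..1::real}"
    by (rule fundamental_theorem_of_calculus)
      (auto intro!: derivative_eq_intros simp: has_vector_derivative_def fun_eq_iff scaleR_conv_of_real algebra_simps)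
  then have int: "integral {0..1::real} (\<lambda>s. of_real (2 * s) * P + of_real (s\<^sup>2) * Q) = P + Q / 3"
    by (simp add: integral_unique)
  have J: "J_AY X A ?\<omega> u = (2 * E + E') / (3 * V)"
  proof -
    have "J_AY X A ?\<omega> u = (P + Q / 3) / V + T / (2 * V) + T / (2 * V)"
      unfolding J_AY_def A B V_def[symmetric] energy int by simp
    also have "\<dots> = (3 * P + Q + 3 * T) / (3 * V)" by (cases "V = 0") (simp_all add: field_simps)
    finally show ?thesis unfolding PT[symmetric] PQT[symmetric] by (simp add: algebra_simps)
  qed
  show thesis by (rule that[OF V E I J])
qed

end

theorem theorem1p3:
  fixes X :: "'a topology"
    and A :: "('a, 2) chart set"
    and g :: "('a, 2) chart \<Rightarrow> complex^2 \<Rightarrow> complex^2^2"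
    and \<omega> :: "('a, 2) dform"
    and \<phi> :: "'a \<Rightarrow> real"
  assumes "compact_hermitian_manifold X A g"
    and "\<omega> = associated_form g"
    and "\<phi> \<in> potentials A \<omega>"
  shows "1/3 * I_AY X A \<omega> \<phi> \<le> J_AY X A \<omega> \<phi> \<and> J_AY X A \<omega> \<phi> \<le> 2/3 * I_AY X A \<omega> \<phi>"
proof -
  interpret compact_complex_surface X A
    using assms(1) by unfold_locales (auto simp: compact_hermitian_manifold_def)
  \<comment> \<open>the partition chosen in the definition of the integral; it is a partition since one exists\<close>
  define \<rho> where "\<rho> = (SOME \<rho>. finite_partition_of_unity X A \<rho>)"
  interpret surface_with_partition X A \<rho>
    by unfold_locales (simp add: \<rho>_def finite_partition_of_unity_exists someI_ex)
  have g: "hermitian_metric A g" using assms(1) by (simp add: compact_hermitian_manifold_def)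
  obtain V E E' where *: "0 \<le> V" "0 \<le> E" "0 \<le> E'"
    "I_AY X A \<omega> \<phi> = (E + E') / V" "J_AY X A \<omega> \<phi> = (2 * E + E') / (3 * V)"
    using functionals_as_gradient_energies[OF \<rho>_def g] assms(2,3) by metis
  obtain v e e' where r: "V = complex_of_real v" "E = complex_of_real e" "E' = complex_of_real e'"
    "0 \<le> v" "0 \<le> e" "0 \<le> e'"
    using *(1-3) that[of "Re V" "Re E" "Re E'"] by (simp add: less_eq_complex_def complex_eq_iff)
  have "1/3 * I_AY X A \<omega> \<phi> = complex_of_real ((e + e') / (3 * v))"
    "J_AY X A \<omega> \<phi> = complex_of_real ((2 * e + e') / (3 * v))"
    "2/3 * I_AY X A \<omega> \<phi> = complex_of_real ((2 * e + 2 * e') / (3 * v))"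
    unfolding * r by (simp_all add: distrib_left add_divide_distrib)
  moreover have "(e + e') / (3 * v) \<le> (2 * e + e') / (3 * v)" "(2 * e + e') / (3 * v) \<le> (2 * e + 2 * e') / (3 * v)"
    using r by (auto intro!: divide_right_mono)
  ultimately show ?thesis by (simp only: less_eq_complex_def Re_complex_of_real Im_complex_of_real)
qed

end
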